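(* Let $X$ and $Y$ be finite connected multigraphs with no vertices of degree one, and let $Y/X$ be an abelian cover with automorphism group $G=\mathrm{Aut}(Y/X)$. Let $\theta_{Y/X}^{*}(1)=\sum_{\chi\in\widehat{G}} L_{Y/X}^{*}(1,\chi)\, e_{\overline{\chi}}\in\mathbb{C}[G]$, and let $e = 1 - e_{\chi_1}$, where $\chi_1$ is the trivial character of $G$. Then $$\theta_{Y/X}^{*}(1)\cdot e \in \mathrm{Ann}_{\mathbb{Z}[G]}(\mathrm{Jac}(Y)),$$ that is, $\theta_{Y/X}^{*}(1)\cdot e$ lies in $\mathbb{Z}[G]$ and annihilates the $\mathbb{Z}[G]$-module $\mathrm{Jac}(Y)$.
   Context: Multigraphs. A multigraph $X$ consists of a set $V_X$ of vertices and a multiset $E_X$ of unordered pairs of vertices (edges); loops and multiple edges are allowed. The degree $d_X(v)$ of a vertex is the number of edges incident to $v$, each loop counted twice. Covers. Multigraphs are viewed as one-dimensional CW-complexes. A cover $Y/X$ of multigraphs is a topological covering map $\pi:Y\to X$ that is a morphism of multigraphs; $\mathrm{Aut}(Y/X)$ is its group of deck transformations (which are multigraph automorphisms of $Y$). The cover is Galois if $\mathrm{Aut}(Y/X)$ acts transitively on each fiber (it acts freely), and abelian if moreover $G=\mathrm{Aut}(Y/X)$ is abelian. $\widehat{G}$ is the group of complex characters of $G$. Primes. Each edge (including a loop) has two orientations; $e^{-1}$ denotes the oriented edge $e$ with the opposite orientation. A path is a sequence of oriented edges $e_1\cdots e_m$ with the terminal vertex of $e_i$ equal to the initial vertex of $e_{i+1}$;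 its length is $m$. It is closed if its initial and terminal vertices agree. A prime path is a closed path with no backtrack ($e_{i+1}\ne e_i^{-1}$ for all $i=1,\dots,m-1$), no tail ($e_1\neq e_m^{-1}$), and which is not of the form $C^a$ with $C$ a closed path and $a\ge 2$. Two closed paths are equivalent if one is obtained from the other by a cyclic rotation of its edges. A prime $\mathfrak{p}$ of $X$ is an equivalence class of prime paths; $\nu(\mathfrak{p})$ is its length. Frobenius. For an abelian cover $Y/X$ and a prime $\mathfrak{p}$ of $X$, represent $\mathfrak p$ by a prime path starting at a vertex $v$, choose a vertex $w$ of $Y$ above $v$, lift the path to $Y$ starting at $w$, and let $w'$ be the terminal vertex of the lift. The Frobenius automorphism $\left(\frac{Y/X}{\mathfrak{p}}\right)$ is the unique $g\in G$ with $g\cdot w=w'$; it depends only on $\mathfrak{p}$. $L$-functions. For $\chi\in\widehat{G}$, $L_{Y/X}(u,\chi)=\prod_{\mathfrak{p}}\left(1-\chi\left(\left(\frac{Y/X}{\mathfrak{p}}\right)\right)u^{\nu(\mathfrak{p})}\right)^{-1}$, the product over all primes $\mathfrak p$ of $X$. It converges for $|u|$ small and $L_{Y/X}(u,\chi)^{-1}$ is a polynomial in $u$. $L_{Y/X}^{*}(1,\chi)$ denotes the first non-vanishing Taylor coefficient of $L_{Y/X}(u,\chi)^{-1}$ at $u=1$ (coefficient of the lowest power of $u-1$). Idempotents. $e_\chi=\frac{1}{|G|}\sum_{\sigma\in G}\chi(\sigma)\,\sigma^{-1}\in\mathbb{C}[G]$. Jacobian. $\mathrm{Div}(Y)$ is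 the free abelian group on $V_Y$, with its natural $G$-action; $\deg\left(\sum n_w w\right)=\sum n_w$ and $\mathrm{Div}^{\circ}(Y)=\ker(\deg)$. Let $\phi:\mathrm{Div}(Y)\to\mathrm{Div}(Y)$ be the group morphism with $\phi(w_0)=\sum_{w\in V_Y}\rho_w(w_0)\, w$, where $\rho_{w_0}(w_0)=d_Y(w_0)-2\cdot(\text{number of loops at }w_0)$ and $\rho_w(w_0)=-(\text{number of edges from }w\text{ to }w_0)$ for $w\ne w_0$. Put $\mathrm{Pr}(Y)=\phi(\mathrm{Div}(Y))\subseteq \mathrm{Div}^{\circ}(Y)$ and $\mathrm{Jac}(Y)=\mathrm{Div}^{\circ}(Y)/\mathrm{Pr}(Y)$, a finite $\mathbb{Z}[G]$-module. *)

theory Defs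
  imports
    "HOL-Analysis.Analysis"
    "HOL-Algebra.Bij"
    "HOL-Algebra.Free_Abelian_Groups"
    "Graph_Theory.Bidirected_Digraph"
    "Graph_Theory.Digraph_Component"
begin

text \<open>
  A multigraph is given by its oriented edges: a digraph \<open>G\<close> whose arcs carry a fixed-point-free
  reversal \<open>r\<close>. An (unoriented) edge is an orbit \<open>{a, r a}\<close>, so that loops and parallel edges are
  allowed and every edge, loops included, has exactly two orientations. The locale
  \<^locale>\<open>bidirected_digraph\<close> normalises \<open>r\<close> to be the identity off the arcs.
\<close>

definition finite_multigraph :: "('v, 'a) pre_digraph \<Rightarrow> ('a \<Rightarrow> 'a) \<Rightarrow> bool" where
  "finite_multigraph G r \<longleftrightarrow> fin_digraph G \<and> bidirected_digraph G r"

definition edges :: "('v, 'a) pre_digraph \<Rightarrow> ('a \<Rightarrow> 'a) \<Rightarrow> 'a set set" where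
  "edges G r = (\<lambda>a. {a, r a}) ` arcs G"

text \<open>The unordered pair of end vertices of an edge; a singleton exactly for loops.\<close>

definition ends :: "('v, 'a) pre_digraph \<Rightarrow> 'a set \<Rightarrow> 'v set" where
  "ends G E = tail G ` E"

definition loops_at :: "('v, 'a) pre_digraph \<Rightarrow> ('a \<Rightarrow> 'a) \<Rightarrow> 'v \<Rightarrow> nat" where
  "loops_at G r v = card {E \<in> edges G r. ends G E = {v}}"

definition edges_between :: "('v, 'a) pre_digraph \<Rightarrow> ('a \<Rightarrow> 'a) \<Rightarrow> 'v \<Rightarrow> 'v \<Rightarrow> nat" where
  "edges_between G r v w = card {E \<in> edges G r. ends G E = {v, w}}"

definition vdegree :: "('v, 'a) pre_digraph \<Rightarrow> ('a \<Rightarrow> 'a) \<Rightarrow> 'v \<Rightarrow> nat" where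
  "vdegree G r v = (\<Sum>E\<in>{E \<in> edges G r. v \<in> ends G E}. if ends G E = {v} then 2 else 1)"


section \<open>Covers\<close>

text \<open>
  The CW-complex of a multigraph. Its points are the vertices and the points at parameter
  \<open>0 < t < 1\<close> along an arc \<open>a\<close>, the latter being the same as the point at parameter \<open>1 - t\<close> along
  \<open>r a\<close>. It carries the weak topology: a set is open iff its preimage under the characteristic
  map \<open>[0,1] \<rightarrow> |G|\<close> of each arc is open.
\<close>

type_synonym ('v, 'a) point = "'v + ('a \<times> real) set"

definition arc_point :: "('v, 'a) pre_digraph \<Rightarrow> ('a \<Rightarrow> 'a) \<Rightarrow> 'a \<Rightarrow> real \<Rightarrow> ('v, 'a) point" where
  "arc_point G r a t =
     (if t = 0 then Inl (tail G a) else if t = 1 then Inl (head G a)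
      else Inr {(a, t), (r a, 1 - t)})"

definition points :: "('v, 'a) pre_digraph \<Rightarrow> ('a \<Rightarrow> 'a) \<Rightarrow> ('v, 'a) point set" where
  "points G r = Inl ` verts G \<union> (\<Union>a\<in>arcs G. arc_point G r a ` {0..1})"

definition realization :: "('v, 'a) pre_digraph \<Rightarrow> ('a \<Rightarrow> 'a) \<Rightarrow> ('v, 'a) point topology" where
  "realization G r = topology (\<lambda>U. U \<subseteq> points G r \<and>
     (\<forall>a\<in>arcs G. openin (top_of_set {0..1}) {t \<in> {0..1}. arc_point G r a t \<in> U}))"

lemma openin_realization:
  "openin (realization G r) U \<longleftrightarrow> U \<subseteq> points G r \<and>
     (\<forall>a\<in>arcs G. openin (top_of_set {0..1}) {t \<in> {0..1}. arc_point G r a t \<in> U})"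
proof -
  let ?L = "\<lambda>U. U \<subseteq> points G r \<and>
     (\<forall>a\<in>arcs G. openin (top_of_set {0..1}) {t \<in> {0..1}. arc_point G r a t \<in> U})"
  have "istopology ?L"
    unfolding istopology_def
  proof (intro conjI allI impI)
    fix S T assume S: "?L S" and T: "?L T"
    have "openin (top_of_set {0..1}) {t \<in> {0..1}. arc_point G r a t \<in> S \<inter> T}" if "a \<in> arcs G" for a
    proof -
      have "{t \<in> {0..1}. arc_point G r a t \<in> S \<inter> T} =
          {t \<in> {0..1}. arc_point G r a t \<in> S} \<inter> {t \<in> {0..1}. arc_point G r a t \<in> T}" by blast
      then show ?thesis using S T that by (simp add: openin_Int)
    qed
    moreover show "S \<inter> T \<subseteq> points G r" using S by blast
    ultimately show "\<forall>a\<in>arcs G. openin (top_of_set {0..1}) {t \<in> {0..1}. arc_point G r a t \<in> S \<inter> T}"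
      by blast
  next
    fix K assume K: "\<forall>S\<in>K. ?L S"
    show "\<Union> K \<subseteq> points G r" using K by blast
    have "openin (top_of_set {0..1}) {t \<in> {0..1}. arc_point G r a t \<in> \<Union> K}" if "a \<in> arcs G" for a
    proof -
      have "{t \<in> {0..1}. arc_point G r a t \<in> \<Union> K} =
          (\<Union>S\<in>K. {t \<in> {0..1}. arc_point G r a t \<in> S})" by blast
      moreover have "openin (top_of_set {0..1}) (\<Union>S\<in>K. {t \<in> {0..1}. arc_point G r a t \<in> S})"
        using K that by (intro openin_Union) blast
      ultimately show ?thesis by simp
    qed
    then show "\<forall>a\<in>arcs G. openin (top_of_set {0..1}) {t \<in> {0..1}. arc_point G r a t \<in> \<Union> K}"
      by blast
  qed
  then show ?thesis unfolding realization_def by (simp add: topology_inverse')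
qed

text \<open>A morphism consists of a map on vertices and a map on arcs; \<open>realize\<close> is the induced map on
  points, which is affine along each edge.\<close>

definition multigraph_morphism ::
  "('w, 'b) pre_digraph \<Rightarrow> ('b \<Rightarrow> 'b) \<Rightarrow> ('v, 'a) pre_digraph \<Rightarrow> ('a \<Rightarrow> 'a)
    \<Rightarrow> ('w \<Rightarrow> 'v) \<times> ('b \<Rightarrow> 'a) \<Rightarrow> bool" where
  "multigraph_morphism H s G r f \<longleftrightarrow>
     fst f \<in> verts H \<rightarrow> verts G \<and> snd f \<in> arcs H \<rightarrow> arcs G \<and>
     (\<forall>b\<in>arcs H. tail G (snd f b) = fst f (tail H b) \<and>
                 head G (snd f b) = fst f (head H b) \<and>
                 snd f (s b) = r (snd f b))"

definition realize :: "('w \<Rightarrow> 'v) \<times> ('b \<Rightarrow> 'a) \<Rightarrow> ('w, 'b) point \<Rightarrow> ('v, 'a) point" where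
  "realize f = map_sum (fst f) (image (map_prod (snd f) id))"

definition covering_map :: "'x topology \<Rightarrow> 'y topology \<Rightarrow> ('x \<Rightarrow> 'y) \<Rightarrow> bool" where
  "covering_map A B p \<longleftrightarrow>
     continuous_map A B p \<and> p ` topspace A = topspace B \<and>
     (\<forall>y\<in>topspace B. \<exists>T. openin B T \<and> y \<in> T \<and>
        (\<exists>\<V>. \<Union>\<V> = {x \<in> topspace A. p x \<in> T} \<and> (\<forall>U\<in>\<V>. openin A U) \<and> pairwise disjnt \<V> \<and>
             (\<forall>U\<in>\<V>. homeomorphic_map (subtopology A U) (subtopology B T) p)))"

definition multigraph_cover ::
  "('w, 'b) pre_digraph \<Rightarrow> ('b \<Rightarrow> 'b) \<Rightarrow> ('v, 'a) pre_digraph \<Rightarrow> ('a \<Rightarrow> 'a)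
    \<Rightarrow> ('w \<Rightarrow> 'v) \<times> ('b \<Rightarrow> 'a) \<Rightarrow> bool" where
  "multigraph_cover Y s X r \<pi> \<longleftrightarrow>
     multigraph_morphism Y s X r \<pi> \<and>
     covering_map (realization Y s) (realization X r) (realize \<pi>)"

text \<open>The group of automorphisms of the multigraph \<open>Y\<close> over \<open>X\<close>.\<close>

definition deck_group ::
  "('w, 'b) pre_digraph \<Rightarrow> ('b \<Rightarrow> 'b) \<Rightarrow> ('w \<Rightarrow> 'v) \<times> ('b \<Rightarrow> 'a)
    \<Rightarrow> (('w \<Rightarrow> 'w) \<times> ('b \<Rightarrow> 'b)) monoid" where
  "deck_group Y s \<pi> = (BijGroup (verts Y) \<times>\<times> BijGroup (arcs Y))
     \<lparr>carrier := {g \<in> Bij (verts Y) \<times> Bij (arcs Y).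
        multigraph_morphism Y s Y s g \<and>
        (\<forall>w\<in>verts Y. fst \<pi> (fst g w) = fst \<pi> w) \<and>
        (\<forall>b\<in>arcs Y. snd \<pi> (snd g b) = snd \<pi> b)}\<rparr>"

definition galois_cover ::
  "('w, 'b) pre_digraph \<Rightarrow> ('b \<Rightarrow> 'b) \<Rightarrow> ('v, 'a) pre_digraph \<Rightarrow> ('a \<Rightarrow> 'a)
    \<Rightarrow> ('w \<Rightarrow> 'v) \<times> ('b \<Rightarrow> 'a) \<Rightarrow> bool" where
  "galois_cover Y s X r \<pi> \<longleftrightarrow>
     multigraph_cover Y s X r \<pi> \<and>
     (\<forall>x\<in>points Y s. \<forall>y\<in>points Y s. realize \<pi> x = realize \<pi> y \<longrightarrow>
        (\<exists>g\<in>carrier (deck_group Y s \<pi>). realize g x = y))"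

definition abelian_cover ::
  "('w, 'b) pre_digraph \<Rightarrow> ('b \<Rightarrow> 'b) \<Rightarrow> ('v, 'a) pre_digraph \<Rightarrow> ('a \<Rightarrow> 'a)
    \<Rightarrow> ('w \<Rightarrow> 'v) \<times> ('b \<Rightarrow> 'a) \<Rightarrow> bool" where
  "abelian_cover Y s X r \<pi> \<longleftrightarrow> galois_cover Y s X r \<pi> \<and> comm_group (deck_group Y s \<pi>)"


section \<open>Primes and the Frobenius automorphism\<close>

definition closed_path :: "('v, 'a) pre_digraph \<Rightarrow> 'a list \<Rightarrow> bool" where
  "closed_path G p \<longleftrightarrow> p \<noteq> [] \<and> (\<exists>v. pre_digraph.awalk G v p v)"

definition prime_path :: "('v, 'a) pre_digraph \<Rightarrow> ('a \<Rightarrow> 'a) \<Rightarrow> 'a list \<Rightarrow> bool" where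
  "prime_path G r p \<longleftrightarrow>
     closed_path G p \<and>
     (\<forall>i. Suc i < length p \<longrightarrow> p ! Suc i \<noteq> r (p ! i)) \<and>
     hd p \<noteq> r (last p) \<and>
     \<not> (\<exists>c k. closed_path G c \<and> k \<ge> 2 \<and> p = concat (replicate k c))"

definition primes :: "('v, 'a) pre_digraph \<Rightarrow> ('a \<Rightarrow> 'a) \<Rightarrow> 'a list set set" where
  "primes G r = {{rotate n p | n. True} | p. prime_path G r p}"

definition prime_length :: "'a list set \<Rightarrow> nat" where
  "prime_length P = (THE n. \<forall>p\<in>P. length p = n)"

definition frobenius ::
  "('w, 'b) pre_digraph \<Rightarrow> ('b \<Rightarrow> 'b) \<Rightarrow> ('v, 'a) pre_digraph
    \<Rightarrow> ('w \<Rightarrow> 'v) \<times> ('b \<Rightarrow> 'a) \<Rightarrow> 'a list set \<Rightarrow> ('w \<Rightarrow> 'w) \<times> ('b \<Rightarrow> 'b)" where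
  "frobenius Y s X \<pi> P = (THE g. g \<in> carrier (deck_group Y s \<pi>) \<and>
     (\<exists>p\<in>P. \<exists>w q w'. w \<in> verts Y \<and> fst \<pi> w = tail X (hd p) \<and>
        pre_digraph.awalk Y w q w' \<and> map (snd \<pi>) q = p \<and> fst g w = w'))"


section \<open>Characters and \<open>L\<close>-functions\<close>

definition complex_units :: "complex monoid" where
  "complex_units = \<lparr>carrier = UNIV - {0}, monoid.mult = (*), one = 1\<rparr>"

definition characters :: "('g, 'm) monoid_scheme \<Rightarrow> ('g \<Rightarrow> complex) set" where
  "characters G = hom G complex_units \<inter> extensional (carrier G)"

definition trivial_char :: "('g, 'm) monoid_scheme \<Rightarrow> 'g \<Rightarrow> complex" where
  "trivial_char G = (\<lambda>g\<in>carrier G. 1)"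

definition conj_char :: "('g, 'm) monoid_scheme \<Rightarrow> ('g \<Rightarrow> complex) \<Rightarrow> 'g \<Rightarrow> complex" where
  "conj_char G \<psi> = (\<lambda>g\<in>carrier G. cnj (\<psi> g))"

text \<open>The product over the countably many primes is the unconditional one, i.e. the limit of the
  finite partial products along the filter of finite sets of primes.\<close>

definition L_function ::
  "('w, 'b) pre_digraph \<Rightarrow> ('b \<Rightarrow> 'b) \<Rightarrow> ('v, 'a) pre_digraph \<Rightarrow> ('a \<Rightarrow> 'a)
    \<Rightarrow> ('w \<Rightarrow> 'v) \<times> ('b \<Rightarrow> 'a) \<Rightarrow> (('w \<Rightarrow> 'w) \<times> ('b \<Rightarrow> 'b) \<Rightarrow> complex) \<Rightarrow> complex \<Rightarrow> complex" where
  "L_function Y s X r \<pi> \<psi> u =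
     Lim (finite_subsets_at_top (primes X r))
       (\<lambda>F. \<Prod>P\<in>F. inverse (1 - \<psi> (frobenius Y s X \<pi> P) * u ^ prime_length P))"

definition L_reciprocal ::
  "('w, 'b) pre_digraph \<Rightarrow> ('b \<Rightarrow> 'b) \<Rightarrow> ('v, 'a) pre_digraph \<Rightarrow> ('a \<Rightarrow> 'a)
    \<Rightarrow> ('w \<Rightarrow> 'v) \<times> ('b \<Rightarrow> 'a) \<Rightarrow> (('w \<Rightarrow> 'w) \<times> ('b \<Rightarrow> 'b) \<Rightarrow> complex) \<Rightarrow> complex poly" where
  "L_reciprocal Y s X r \<pi> \<psi> =
     (THE p. \<forall>\<^sub>F u in nhds 0. inverse (L_function Y s X r \<pi> \<psi> u) = poly p u)"

text \<open>Composition with \<open>1 + x\<close> gives the Taylor expansion at \<open>u = 1\<close> in powers of \<open>x = u - 1\<close>.\<close>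

definition L_star_1 ::
  "('w, 'b) pre_digraph \<Rightarrow> ('b \<Rightarrow> 'b) \<Rightarrow> ('v, 'a) pre_digraph \<Rightarrow> ('a \<Rightarrow> 'a)
    \<Rightarrow> ('w \<Rightarrow> 'v) \<times> ('b \<Rightarrow> 'a) \<Rightarrow> (('w \<Rightarrow> 'w) \<times> ('b \<Rightarrow> 'b) \<Rightarrow> complex) \<Rightarrow> complex" where
  "L_star_1 Y s X r \<pi> \<psi> =
     (let q = pcompose (L_reciprocal Y s X r \<pi> \<psi>) [:1, 1:]
      in coeff q (LEAST k. coeff q k \<noteq> 0))"


section \<open>Group rings\<close>

text \<open>For a finite group \<open>G\<close>, the elements of \<open>R[G]\<close> are the functions \<open>'g \<Rightarrow> R\<close> vanishing outside
  \<open>carrier G\<close>.\<close>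

definition gr_carrier :: "('g, 'm) monoid_scheme \<Rightarrow> ('g \<Rightarrow> 'r::comm_ring_1) set" where
  "gr_carrier G = {\<alpha>. \<forall>g. g \<notin> carrier G \<longrightarrow> \<alpha> g = 0}"

definition gr_of :: "'g \<Rightarrow> 'g \<Rightarrow> 'r::comm_ring_1" where
  "gr_of \<sigma> = (\<lambda>g. if g = \<sigma> then 1 else 0)"

definition gr_mult ::
  "('g, 'm) monoid_scheme \<Rightarrow> ('g \<Rightarrow> 'r::comm_ring_1) \<Rightarrow> ('g \<Rightarrow> 'r) \<Rightarrow> 'g \<Rightarrow> 'r" where
  "gr_mult G \<alpha> \<beta> = (\<lambda>g. \<Sum>(\<sigma>, \<tau>)\<in>{(\<sigma>, \<tau>) \<in> carrier G \<times> carrier G. \<sigma> \<otimes>\<^bsub>G\<^esub> \<tau> = g}. \<alpha> \<sigma> * \<beta> \<tau>)"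

definition gr_minus :: "('g \<Rightarrow> 'r::comm_ring_1) \<Rightarrow> ('g \<Rightarrow> 'r) \<Rightarrow> 'g \<Rightarrow> 'r" where
  "gr_minus \<alpha> \<beta> = (\<lambda>g. \<alpha> g - \<beta> g)"

definition gr_of_int :: "('g \<Rightarrow> int) \<Rightarrow> 'g \<Rightarrow> complex" where
  "gr_of_int \<alpha> = (\<lambda>g. of_int (\<alpha> g))"

definition idem :: "('g, 'm) monoid_scheme \<Rightarrow> ('g \<Rightarrow> complex) \<Rightarrow> 'g \<Rightarrow> complex" where
  "idem G \<psi> = (\<lambda>g. 1 / of_nat (order G) * (\<Sum>\<sigma>\<in>carrier G. \<psi> \<sigma> * gr_of (inv\<^bsub>G\<^esub> \<sigma>) g))"

definition theta_star_1 ::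
  "('w, 'b) pre_digraph \<Rightarrow> ('b \<Rightarrow> 'b) \<Rightarrow> ('v, 'a) pre_digraph \<Rightarrow> ('a \<Rightarrow> 'a)
    \<Rightarrow> ('w \<Rightarrow> 'v) \<times> ('b \<Rightarrow> 'a) \<Rightarrow> ('w \<Rightarrow> 'w) \<times> ('b \<Rightarrow> 'b) \<Rightarrow> complex" where
  "theta_star_1 Y s X r \<pi> = (\<lambda>g. \<Sum>\<psi>\<in>characters (deck_group Y s \<pi>).
     L_star_1 Y s X r \<pi> \<psi> * idem (deck_group Y s \<pi>) (conj_char (deck_group Y s \<pi>) \<psi>) g)"


section \<open>The Jacobian\<close>

definition divisor_degree :: "('w \<Rightarrow>\<^sub>0 int) \<Rightarrow> int" where
  "divisor_degree D = (\<Sum>w\<in>Poly_Mapping.keys D. Poly_Mapping.lookup D w)"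

definition Div0 :: "('w, 'b) pre_digraph \<Rightarrow> ('w \<Rightarrow>\<^sub>0 int) monoid" where
  "Div0 Y = (free_Abelian_group (verts Y))
     \<lparr>carrier := {D \<in> carrier (free_Abelian_group (verts Y)). divisor_degree D = 0}\<rparr>"

definition rho :: "('w, 'b) pre_digraph \<Rightarrow> ('b \<Rightarrow> 'b) \<Rightarrow> 'w \<Rightarrow> 'w \<Rightarrow> int" where
  "rho Y s w w0 =
     (if w = w0 then int (vdegree Y s w0) - 2 * int (loops_at Y s w0)
      else - int (edges_between Y s w w0))"

definition laplacian :: "('w, 'b) pre_digraph \<Rightarrow> ('b \<Rightarrow> 'b) \<Rightarrow> ('w \<Rightarrow>\<^sub>0 int) \<Rightarrow> ('w \<Rightarrow>\<^sub>0 int)" where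
  "laplacian Y s = frag_extend (\<lambda>w0. \<Sum>w\<in>verts Y. frag_cmul (rho Y s w w0) (frag_of w))"

definition Pr :: "('w, 'b) pre_digraph \<Rightarrow> ('b \<Rightarrow> 'b) \<Rightarrow> ('w \<Rightarrow>\<^sub>0 int) set" where
  "Pr Y s = laplacian Y s ` carrier (free_Abelian_group (verts Y))"

definition Jac :: "('w, 'b) pre_digraph \<Rightarrow> ('b \<Rightarrow> 'b) \<Rightarrow> ('w \<Rightarrow>\<^sub>0 int) set monoid" where
  "Jac Y s = Div0 Y Mod Pr Y s"

text \<open>The action of \<open>\<int>[G]\<close> on divisors, and the induced action on classes of divisors
  (all members of the union below coincide).\<close>

definition div_action ::
  "(('w \<Rightarrow> 'w) \<times> ('b \<Rightarrow> 'b), 'm) monoid_scheme \<Rightarrow> (('w \<Rightarrow> 'w) \<times> ('b \<Rightarrow> 'b) \<Rightarrow> int)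
    \<Rightarrow> ('w \<Rightarrow>\<^sub>0 int) \<Rightarrow> ('w \<Rightarrow>\<^sub>0 int)" where
  "div_action G \<alpha> D =
     (\<Sum>g\<in>carrier G. frag_cmul (\<alpha> g) (frag_extend (\<lambda>w. frag_of (fst g w)) D))"

definition Jac_action ::
  "('w, 'b) pre_digraph \<Rightarrow> ('b \<Rightarrow> 'b) \<Rightarrow> (('w \<Rightarrow> 'w) \<times> ('b \<Rightarrow> 'b), 'm) monoid_scheme
    \<Rightarrow> (('w \<Rightarrow> 'w) \<times> ('b \<Rightarrow> 'b) \<Rightarrow> int) \<Rightarrow> ('w \<Rightarrow>\<^sub>0 int) set \<Rightarrow> ('w \<Rightarrow>\<^sub>0 int) set" where
  "Jac_action Y s G \<alpha> C = (\<Union>D\<in>C. Pr Y s #>\<^bsub>Div0 Y\<^esub> div_action G \<alpha> D)"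

definition Ann_Jac ::
  "('w, 'b) pre_digraph \<Rightarrow> ('b \<Rightarrow> 'b) \<Rightarrow> (('w \<Rightarrow> 'w) \<times> ('b \<Rightarrow> 'b), 'm) monoid_scheme
    \<Rightarrow> (('w \<Rightarrow> 'w) \<times> ('b \<Rightarrow> 'b) \<Rightarrow> int) set" where
  "Ann_Jac Y s G =
     {\<alpha> \<in> gr_carrier G. \<forall>C\<in>carrier (Jac Y s). Jac_action Y s G \<alpha> C = \<one>\<^bsub>Jac Y s\<^esub>}"

end

theory Submission
  imports
    Defs
    "Jordan_Normal_Form.Schur_Decomposition"
    "Jordan_Normal_Form.Determinant"
begin

text \<open>
  Lifting arcs to fixed base points of \<open>Y\<close> assigns to every arc of \<open>X\<close> a voltage in \<open>G\<close>, and the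
  Frobenius automorphism of a prime is the product of the voltages along it. Hence \<open>L(u, \<psi>)\<close> is an
  Euler product over primitive cyclic words, whose logarithm is a sum of traces of powers of the
  twisted edge matrix; by Bass's determinant formula
  \<open>L(u, \<psi>)\<inverse> = (1 - u\<^sup>2)\<^sup>k det (1 - u A\<^sub>\<psi> + u\<^sup>2 (D - 1))\<close>, where \<open>k\<close> is the number of edges minus the
  number of vertices of \<open>X\<close>. For nontrivial \<open>\<psi>\<close> the determinant of the twisted Laplacian
  \<open>D - A\<^sub>\<psi>\<close> does not vanish, because harmonic functions on the connected graph \<open>Y\<close> are constant;
  for trivial \<open>\<psi>\<close> it is zero. So \<open>\<theta>\<^sup>* e\<close> is \<open>(-2)\<^sup>k\<close> times the element of \<open>\<int>[G]\<close> obtained as the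
  determinant of the Laplacian of \<open>Y\<close>, a matrix over \<open>\<int>[G]\<close>. This determinant annihilates the
  cokernel of the Laplacian, since the adjugate times the Laplacian is the determinant.
\<close>

section \<open>Matrices indexed by lists\<close>

text \<open>The difficulty lies in integrality: the idempotents carry the denominator
  \<open>|G|\<close>. It cancels because the coefficients of \<open>\<theta>\<^sup>* e\<close> form
  the Fourier transform of determinants that all specialise one integral element, and inversion
  returns exactly the factor \<open>|G|\<close>. Inversion needs all characters while
  \<open>e\<close> removes the trivial one; the vanishing of its determinant lets it be put back at
  no cost. The degree hypothesis enters through \<open>k\<close>: once every degree is at least two
  there are at least as many edges as vertices, so \<open>k\<close> is a genuine natural number; an
  isolated vertex is treated apart. The adjugate argument needs a single determinant that acts on
  divisors and also specialises to every character, hence the Laplacian is written with formal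
  variables standing for group elements. Since the reciprocal of \<open>L\<close> is pinned down as
  the polynomial agreeing with it near \<open>0\<close>, every analytic identity is only needed on a
  neighbourhood of \<open>0\<close>, where the sums converge absolutely.\<close>

text \<open>Rows and columns are numbered by enumerating a set of arcs or vertices; concatenating
  two enumerations yields a block matrix.\<close>

definition mat_on :: "'a list \<Rightarrow> 'b list \<Rightarrow> ('a \<Rightarrow> 'b \<Rightarrow> 'c) \<Rightarrow> 'c mat" where
  "mat_on xs ys f = mat (length xs) (length ys) (\<lambda>(i, j). f (xs ! i) (ys ! j))"

lemma mat_on_carrier [simp, intro]: "mat_on xs ys f \<in> carrier_mat (length xs) (length ys)"
  by (simp add: mat_on_def)

lemma mat_on_dim [simp]:
  "dim_row (mat_on xs ys f) = length xs" "dim_col (mat_on xs ys f) = length ys"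
  by (simp_all add: mat_on_def)

lemma mat_on_index [simp]:
  "i < length xs \<Longrightarrow> j < length ys \<Longrightarrow> mat_on xs ys f $$ (i, j) = f (xs ! i) (ys ! j)"
  by (simp add: mat_on_def)

lemma mat_on_cong:
  "(\<And>x y. x \<in> set xs \<Longrightarrow> y \<in> set ys \<Longrightarrow> f x y = g x y) \<Longrightarrow> mat_on xs ys f = mat_on xs ys g"
  by (rule eq_matI) auto

lemma sum_nth_distinct: "distinct ys \<Longrightarrow> (\<Sum>i<length ys. f (ys ! i)) = sum f (set ys)"
  by (rule sum.reindex_bij_betw) (rule bij_betw_nth, simp_all)

lemma mat_on_mult:
  assumes "distinct ys"
  shows "mat_on xs ys f * mat_on ys zs g = mat_on xs zs (\<lambda>x z. \<Sum>y\<in>set ys. f x y * g y z)"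
proof (rule eq_matI)
  fix i j
  assume "i < dim_row (mat_on xs zs (\<lambda>x z. \<Sum>y\<in>set ys. f x y * g y z))"
    "j < dim_col (mat_on xs zs (\<lambda>x z. \<Sum>y\<in>set ys. f x y * g y z))"
  then have ij: "i < length xs" "j < length zs" by simp_all
  have "(mat_on xs ys f * mat_on ys zs g) $$ (i, j)
      = (\<Sum>k = 0..<length ys. f (xs ! i) (ys ! k) * g (ys ! k) (zs ! j))"
    using ij by (auto simp: scalar_prod_def intro!: sum.cong)
  also have "\<dots> = (\<Sum>k<length ys. f (xs ! i) (ys ! k) * g (ys ! k) (zs ! j))"
    by (simp add: atLeast0LessThan)
  also have "\<dots> = (\<Sum>y\<in>set ys. f (xs ! i) y * g y (zs ! j))"
    by (rule sum_nth_distinct[OF assms, of "\<lambda>y. f (xs ! i) y * g y (zs ! j)"])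
  finally show "(mat_on xs ys f * mat_on ys zs g) $$ (i, j)
      = mat_on xs zs (\<lambda>x z. \<Sum>y\<in>set ys. f x y * g y z) $$ (i, j)"
    using ij by simp
qed simp_all

lemma mat_on_minus: "mat_on xs ys f - mat_on xs ys g = mat_on xs ys (\<lambda>x y. f x y - g x y)"
  by (rule eq_matI) simp_all

lemma mat_on_smult: "c \<cdot>\<^sub>m mat_on xs ys f = mat_on xs ys (\<lambda>x y. c * f x y)"
  by (rule eq_matI) simp_all

lemma mat_on_one: "distinct xs \<Longrightarrow> 1\<^sub>m (length xs) = mat_on xs xs (\<lambda>x y. of_bool (x = y))"
  by (rule eq_matI) (auto simp: nth_eq_iff_index_eq)

lemma mat_on_transpose: "transpose_mat (mat_on xs ys f) = mat_on ys xs (\<lambda>y x. f x y)"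
  by (rule eq_matI) simp_all

lemma mat_on_map: "map_mat h (mat_on xs ys f) = mat_on xs ys (\<lambda>x y. h (f x y))"
  by (rule eq_matI) simp_all

lemma mat_on_reindex:
  "mat_on (map g xs) ys f = mat_on xs ys (\<lambda>x. f (g x))"
  "mat_on xs (map h ys) f' = mat_on xs ys (\<lambda>x y. f' x (h y))"
  by (rule eq_matI; simp)+

lemma mat_on_append:
  "mat_on (xs @ xs') (ys @ ys') f
    = four_block_mat (mat_on xs ys f) (mat_on xs ys' f) (mat_on xs' ys f) (mat_on xs' ys' f)"
  by (rule eq_matI) (auto simp: nth_append)

lemma det_mat_on_transpose: "det (mat_on xs xs (\<lambda>x y. f y x)) = det (mat_on xs xs f)"
  using det_transpose[of "mat_on xs xs f" "length xs"] by (simp add: mat_on_transpose)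

text \<open>Sylvester's identity. The block matrices \<open>?B\<close> and \<open>?L\<close>
  multiply in either order to a block triangular matrix, with \<open>1 - X * Y\<close> on the
  diagonal in one order and \<open>1 - Y * X\<close> in the other, and the order does not affect the
  determinant.\<close>

lemma det_one_minus_commute:
  fixes X Y :: "'a::idom mat"
  assumes X: "X \<in> carrier_mat n m" and Y: "Y \<in> carrier_mat m n"
  shows "det (1\<^sub>m n - X * Y) = det (1\<^sub>m m - Y * X)"
proof -
  have C: "1\<^sub>m n \<in> carrier_mat n n" "1\<^sub>m m \<in> carrier_mat m m" "- Y \<in> carrier_mat m n"
    "0\<^sub>m n m \<in> carrier_mat n m" using Y by simp_all
  let ?B = "four_block_mat (1\<^sub>m n) X Y (1\<^sub>m m)"
  let ?L = "four_block_mat (1\<^sub>m n) (0\<^sub>m n m) (- Y) (1\<^sub>m m)"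
  have BL: "?B * ?L = four_block_mat (1\<^sub>m n - X * Y) X (0\<^sub>m m n) (1\<^sub>m m)"
    by (subst mult_four_block_mat[OF C(1) X Y C(2) C(1) C(4) C(3) C(2)])
      (use X Y in \<open>auto intro!: cong_four_block_mat eq_matI\<close>)
  have LB: "?L * ?B = four_block_mat (1\<^sub>m n) X (0\<^sub>m m n) (1\<^sub>m m - Y * X)"
    by (subst mult_four_block_mat[OF C(1) C(4) C(3) C(2) C(1) X Y C(2)])
      (use X Y in \<open>auto intro!: cong_four_block_mat eq_matI\<close>)
  have carr: "?B \<in> carrier_mat (n + m) (n + m)" "?L \<in> carrier_mat (n + m) (n + m)"
    by (simp_all add: four_block_carrier_mat)
  have "det (?B * ?L) = det (?L * ?B)"
    using det_mult[OF carr] det_mult[OF carr(2,1)] by (simp only: mult.commute)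
  moreover have "det (?B * ?L) = det (1\<^sub>m n - X * Y)"
    unfolding BL by (subst det_four_block_mat_lower_left_zero[OF _ X]) (use X Y in auto)
  moreover have "det (?L * ?B) = det (1\<^sub>m m - Y * X)"
    unfolding LB by (subst det_four_block_mat_lower_left_zero[OF _ X]) (use X Y in auto)
  ultimately show ?thesis by simp
qed

section \<open>Bass's determinant formula\<close>

lemma sum_of_bool_eq:
  fixes f :: "'a \<Rightarrow> 'b::semiring_1"
  shows "finite A \<Longrightarrow> (\<Sum>y\<in>A. of_bool (y = x) * f y) = (if x \<in> A then f x else 0)"
    "finite A \<Longrightarrow> (\<Sum>y\<in>A. of_bool (x = y) * f y) = (if x \<in> A then f x else 0)"
  by (auto simp: of_bool_def if_distrib[of "\<lambda>c. c * _"] cong: if_cong)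

text \<open>In the order \<open>es @ map r es\<close> the reversal exchanges the two halves, so both
  diagonal blocks are identities. The lower right one commutes with every block, which reduces the
  determinant to that of \<open>1 - ?B * ?C\<close>; inverse weights on opposite arcs make
  \<open>?B * ?C\<close> equal to \<open>u\<^sup>2\<close> times the identity.\<close>

lemma det_one_plus_reversal:
  fixes w :: "'a \<Rightarrow> 'c::idom"
  assumes dist: "distinct (es @ map r es)"
    and inv: "\<And>a. a \<in> set es \<Longrightarrow> r (r a) = a"
    and w: "\<And>a. a \<in> set es \<Longrightarrow> w a * w (r a) = 1"
  shows "det (mat_on (es @ map r es) (es @ map r es)
      (\<lambda>a b. of_bool (a = b) + u * w a * of_bool (b = r a))) = (1 - u\<^sup>2) ^ length es"
proof -
  define n where "n = length es"
  have d: "distinct es" using dist by simp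
  have rne: "r b \<noteq> a" if "a \<in> set es" "b \<in> set es" for a b
    using dist that by auto
  have rinj: "r a = r b \<longleftrightarrow> a = b" if "a \<in> set es" "b \<in> set es" for a b
    using that inv by metis
  let ?f = "\<lambda>a b. of_bool (a = b) + u * w a * of_bool (b = r a)"
  let ?B = "mat_on es es (\<lambda>a b. of_bool (a = b) * (u * w a))"
  let ?C = "mat_on es es (\<lambda>a b. of_bool (a = b) * (u * w (r a)))"
  have "mat_on (es @ map r es) (es @ map r es) ?f = four_block_mat (1\<^sub>m n) ?B ?C (1\<^sub>m n)"
    unfolding mat_on_append mat_on_reindex n_def mat_on_one[OF d]
    by (intro cong_four_block_mat mat_on_cong)
      (use rne rne[symmetric] rinj inv in \<open>auto simp: rinj\<close>)
  also have "det \<dots> = det (1\<^sub>m n * 1\<^sub>m n - ?B * ?C)"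
    by (rule det_four_block_mat) (auto simp: n_def intro!: left_mult_one_mat[symmetric] right_mult_one_mat)
  also have "1\<^sub>m n * 1\<^sub>m n - ?B * ?C = (1 - u\<^sup>2) \<cdot>\<^sub>m 1\<^sub>m n"
  proof -
    have "?B * ?C = mat_on es es (\<lambda>a b. of_bool (a = b) * u\<^sup>2)"
      unfolding mat_on_mult[OF d]
    proof (rule mat_on_cong)
      fix x z assume x: "x \<in> set es" and z: "z \<in> set es"
      have "(\<Sum>y\<in>set es. of_bool (x = y) * (u * w x) * (of_bool (y = z) * (u * w (r y))))
          = (\<Sum>y\<in>set es. of_bool (x = y) * ((u * w x) * (of_bool (y = z) * (u * w (r y)))))"
        by (simp add: mult.assoc)
      also have "\<dots> = (u * w x) * (of_bool (x = z) * (u * w (r x)))"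
        using x by (subst sum_of_bool_eq) simp_all
      also have "\<dots> = of_bool (x = z) * (u\<^sup>2 * (w x * w (r x)))"
        by (simp add: power2_eq_square mult_ac)
      finally show "(\<Sum>y\<in>set es. of_bool (x = y) * (u * w x) * (of_bool (y = z) * (u * w (r y))))
          = of_bool (x = z) * u\<^sup>2" by (simp add: w[OF x])
    qed
    then show ?thesis
      unfolding n_def left_mult_one_mat[OF one_carrier_mat]
      unfolding mat_on_one[OF d] by (simp add: mat_on_minus mat_on_smult) (rule mat_on_cong, auto)
  qed
  also have "det \<dots> = (1 - u\<^sup>2) ^ length es" by (simp add: n_def)
  finally show ?thesis .
qed

text \<open>\<open>1 - u W = P (1 - X B)\<close> with \<open>P = 1 + u J\<close>, \<open>J\<close> the weighted arc reversal, and
  \<open>det (1 - X B) = det (1 - B X)\<close>, where \<open>B X\<close> is indexed by vertices.\<close>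

lemma bass_formula:
  fixes w :: "'a \<Rightarrow> 'c::field" and t h :: "'a \<Rightarrow> 'v"
  defines "A \<equiv> \<lambda>es r. set (es @ map r es)"
  assumes dist: "distinct (es @ map r es)" and dv: "distinct vs"
    and inv: "\<And>a. a \<in> A es r \<Longrightarrow> r (r a) = a"
    and w: "\<And>a. a \<in> A es r \<Longrightarrow> w a * w (r a) = 1"
    and hr: "\<And>a. a \<in> A es r \<Longrightarrow> h (r a) = t a"
    and tr: "\<And>a. a \<in> A es r \<Longrightarrow> t (r a) = h a"
    and tv: "\<And>a. a \<in> A es r \<Longrightarrow> t a \<in> set vs"
    and u: "u\<^sup>2 \<noteq> 1"
  shows "(1 - u\<^sup>2) ^ length vs * det (mat_on (es @ map r es) (es @ map r es)
      (\<lambda>a b. of_bool (a = b) - u * (w a * of_bool (h a = t b \<and> b \<noteq> r a))))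
    = (1 - u\<^sup>2) ^ length es * det (mat_on vs vs (\<lambda>x y. of_bool (x = y) *
        (1 - u\<^sup>2 + u\<^sup>2 * of_nat (card {a \<in> A es r. t a = x}))
        - u * (\<Sum>a\<in>{a \<in> A es r. t a = x \<and> h a = y}. w a)))"
proof -
  define as where "as = es @ map r es"
  define c where "c = 1 - u\<^sup>2"
  have c: "c \<noteq> 0" using u by (simp add: c_def)
  have A: "A es r = set as" by (simp add: A_def as_def)
  have da: "distinct as" using dist by (simp add: as_def)
  have rA: "r a \<in> set as" if "a \<in> set as" for a
    using that inv unfolding A by (auto simp: as_def)
  note inv = inv[unfolded A] and w = w[unfolded A] and hr = hr[unfolded A]
    and tr = tr[unfolded A] and tv = tv[unfolded A]
  define P where "P = mat_on as as (\<lambda>a b. of_bool (a = b) + u * w a * of_bool (b = r a))"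
  \<comment> \<open>The weighted reversal \<open>J\<close> squares to 1, so
    \<open>P = 1 + u J\<close> has inverse \<open>(1 - u J) / c\<close>. Applying it to the entries
    \<open>u * w a * of_bool (h a = v)\<close> gives \<open>x\<close>.\<close>
  define x where "x = (\<lambda>a v. u / c * (w a * of_bool (h a = v) - u * of_bool (t a = v)))"
  define X where "X = mat_on as vs x"
  define B where "B = mat_on vs as (\<lambda>v b. of_bool (t b = v) :: 'c)"
  have PX: "P * X = mat_on as vs (\<lambda>a v. u * w a * of_bool (h a = v))"
    unfolding P_def X_def mat_on_mult[OF da]
  proof (rule mat_on_cong)
    fix a v assume a: "a \<in> set as" and "v \<in> set vs"
    have "(\<Sum>b\<in>set as. (of_bool (a = b) + u * w a * of_bool (b = r a)) * x b v)
        = (\<Sum>b\<in>set as. of_bool (a = b) * x b v) + (\<Sum>b\<in>set as. of_bool (b = r a) * (u * w a * x b v))"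
      unfolding sum.distrib[symmetric] by (intro sum.cong) (auto simp: algebra_simps)
    also have "\<dots> = x a v + u * w a * x (r a) v"
      using a rA[OF a] by (simp only: sum_of_bool_eq finite_set if_True)
    also have "\<dots> = u / c * (w a * of_bool (h a = v) - u * of_bool (t a = v)
        + u * (w a * w (r a)) * of_bool (t a = v) - u\<^sup>2 * (w a * of_bool (h a = v)))"
      by (simp add: x_def hr[OF a] tr[OF a] algebra_simps power2_eq_square)
    also have "\<dots> = u / c * (c * (w a * of_bool (h a = v)))"
      by (simp add: w[OF a] c_def algebra_simps)
    also have "\<dots> = u * w a * of_bool (h a = v)" using c by simp
    finally show "(\<Sum>b\<in>set as. (of_bool (a = b) + u * w a * of_bool (b = r a)) * x b v)
        = u * w a * of_bool (h a = v)" .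
  qed
  have car: "P \<in> carrier_mat (length as) (length as)" "X \<in> carrier_mat (length as) (length vs)"
    "B \<in> carrier_mat (length vs) (length as)" by (simp_all add: P_def X_def B_def)
  have "P * X * B = mat_on as as (\<lambda>a b. u * w a * of_bool (h a = t b))"
    unfolding PX B_def mat_on_mult[OF dv]
  proof (rule mat_on_cong)
    fix a b assume a: "a \<in> set as" and b: "b \<in> set as"
    have "(\<Sum>y\<in>set vs. u * w a * of_bool (h a = y) * of_bool (t b = y))
        = (\<Sum>y\<in>set vs. of_bool (t b = y) * (u * w a * of_bool (h a = y)))"
      by (simp add: mult_ac)
    also have "\<dots> = u * w a * of_bool (h a = t b)"
      by (subst sum_of_bool_eq) (simp_all add: tv[OF b])
    finally show "(\<Sum>y\<in>set vs. u * w a * of_bool (h a = y) * of_bool (t b = y))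
        = u * w a * of_bool (h a = t b)" .
  qed
  then have "P - P * X * B
      = mat_on as as (\<lambda>a b. of_bool (a = b) - u * (w a * of_bool (h a = t b \<and> b \<noteq> r a)))"
    unfolding P_def
    by (simp add: mat_on_minus) (rule mat_on_cong, auto simp: algebra_simps tr)
  also have "P - P * X * B = P * (1\<^sub>m (length as) - X * B)"
    using car mult_minus_distrib_mat[of P "length as" "length as" "1\<^sub>m (length as)" "length as" "X * B"]
    by (simp add: assoc_mult_mat)
  finally have "det (mat_on as as (\<lambda>a b. of_bool (a = b) - u * (w a * of_bool (h a = t b \<and> b \<noteq> r a))))
      = det P * det (1\<^sub>m (length as) - X * B)"
    using car by (metis det_mult minus_carrier_mat mult_carrier_mat)
  also have "det P = c ^ length es"
    unfolding P_def as_def c_def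
    by (rule det_one_plus_reversal[OF dist]) (use inv w in \<open>auto simp: as_def\<close>)
  also have "det (1\<^sub>m (length as) - X * B) = det (1\<^sub>m (length vs) - B * X)"
    by (rule det_one_minus_commute[OF car(2,3)])
  \<comment> \<open>Scaling the vertex matrix by \<open>c\<close> clears the denominator of
    \<open>x\<close>; the price \<open>c ^ length vs\<close> is the factor on the left of the
    claim.\<close>
  finally have eq: "c ^ length vs * det (mat_on as as
        (\<lambda>a b. of_bool (a = b) - u * (w a * of_bool (h a = t b \<and> b \<noteq> r a))))
      = c ^ length es * det (c \<cdot>\<^sub>m (1\<^sub>m (length vs) - B * X))"
    using car by simp
  have "c \<cdot>\<^sub>m (1\<^sub>m (length vs) - B * X) = mat_on vs vs (\<lambda>x y. of_bool (x = y) *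
        (1 - u\<^sup>2 + u\<^sup>2 * of_nat (card {a \<in> set as. t a = x}))
        - u * (\<Sum>a\<in>{a \<in> set as. t a = x \<and> h a = y}. w a))"
    unfolding B_def X_def mat_on_mult[OF da] mat_on_one[OF dv] mat_on_minus mat_on_smult
  proof (rule mat_on_cong)
    fix v v' assume "v \<in> set vs" "v' \<in> set vs"
    have "(\<Sum>y\<in>set as. of_bool (t y = v) * x y v')
        = u / c * ((\<Sum>y\<in>set as. of_bool (t y = v \<and> h y = v') * w y)
          - u * (\<Sum>y\<in>set as. of_bool (t y = v \<and> t y = v')))"
      unfolding x_def right_diff_distrib sum_distrib_left sum_subtractf[symmetric]
      by (intro sum.cong) (auto simp: algebra_simps)
    also have "(\<Sum>y\<in>set as. of_bool (t y = v \<and> h y = v') * w y)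
        = (\<Sum>a\<in>{a \<in> set as. t a = v \<and> h a = v'}. w a)"
      by (subst sum.inter_filter) (auto intro!: sum.cong simp: of_bool_def)
    also have "(\<Sum>y\<in>set as. of_bool (t y = v \<and> t y = v') :: 'c)
        = of_bool (v = v') * of_nat (card {a \<in> set as. t a = v})"
      by (auto simp: of_bool_def sum.inter_filter[symmetric] simp flip: of_nat_sum cong: conj_cong)
    finally have "c * (of_bool (v = v') - (\<Sum>y\<in>set as. of_bool (t y = v) * x y v'))
        = c * of_bool (v = v') - u * ((\<Sum>a\<in>{a \<in> set as. t a = v \<and> h a = v'}. w a)
          - u * (of_bool (v = v') * of_nat (card {a \<in> set as. t a = v})))"
      using c by (simp add: right_diff_distrib)
    then show "c * (of_bool (v = v') - (\<Sum>y\<in>set as. of_bool (t y = v) * x y v'))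
        = of_bool (v = v') * (1 - u\<^sup>2 + u\<^sup>2 * of_nat (card {a \<in> set as. t a = v}))
        - u * (\<Sum>a\<in>{a \<in> set as. t a = v \<and> h a = v'}. w a)"
      by (simp add: c_def algebra_simps power2_eq_square)
  qed
  with eq show ?thesis unfolding A by (simp only: c_def as_def)
qed

section \<open>Traces of powers and the determinant\<close>

definition mtrace :: "'a::comm_monoid_add mat \<Rightarrow> 'a" where
  "mtrace M = (\<Sum>i<dim_row M. M $$ (i, i))"

lemma mtrace_commute:
  fixes X Y :: "'a::comm_semiring_0 mat"
  assumes "X \<in> carrier_mat n m" "Y \<in> carrier_mat m n"
  shows "mtrace (X * Y) = mtrace (Y * X)"
proof -
  have "mtrace (X * Y) = (\<Sum>i<n. \<Sum>k<m. X $$ (i, k) * Y $$ (k, i))"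
    using assms by (auto simp: mtrace_def scalar_prod_def atLeast0LessThan intro!: sum.cong)
  also have "\<dots> = (\<Sum>k<m. \<Sum>i<n. Y $$ (k, i) * X $$ (i, k))"
    by (subst sum.swap) (simp add: mult.commute)
  also have "\<dots> = mtrace (Y * X)"
    using assms by (auto simp: mtrace_def scalar_prod_def atLeast0LessThan intro!: sum.cong)
  finally show ?thesis .
qed

lemma mtrace_similar:
  fixes A B :: "'a::comm_ring_1 mat"
  assumes "similar_mat_wit A B P Q"
  shows "mtrace A = mtrace B"
proof -
  obtain n where c: "A \<in> carrier_mat n n" "B \<in> carrier_mat n n" "P \<in> carrier_mat n n"
    "Q \<in> carrier_mat n n" and eq: "Q * P = 1\<^sub>m n" "A = P * B * Q"
    using assms unfolding similar_mat_wit_def Let_def by auto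
  have "mtrace A = mtrace (P * (B * Q))" using c by (simp add: eq assoc_mult_mat[of P n n])
  also have "\<dots> = mtrace (B * Q * P)" using c by (intro mtrace_commute[of _ n n]) auto
  also have "B * Q * P = B" using c by (simp add: eq assoc_mult_mat[of B n n])
  finally show ?thesis .
qed

lemma upper_triangular_mult:
  fixes A B :: "'a::semiring_0 mat"
  assumes A: "A \<in> carrier_mat n n" "upper_triangular A"
    and B: "B \<in> carrier_mat n n" "upper_triangular B"
  shows "upper_triangular (A * B)"
    and "i < n \<Longrightarrow> (A * B) $$ (i, i) = A $$ (i, i) * B $$ (i, i)"
proof -
  \<comment> \<open>A term is nonzero only if \<open>i \<le> k\<close> and \<open>k \<le> j\<close>;
    with \<open>j \<le> i\<close> only \<open>k = i = j\<close> remains, which settles both claims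
    at once.\<close>
  have e: "(A * B) $$ (i, j) = (\<Sum>k<n. if k = i \<and> i = j then A $$ (i, i) * B $$ (i, i) else 0)"
    if ij: "i < n" "j \<le> i" for i j
  proof -
    have "(A * B) $$ (i, j) = (\<Sum>k<n. A $$ (i, k) * B $$ (k, j))"
      using ij A B by (auto simp: scalar_prod_def atLeast0LessThan)
    also have "\<dots> = (\<Sum>k<n. if k = i \<and> i = j then A $$ (i, i) * B $$ (i, i) else 0)"
    proof (rule sum.cong)
      fix k assume k: "k \<in> {..<n}"
      have "A $$ (i, k) = 0" if "k < i" using A ij that by (auto dest: upper_triangularD)
      moreover have "B $$ (k, j) = 0" if "j < k" using B k that by (auto dest: upper_triangularD)
      ultimately show "A $$ (i, k) * B $$ (k, j)
          = (if k = i \<and> i = j then A $$ (i, i) * B $$ (i, i) else 0)"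
        using ij by (cases "k < i"; cases "j < k"; cases "k = i") auto
    qed simp
    finally show ?thesis .
  qed
  show "upper_triangular (A * B)" using A e by (auto intro!: upper_triangularI)
  show "(A * B) $$ (i, i) = A $$ (i, i) * B $$ (i, i)" if "i < n"
    using e[OF that order_refl] that by (simp cong: if_cong)
qed

lemma upper_triangular_pow:
  fixes B :: "'a::comm_ring_1 mat"
  assumes "B \<in> carrier_mat n n" "upper_triangular B"
  shows "upper_triangular (B ^\<^sub>m m) \<and> (\<forall>i<n. (B ^\<^sub>m m) $$ (i, i) = (B $$ (i, i)) ^ m)"
proof (induction m)
  case 0
  show ?case using assms by (auto intro!: upper_triangularI)
next
  case (Suc m)
  have "B ^\<^sub>m m \<in> carrier_mat n n" using assms by (rule_tac pow_carrier_mat)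
  then show ?case
    using upper_triangular_mult[of "B ^\<^sub>m m" n B] Suc assms by (auto simp: mult.commute)
qed

text \<open>Over the complex numbers a matrix is similar to a triangular one, and both quantities
  are read off the same diagonal.\<close>

lemma spectrum_trace_det:
  fixes M :: "complex mat"
  assumes M: "M \<in> carrier_mat n n"
  obtains es where "\<And>m. mtrace (M ^\<^sub>m m) = (\<Sum>e\<leftarrow>es. e ^ m)"
    and "\<And>u. det (1\<^sub>m n - u \<cdot>\<^sub>m M) = (\<Prod>e\<leftarrow>es. 1 - u * e)"
proof -
  obtain as where "char_poly M = (\<Prod>a\<leftarrow>as. [:- a, 1:])"
    using char_poly_factorized[OF M] by blast
  then obtain B where B: "B \<in> carrier_mat n n" "upper_triangular B" "similar_mat M B"
    using schur_decomposition_exists[OF M] by blast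
  obtain P Q where wit: "similar_mat_wit M B P Q"
    using B(3) unfolding similar_mat_def by blast
  have c: "P \<in> carrier_mat n n" "Q \<in> carrier_mat n n"
    and eq: "Q * P = 1\<^sub>m n" "P * Q = 1\<^sub>m n" "M = P * B * Q"
    using wit M unfolding similar_mat_wit_def Let_def by auto
  have sum_diag: "(\<Sum>e\<leftarrow>diag_mat B. g e) = (\<Sum>i<n. g (B $$ (i, i)))" for g :: "complex \<Rightarrow> complex"
    using B(1) by (simp add: diag_mat_def comp_def interv_sum_list_conv_sum_set_nat atLeast0LessThan)
  have "mtrace (M ^\<^sub>m m) = (\<Sum>e\<leftarrow>diag_mat B. e ^ m)" for m
  proof -
    have "mtrace (M ^\<^sub>m m) = mtrace (B ^\<^sub>m m)"
      by (rule mtrace_similar[OF similar_mat_wit_pow[OF wit]])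
    then show ?thesis
      using upper_triangular_pow[OF B(1,2), of m] B(1) by (simp add: mtrace_def sum_diag)
  qed
  moreover have "det (1\<^sub>m n - u \<cdot>\<^sub>m M) = (\<Prod>e\<leftarrow>diag_mat B. 1 - u * e)" for u
  proof -
    let ?C = "1\<^sub>m n - u \<cdot>\<^sub>m B"
    have C: "?C \<in> carrier_mat n n" "upper_triangular ?C" "diag_mat ?C = map (\<lambda>e. 1 - u * e) (diag_mat B)"
      using B by (auto simp: diag_mat_def intro!: upper_triangularI dest: upper_triangularD)
    have "P * ?C * Q = 1\<^sub>m n - u \<cdot>\<^sub>m M"
    proof -
      have "P * ?C = P - u \<cdot>\<^sub>m (P * B)"
        using c B mult_minus_distrib_mat[of P n n "1\<^sub>m n" n "u \<cdot>\<^sub>m B"]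
        by (simp add: mult_smult_distrib[of P n n B n])
      then have "P * ?C * Q = P * Q - (u \<cdot>\<^sub>m (P * B)) * Q"
        using c B by (simp add: minus_mult_distrib_mat[of _ n n])
      then show ?thesis using c B by (simp add: eq mult_smult_assoc_mat[of "P * B" n n Q n])
    qed
    then have "similar_mat_wit (1\<^sub>m n - u \<cdot>\<^sub>m M) ?C P Q"
      by (intro similar_mat_witI[of _ _ n] eq c C(1)) (use M in auto)
    then have "similar_mat (1\<^sub>m n - u \<cdot>\<^sub>m M) ?C" unfolding similar_mat_def by blast
    then have "det (1\<^sub>m n - u \<cdot>\<^sub>m M) = prod_list (diag_mat ?C)"
      using det_upper_triangular[OF C(2,1)] by (simp add: det_similar)
    then show ?thesis using C(3) by simp
  qed
  ultimately show ?thesis by (rule that)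
qed

text \<open>The index \<open>m = 0\<close> contributes nothing, since division by zero yields zero.\<close>

lemma minus_Ln_series:
  fixes z :: complex
  assumes "norm z < 1"
  shows "(\<lambda>m. z ^ m / of_nat m) sums (- Ln (1 - z))"
proof -
  have "(\<lambda>m. - ((-1) ^ Suc m / of_nat m * (- z) ^ m)) sums (- Ln (1 + - z))"
    by (intro sums_minus Ln_series) (simp add: assms)
  moreover have "- ((-1) ^ Suc m / of_nat m * (- z) ^ m) = z ^ m / of_nat m" for m
    using power_mult_distrib[of "-1" "-z" m] by simp
  ultimately have "(\<lambda>m. z ^ m / of_nat m) sums (- Ln (1 + - z))" by (simp only:)
  then show ?thesis by simp
qed

text \<open>Each eigenvalue \<open>e\<close> contributes the series of
  \<open>- Ln (1 - u * e)\<close>. The conclusion is phrased through \<open>exp\<close>, since a sum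
  of principal logarithms need not be the principal logarithm of the product.\<close>

lemma exp_trace_series:
  fixes M :: "complex mat"
  assumes M: "M \<in> carrier_mat n n"
  shows "\<forall>\<^sub>F u in nhds 0. \<exists>S. (\<lambda>m. u ^ m * mtrace (M ^\<^sub>m m) / of_nat m) sums S
    \<and> exp S = inverse (det (1\<^sub>m n - u \<cdot>\<^sub>m M))"
proof -
  obtain es where tr: "\<And>m. mtrace (M ^\<^sub>m m) = (\<Sum>e\<leftarrow>es. e ^ m)"
    and dt: "\<And>u. det (1\<^sub>m n - u \<cdot>\<^sub>m M) = (\<Prod>e\<leftarrow>es. 1 - u * e)"
    using spectrum_trace_det[OF M] by blast
  have "\<forall>\<^sub>F u in nhds 0. norm (u * e) < 1" for e :: complex
  proof -
    have "((\<lambda>u. norm (u * e)) \<longlongrightarrow> norm (0 * e)) (nhds 0)"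
      by (intro tendsto_norm tendsto_mult tendsto_const filterlim_ident)
    then show ?thesis by (rule order_tendstoD) simp
  qed
  then have "\<forall>\<^sub>F u in nhds 0. \<forall>e\<in>set es. norm (u * e) < 1"
    by (intro eventually_ball_finite) auto
  then show ?thesis
  proof eventually_elim
    case (elim u)
    have "(\<lambda>m. u ^ m * (\<Sum>e\<leftarrow>es. e ^ m) / of_nat m) sums (\<Sum>e\<leftarrow>es. - Ln (1 - u * e))
        \<and> exp (\<Sum>e\<leftarrow>es. - Ln (1 - u * e)) = inverse (\<Prod>e\<leftarrow>es. 1 - u * e)"
      using elim
    proof (induction es)
      case (Cons e es)
      have e: "norm (u * e) < 1" using Cons.prems by simp
      then have ne: "1 - u * e \<noteq> 0" by auto
      have "(\<lambda>m. (u * e) ^ m / of_nat m + u ^ m * (\<Sum>e\<leftarrow>es. e ^ m) / of_nat m)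
          sums (- Ln (1 - u * e) + (\<Sum>e\<leftarrow>es. - Ln (1 - u * e)))"
        by (rule sums_add[OF minus_Ln_series[OF e]]) (use Cons in auto)
      moreover have "(u * e) ^ m / of_nat m + u ^ m * (\<Sum>e\<leftarrow>es. e ^ m) / of_nat m
          = u ^ m * (\<Sum>e\<leftarrow>e # es. e ^ m) / of_nat m" for m
        by (simp add: power_mult_distrib ring_distribs add_divide_distrib)
      ultimately have "(\<lambda>m. u ^ m * (\<Sum>e\<leftarrow>e # es. e ^ m) / of_nat m)
          sums (\<Sum>e\<leftarrow>e # es. - Ln (1 - u * e))"
        by (simp only: list.map sum_list.Cons)
      moreover have "exp (\<Sum>e\<leftarrow>e # es. - Ln (1 - u * e)) = inverse (\<Prod>e\<leftarrow>e # es. 1 - u * e)"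
      proof -
        have "exp (\<Sum>e\<leftarrow>es. - Ln (1 - u * e)) = inverse (\<Prod>e\<leftarrow>es. 1 - u * e)"
          using Cons by simp
        moreover have "exp (- Ln (1 - u * e)) = inverse (1 - u * e)"
          using ne by (simp add: exp_minus)
        ultimately show ?thesis by (simp only: list.map sum_list.Cons prod_list.Cons exp_add inverse_mult_distrib)
      qed
      ultimately show ?case by blast
    qed simp
    then show ?case unfolding tr dt by blast
  qed
qed

section \<open>Traces of matrix powers as sums over closed words\<close>

definition cyc_weight :: "('a \<Rightarrow> 'a \<Rightarrow> 'c::comm_monoid_mult) \<Rightarrow> 'a list \<Rightarrow> 'c" where
  "cyc_weight f q = (\<Prod>i<length q. f (q ! i) (q ! (Suc i mod length q)))"

text \<open>Open counterpart of \<open>cyc_weight\<close>: entries of a power are sums over open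
  walks, and only the trace closes them up.\<close>

fun walk_weight :: "('a \<Rightarrow> 'a \<Rightarrow> 'c::comm_monoid_mult) \<Rightarrow> 'a list \<Rightarrow> 'c" where
  "walk_weight f (x # y # l) = f x y * walk_weight f (y # l)"
| "walk_weight f _ = 1"

lemma walk_weight_snoc: "walk_weight f (l @ [y, z]) = walk_weight f (l @ [y]) * f y z"
  by (induction f l rule: walk_weight.induct) (simp_all add: mult_ac)

lemma walk_weight_nth:
  "walk_weight f (x # l) = (\<Prod>i<length l. f ((x # l) ! i) ((x # l) ! Suc i))"
  by (induction l arbitrary: x) (simp_all add: prod.lessThan_Suc_shift del: prod.lessThan_Suc)

lemma walk_weight_closed: "walk_weight f (x # p @ [x]) = cyc_weight f (x # p)"
proof -
  have "walk_weight f (x # p @ [x])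
      = (\<Prod>i<Suc (length p). f ((x # p @ [x]) ! i) ((x # p @ [x]) ! Suc i))"
    by (subst walk_weight_nth) simp
  also have "\<dots> = cyc_weight f (x # p)"
    unfolding cyc_weight_def
    by (intro prod.cong) (auto simp: nth_append nth_Cons' less_Suc_eq mod_Suc)
  finally show ?thesis .
qed

text \<open>The word \<open>p\<close> lists the interior points of a walk from \<open>x\<close> to
  \<open>y\<close>, so exponent \<open>Suc k\<close> goes with length \<open>k\<close>. Multiplying
  by one more factor turns the former end point into the last interior letter.\<close>

lemma mat_on_pow_Suc:
  fixes f :: "'a \<Rightarrow> 'a \<Rightarrow> 'c::comm_ring_1"
  assumes "distinct as"
  shows "mat_on as as f ^\<^sub>m Suc k
    = mat_on as as (\<lambda>x y. \<Sum>p | set p \<subseteq> set as \<and> length p = k. walk_weight f (x # p @ [y]))"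
proof (induction k)
  case 0
  have "{p. set p \<subseteq> set as \<and> length p = 0} = {[]}" by auto
  then show ?case by simp
next
  case (Suc k)
  let ?L = "\<lambda>k. {p. set p \<subseteq> set as \<and> length p = k}"
  have "(\<Sum>z\<in>set as. (\<Sum>p\<in>?L k. walk_weight f (x # p @ [z])) * f z y)
      = (\<Sum>p\<in>?L (Suc k). walk_weight f (x # p @ [y]))" for x y
  proof -
    have "(\<Sum>z\<in>set as. (\<Sum>p\<in>?L k. walk_weight f (x # p @ [z])) * f z y)
        = (\<Sum>(z, p)\<in>set as \<times> ?L k. walk_weight f (x # p @ [z]) * f z y)"
      by (simp add: sum_distrib_right sum.cartesian_product)
    also have "\<dots> = (\<Sum>p\<in>?L (Suc k). walk_weight f (x # p @ [y]))"
    proof (rule sum.reindex_bij_witness[of _ "\<lambda>q. (last q, butlast q)" "\<lambda>(z, p). p @ [z]"])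
      fix q assume q: "q \<in> ?L (Suc k)"
      then have "q \<noteq> []" by auto
      then show "(case (last q, butlast q) of (z, p) \<Rightarrow> p @ [z]) = q"
        "(last q, butlast q) \<in> set as \<times> ?L k"
        using q by (auto dest: in_set_butlastD)
    next
      fix zp assume "zp \<in> set as \<times> ?L k"
      then obtain z p where zp: "zp = (z, p)" "z \<in> set as" "set p \<subseteq> set as" "length p = k" by auto
      show "(last (case zp of (z, p) \<Rightarrow> p @ [z]), butlast (case zp of (z, p) \<Rightarrow> p @ [z])) = zp"
        "(case zp of (z, p) \<Rightarrow> p @ [z]) \<in> ?L (Suc k)"
        using zp by simp_all
      show "walk_weight f (x # (case zp of (z, p) \<Rightarrow> p @ [z]) @ [y])
          = (case zp of (z, p) \<Rightarrow> walk_weight f (x # p @ [z]) * f z y)"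
        using walk_weight_snoc[of f "x # p" z y] by (simp add: zp)
    qed
    finally show ?thesis .
  qed
  then have "mat_on as as f ^\<^sub>m Suc k * mat_on as as f
      = mat_on as as (\<lambda>x y. \<Sum>p\<in>?L (Suc k). walk_weight f (x # p @ [y]))"
    unfolding Suc mat_on_mult[OF assms] by simp
  then show ?case by simp
qed

text \<open>The first letter of a closed word is the diagonal index and the rest is the interior of
  the walk. At \<open>m = 0\<close> this fails: the trace is the size of the matrix, while the empty
  word alone contributes 1.\<close>

lemma mtrace_mat_on_pow:
  fixes f :: "'a \<Rightarrow> 'a \<Rightarrow> 'c::comm_ring_1"
  assumes "distinct as" and "m > 0"
  shows "mtrace (mat_on as as f ^\<^sub>m m) = (\<Sum>q | set q \<subseteq> set as \<and> length q = m. cyc_weight f q)"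
proof -
  obtain k where k: "m = Suc k" using \<open>m > 0\<close> gr0_implies_Suc by blast
  let ?L = "\<lambda>k. {p. set p \<subseteq> set as \<and> length p = k}"
  have "mtrace (mat_on as as f ^\<^sub>m m)
      = (\<Sum>i<length as. \<Sum>p\<in>?L k. walk_weight f ((as ! i) # p @ [as ! i]))"
    unfolding k mat_on_pow_Suc[OF assms(1)] by (simp add: mtrace_def)
  also have "\<dots> = (\<Sum>x\<in>set as. \<Sum>p\<in>?L k. walk_weight f (x # p @ [x]))"
    by (rule sum_nth_distinct[OF assms(1), of "\<lambda>x. \<Sum>p\<in>?L k. walk_weight f (x # p @ [x])"])
  also have "\<dots> = (\<Sum>(x, p)\<in>set as \<times> ?L k. cyc_weight f (x # p))"
    by (simp add: sum.cartesian_product walk_weight_closed)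
  also have "\<dots> = (\<Sum>q\<in>?L m. cyc_weight f q)"
  proof (rule sum.reindex_bij_witness[of _ "\<lambda>q. (hd q, tl q)" "\<lambda>(x, p). x # p"])
    fix q assume "q \<in> ?L m"
    then show "(case (hd q, tl q) of (x, p) \<Rightarrow> x # p) = q" "(hd q, tl q) \<in> set as \<times> ?L k"
      by (cases q; simp add: k)+
  qed (auto simp: k)
  finally show ?thesis .
qed

section \<open>Primitive words and the Euler product\<close>

text \<open>The root \<open>d\<close> is an arbitrary word, not a closed path. The empty word is not
  primitive, being its own square.\<close>

definition primitive :: "'a list \<Rightarrow> bool" where
  "primitive c \<longleftrightarrow> \<not> (\<exists>d k. k \<ge> 2 \<and> c = concat (replicate k d))"

text \<open>The relation is also required from the last letter back to the first, so that one cyclic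
  condition captures composability, closedness, absence of backtracks and absence of a tail.\<close>

definition cyclic_words :: "'a set \<Rightarrow> ('a \<Rightarrow> 'a \<Rightarrow> bool) \<Rightarrow> 'a list set" where
  "cyclic_words S R =
    {q. q \<noteq> [] \<and> set q \<subseteq> S \<and> (\<forall>i<length q. R (q ! i) (q ! (Suc i mod length q)))}"

definition rotations :: "'a list \<Rightarrow> 'a list set" where
  "rotations p = {rotate n p | n. True}"

definition necklaces :: "'a set \<Rightarrow> ('a \<Rightarrow> 'a \<Rightarrow> bool) \<Rightarrow> 'a list set set" where
  "necklaces S R = rotations ` {p \<in> cyclic_words S R. primitive p}"

lemma length_concat_replicate [simp]: "length (concat (replicate k c)) = k * length c"
  by (induction k) simp_all

lemma append_concat_replicate_commute: "c @ concat (replicate k c) = concat (replicate k c) @ c"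
  by (induction k) simp_all

lemma concat_replicate_mult:
  "concat (replicate k (concat (replicate j d))) = concat (replicate (k * j) d)"
  by (induction k) (simp_all add: replicate_add)

lemma nth_concat_replicate:
  "i < k * length c \<Longrightarrow> concat (replicate k c) ! i = c ! (i mod length c)"
proof (induction k arbitrary: i)
  case (Suc k)
  show ?case
  proof (cases "i < length c")
    case False
    then have "concat (replicate (Suc k) c) ! i = concat (replicate k c) ! (i - length c)"
      by (simp add: nth_append)
    also have "\<dots> = c ! ((i - length c) mod length c)" using Suc False by (intro Suc.IH) auto
    also have "(i - length c) mod length c = i mod length c" using False by (simp add: le_mod_geq)
    finally show ?thesis .
  qed (simp add: nth_append)
qed simp

text \<open>Equal powers of \<open>c\<close> and \<open>d\<close> force \<open>c\<close> and
  \<open>d\<close> to commute, and commuting words are powers of a common word; primitivity then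
  makes both equal to that word.\<close>

lemma primitive_root_unique:
  assumes "primitive c" "primitive d" "k > 0" "l > 0" "c \<noteq> []" "d \<noteq> []"
    and eq: "concat (replicate k c) = concat (replicate l d)"
  shows "c = d \<and> k = l"
proof -
  obtain k' l' where kl: "k = Suc k'" "l = Suc l'" using assms gr0_implies_Suc by metis
  let ?C = "concat (replicate k' c)" and ?D = "concat (replicate l' d)"
  have w: "c @ ?C = d @ ?D" using eq by (simp add: kl)
  have w': "?C @ c = c @ ?C" "?D @ d = d @ ?D" by (simp_all add: append_concat_replicate_commute)
  \<comment> \<open>Both ends of this chain are the square of the common word, decomposed once with
    prefix \<open>c @ d\<close> and once with prefix \<open>d @ c\<close>.\<close>
  have "(c @ d) @ (?D @ ?C) = c @ (?C @ c) @ ?C" by (simp add: w w')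
  also have "\<dots> = d @ (?D @ d) @ ?D" using w by (metis append.assoc)
  also have "\<dots> = (d @ c) @ (?C @ ?D)" by (simp add: w[symmetric] w')
  finally have "(c @ d) @ (?D @ ?C) = (d @ c) @ (?C @ ?D)" .
  then have "c @ d = d @ c" by (subst (asm) append_eq_append_conv) simp_all
  then obtain m n z where z: "concat (replicate m z) = c" "concat (replicate n z) = d"
    using comm_append_are_replicate[of c d] by blast
  have "m \<noteq> 0" "n \<noteq> 0" using z assms by (intro notI; simp)+
  moreover have "\<not> m \<ge> 2" "\<not> n \<ge> 2" using z assms unfolding primitive_def by blast+
  ultimately have "m = 1" "n = 1" by auto
  then have "c = d" using z by simp
  moreover have "k * length c = l * length d" using eq by (metis length_concat_replicate)
  ultimately show ?thesis using \<open>c \<noteq> []\<close> by simp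
qed

text \<open>A root of minimal length is primitive, because a root of a root is again a root.\<close>

lemma primitive_root_exists:
  assumes "q \<noteq> []"
  obtains c k where "primitive c" "c \<noteq> []" "k > 0" "q = concat (replicate k c)"
proof -
  let ?P = "\<lambda>c. \<exists>k. q = concat (replicate k c)"
  have "?P q" by (rule exI[of _ 1]) simp
  define c where "c = arg_min length ?P"
  have c: "?P c" and min: "\<And>d. ?P d \<Longrightarrow> length c \<le> length d"
    using arg_min_natI[of ?P, OF \<open>?P q\<close>] arg_min_nat_le[of ?P] unfolding c_def by blast+
  obtain k where k: "q = concat (replicate k c)" using c by blast
  have "c \<noteq> []" "k > 0" using k assms by (auto intro: Nat.gr0I)
  moreover have "primitive c"
    unfolding primitive_def
  proof
    assume "\<exists>d j. j \<ge> 2 \<and> c = concat (replicate j d)"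
    then obtain d j where d: "j \<ge> 2" "c = concat (replicate j d)" by blast
    then have "?P d" using k concat_replicate_mult[of k j d] by metis
    then have "length c \<le> length d" by (rule min)
    moreover have "length c = j * length d" using d by simp
    moreover have "d \<noteq> []" using \<open>c \<noteq> []\<close> d by auto
    ultimately have "j * length d \<le> 1 * length d" and "length d > 0" by simp_all
    then have "j \<le> 1" by (simp add: mult_le_cancel2)
    then show False using d(1) by simp
  qed
  ultimately show ?thesis using that k by blast
qed

text \<open>The cyclically adjacent pairs of a power are those of its base repeated \<open>k\<close>
  times; positions modulo \<open>k * length c\<close> reduce to positions modulo
  \<open>length c\<close>.\<close>

lemma cyclic_words_power:
  assumes "k > 0"
  shows "concat (replicate k c) \<in> cyclic_words S R \<longleftrightarrow> c \<in> cyclic_words S R"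
proof (cases "c = []")
  case False
  let ?n = "length c"
  have n: "?n > 0" using False by simp
  have nz: "concat (replicate k c) \<noteq> []" using False assms by (cases k) auto
  have nth: "concat (replicate k c) ! i = c ! (i mod ?n)"
    "concat (replicate k c) ! (Suc i mod (k * ?n)) = c ! (Suc (i mod ?n) mod ?n)" if "i < k * ?n" for i
  proof -
    show "concat (replicate k c) ! i = c ! (i mod ?n)" by (rule nth_concat_replicate[OF that])
    have "Suc i mod (k * ?n) < k * ?n" using assms n by simp
    then have "concat (replicate k c) ! (Suc i mod (k * ?n)) = c ! (Suc i mod (k * ?n) mod ?n)"
      by (rule nth_concat_replicate)
    also have "Suc i mod (k * ?n) mod ?n = Suc (i mod ?n) mod ?n"
      by (simp add: mod_mult_self1 mod_mod_cancel mod_Suc_eq)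
    finally show "concat (replicate k c) ! (Suc i mod (k * ?n)) = c ! (Suc (i mod ?n) mod ?n)" .
  qed
  have "(\<forall>i<k * ?n. R (c ! (i mod ?n)) (c ! (Suc (i mod ?n) mod ?n)))
      \<longleftrightarrow> (\<forall>i<?n. R (c ! i) (c ! (Suc i mod ?n)))" (is "?L \<longleftrightarrow> ?R")
  proof
    assume L: ?L
    show ?R
    proof (intro allI impI)
      fix i assume i: "i < ?n"
      then have "i < k * ?n" using assms by (cases k) auto
      then show "R (c ! i) (c ! (Suc i mod ?n))" using L i by (metis mod_less)
    qed
  qed (use n in auto)
  moreover have "set (concat (replicate k c)) = set c" using assms by simp
  ultimately show ?thesis
    using False nz nth unfolding cyclic_words_def by (simp cong: conj_cong)
qed (simp add: cyclic_words_def)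

lemma cyclic_words_rotate: "q \<in> cyclic_words S R \<Longrightarrow> rotate n q \<in> cyclic_words S R"
proof -
  assume q: "q \<in> cyclic_words S R"
  have "R (rotate n q ! i) (rotate n q ! (Suc i mod length q))" if i: "i < length q" for i
  proof -
    let ?j = "(n + i) mod length q"
    have j: "?j < length q" using i by (intro mod_less_divisor) auto
    have "rotate n q ! (Suc i mod length q) = q ! ((n + Suc i mod length q) mod length q)"
      using i by (intro nth_rotate mod_less_divisor) auto
    also have "(n + Suc i mod length q) mod length q = Suc ?j mod length q"
      by (simp add: mod_simps)
    finally show ?thesis using q j i by (simp add: nth_rotate cyclic_words_def)
  qed
  then show ?thesis using q by (simp add: cyclic_words_def)
qed

lemma rotate_concat_replicate: "rotate n (concat (replicate k c)) = concat (replicate k (rotate n c))"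
proof -
  have snoc: "concat (replicate k (x # xs)) @ [x] = x # concat (replicate k (xs @ [x]))"
    for k and x :: 'b and xs by (induction k) simp_all
  have r1: "rotate1 (concat (replicate k c)) = concat (replicate k (rotate1 c))" for c :: "'b list"
  proof (cases c)
    case (Cons x xs)
    show ?thesis
    proof (cases k)
      case (Suc k')
      then have "rotate1 (concat (replicate k c)) = xs @ (concat (replicate k' (x # xs)) @ [x])"
        by (simp add: Cons)
      also have "\<dots> = concat (replicate k (rotate1 c))" unfolding snoc by (simp add: Cons Suc)
      finally show ?thesis .
    qed simp
  qed (simp add: concat_replicate_trivial)
  show ?thesis by (induction n) (simp_all add: r1)
qed

lemma rotate_rotate_inverse: obtains m where "rotate m (rotate n p) = p"
proof -
  let ?m = "(length p - n mod length p)"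
  have "rotate ?m (rotate n p) = rotate ((?m + n) mod length p) p"
    unfolding rotate_rotate by (rule rotate_conv_mod)
  moreover have "(?m + n) mod length p = 0 \<or> p = []"
  proof (cases "p = []")
    case False
    then have "n mod length p < length p" by simp
    then have "(?m + n mod length p) mod length p = 0" by simp
    then show ?thesis by (metis mod_add_right_eq)
  qed simp
  ultimately show ?thesis using that by (cases "p = []") auto
qed

lemma primitive_rotate: "primitive p \<Longrightarrow> primitive (rotate n p)"
  unfolding primitive_def by (metis rotate_concat_replicate rotate_rotate_inverse)

lemma rotations_eq: "q \<in> rotations p \<Longrightarrow> rotations q = rotations p"
proof -
  assume "q \<in> rotations p"
  then obtain n where n: "q = rotate n p" by (auto simp: rotations_def)
  obtain m where m: "rotate m q = p" unfolding n by (rule rotate_rotate_inverse)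
  show ?thesis unfolding rotations_def
    by (auto simp: n rotate_rotate) (metis m n rotate_rotate)
qed

lemma self_in_rotations: "p \<in> rotations p"
  unfolding rotations_def by (auto intro!: exI[of _ 0])

text \<open>If two rotations agreed, some rotation \<open>p'\<close> of \<open>p\<close> would be
  fixed by a proper shift \<open>d\<close>. Then \<open>take d p'\<close> and
  \<open>drop d p'\<close> commute, so \<open>p'\<close> is a proper power, contradicting
  primitivity.\<close>

lemma card_rotations:
  assumes "primitive p" "p \<noteq> []"
  shows "card (rotations p) = length p" and "finite (rotations p)"
proof -
  have e: "rotations p = (\<lambda>n. rotate n p) ` {..<length p}"
    unfolding rotations_def using assms(2)
    by (auto simp: image_iff) (metis length_greater_0_conv lessThan_iff mod_less_divisor rotate_conv_mod)
  have ne: "rotate i p \<noteq> rotate j p" if ij: "i < j" "j < length p" for i j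
  proof
    assume "rotate i p = rotate j p"
    define p' where "p' = rotate i p"
    define d where "d = j - i"
    have d: "0 < d" "d < length p'" using ij by (auto simp: d_def p'_def)
    have "rotate d p' = p'"
      unfolding p'_def rotate_rotate d_def using ij \<open>rotate i p = rotate j p\<close> by simp
    then have "drop d p' @ take d p' = take d p' @ drop d p'"
      using d by (simp add: rotate_drop_take)
    then obtain m n z where z: "concat (replicate m z) = drop d p'" "concat (replicate n z) = take d p'"
      using comm_append_are_replicate[of "drop d p'" "take d p'"] by blast
    have "m \<noteq> 0" "n \<noteq> 0" using z d by (intro notI; simp)+
    moreover have "p' = concat (replicate (n + m) z)" by (simp add: replicate_add z)
    moreover have "n + m \<ge> 2" using \<open>m \<noteq> 0\<close> \<open>n \<noteq> 0\<close> by simp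
    ultimately have "\<not> primitive p'" unfolding primitive_def by blast
    then show False using primitive_rotate[OF assms(1), of i] unfolding p'_def by blast
  qed
  then have "inj_on (\<lambda>n. rotate n p) {..<length p}"
    by (intro linorder_inj_onI') auto
  then show "card (rotations p) = length p" unfolding e by (simp add: card_image)
  show "finite (rotations p)" unfolding e by simp
qed

section \<open>Unconditional summation over words, primitive roots and necklaces\<close>

text \<open>There are \<open>card S ^ m\<close> words of length \<open>m\<close>, so every finite
  partial sum is bounded by the geometric series with ratio \<open>x * card S\<close>.\<close>

lemma geometric_lists_summable:
  fixes x :: real
  assumes "finite S" "0 \<le> x" "x * card S < 1"
  shows "(\<lambda>q. x ^ length q) summable_on {q. set q \<subseteq> S}"
proof (rule nonneg_bdd_above_summable_on)
  let ?y = "x * card S"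
  have y: "0 \<le> ?y" "?y < 1" using assms by auto
  show "bdd_above (sum (\<lambda>q. x ^ length q) ` {F. F \<subseteq> {q. set q \<subseteq> S} \<and> finite F})"
  proof (rule bdd_aboveI2)
    fix F assume "F \<in> {F. F \<subseteq> {q. set q \<subseteq> S} \<and> finite F}"
    then have F: "F \<subseteq> {q. set q \<subseteq> S}" "finite F" by auto
    define N where "N = Max (insert 0 (length ` F))"
    have "F \<subseteq> (\<Union>m\<in>{..N}. {q. set q \<subseteq> S \<and> length q = m})"
      using F by (auto simp: N_def)
    then have "sum (\<lambda>q. x ^ length q) F
        \<le> sum (\<lambda>q. x ^ length q) (\<Union>m\<in>{..N}. {q. set q \<subseteq> S \<and> length q = m})"
      using assms by (intro sum_mono2) (auto simp: finite_lists_length_eq)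
    also have "\<dots> = (\<Sum>m\<le>N. \<Sum>q | set q \<subseteq> S \<and> length q = m. x ^ length q)"
      using assms by (intro sum.UNION_disjoint) (auto simp: finite_lists_length_eq)
    also have "\<dots> = (\<Sum>m\<le>N. ?y ^ m)"
      by (intro sum.cong) (simp_all add: card_lists_length_eq assms power_mult_distrib mult.commute)
    also have "\<dots> \<le> suminf (\<lambda>m. ?y ^ m)"
      using y by (intro sum_le_suminf summable_geometric) auto
    also have "\<dots> = 1 / (1 - ?y)" using y by (intro suminf_geometric) auto
    finally show "sum (\<lambda>q. x ^ length q) F \<le> 1 / (1 - ?y)" .
  qed
qed (use assms in auto)

text \<open>Regrouping of an unconditional sum. It serves three times: to sort cyclic words by
  length, by primitive root, and primitive words by rotation class.\<close>

lemma has_sum_fibers: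
  fixes h :: "'c \<Rightarrow> 'd::{topological_comm_monoid_add, t3_space}"
  assumes "(h has_sum T) C" and "bij_betw g (Sigma A B) C"
    and "\<And>x. x \<in> A \<Longrightarrow> ((\<lambda>y. h (g (x, y))) has_sum b x) (B x)"
  shows "(b has_sum T) A"
proof -
  have "((\<lambda>xy. h (g xy)) has_sum T) (Sigma A B)"
    using assms(1) has_sum_reindex_bij_betw[OF assms(2)] by blast
  then show ?thesis using assms(3) by (rule has_sum_SigmaD)
qed

lemma cyclic_word_roots:
  fixes R :: "'a \<Rightarrow> 'a \<Rightarrow> bool"
  shows "bij_betw (\<lambda>(c, k). concat (replicate k c))
    ({c \<in> cyclic_words S R. primitive c} \<times> {0<..}) (cyclic_words S R)"
proof (rule bij_betwI')
  fix x y :: "'a list \<times> nat" assume "x \<in> {c \<in> cyclic_words S R. primitive c} \<times> {0<..}"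
    "y \<in> {c \<in> cyclic_words S R. primitive c} \<times> {0<..}"
  then show "(case x of (c, k) \<Rightarrow> concat (replicate k c)) = (case y of (c, k) \<Rightarrow> concat (replicate k c))
      \<longleftrightarrow> x = y"
    using primitive_root_unique by (auto simp: cyclic_words_def split: prod.splits)
next
  fix x :: "'a list \<times> nat" assume "x \<in> {c \<in> cyclic_words S R. primitive c} \<times> {0<..}"
  then show "(case x of (c, k) \<Rightarrow> concat (replicate k c)) \<in> cyclic_words S R"
    by (auto simp: cyclic_words_power)
next
  fix q assume q: "q \<in> cyclic_words S R"
  then have "q \<noteq> []" by (simp add: cyclic_words_def)
  then obtain c k where c: "primitive c" "k > 0" "q = concat (replicate k c)"
    using primitive_root_exists by metis
  then have "c \<in> cyclic_words S R" using q cyclic_words_power by metis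
  then show "\<exists>x\<in>{c \<in> cyclic_words S R. primitive c} \<times> {0<..}.
      q = (case x of (c, k) \<Rightarrow> concat (replicate k c))"
    using c by (intro bexI[of _ "(c, k)"]) auto
qed

text \<open>Classes do not overlap because each is determined by any of its members.\<close>

lemma necklaces_partition:
  "bij_betw snd (SIGMA P:necklaces S R. P) {p \<in> cyclic_words S R. primitive p}"
proof (rule bij_betwI')
  fix x y assume "x \<in> (SIGMA P:necklaces S R. P)" "y \<in> (SIGMA P:necklaces S R. P)"
  then show "snd x = snd y \<longleftrightarrow> x = y"
    by (auto simp: necklaces_def prod_eq_iff dest!: rotations_eq)
next
  fix x assume "x \<in> (SIGMA P:necklaces S R. P)"
  then obtain p where "p \<in> cyclic_words S R" "primitive p" "snd x \<in> rotations p"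
    by (auto simp: necklaces_def)
  then show "snd x \<in> {p \<in> cyclic_words S R. primitive p}"
    by (auto simp: rotations_def cyclic_words_rotate primitive_rotate)
next
  fix p assume "p \<in> {p \<in> cyclic_words S R. primitive p}"
  then show "\<exists>x\<in>(SIGMA P:necklaces S R. P). p = snd x"
    by (intro bexI[of _ "(rotations p, p)"]) (auto simp: necklaces_def self_in_rotations)
qed

lemma cyc_weight_cyclic_words:
  fixes w :: "'a \<Rightarrow> 'c::comm_semiring_1"
  assumes "q \<noteq> []" "set q \<subseteq> S"
  shows "cyc_weight (\<lambda>a b. w a * of_bool (R a b)) q
    = (if q \<in> cyclic_words S R then prod_list (map w q) else 0)"
proof -
  have "(\<Prod>i<length q. w (q ! i)) = prod_list (map w q)"
    by (simp add: prod.list_conv_set_nth atLeast0LessThan)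
  moreover have "(\<Prod>i<length q. of_bool (R (q ! i) (q ! (Suc i mod length q))) :: 'c)
      = of_bool (q \<in> cyclic_words S R)"
    using assms by (cases "q \<in> cyclic_words S R") (auto simp: cyclic_words_def intro!: prod.neutral prod_zero)
  ultimately show ?thesis by (simp add: cyc_weight_def prod.distrib)
qed

text \<open>Both sides are the exponential of the sum of \<open>u\<^sup>m w(q) / m\<close> over all cyclic words \<open>q\<close> of
  length \<open>m\<close>: sorted by length it is the sum of \<open>u\<^sup>m tr (M\<^sup>m) / m\<close>, sorted by primitive roots and
  their rotation classes it is the sum of \<open>- Ln (1 - Z P u\<^sup>\<nu>)\<close> over the necklaces \<open>P\<close>.\<close>

lemma euler_product:
  fixes w :: "'a \<Rightarrow> complex"
  defines "M \<equiv> \<lambda>as R. mat_on as as (\<lambda>a b. w a * of_bool (R a b))"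
  assumes dist: "distinct as" and w: "\<And>a. a \<in> set as \<Longrightarrow> norm (w a) \<le> 1"
    and Z: "\<And>p. p \<in> cyclic_words (set as) R \<Longrightarrow> primitive p \<Longrightarrow> Z (rotations p) = prod_list (map w p)"
    and \<nu>: "\<And>p. p \<in> cyclic_words (set as) R \<Longrightarrow> primitive p \<Longrightarrow> \<nu> (rotations p) = length p"
  shows "\<forall>\<^sub>F u in nhds 0. ((\<lambda>F. \<Prod>P\<in>F. inverse (1 - Z P * u ^ \<nu> P))
    \<longlongrightarrow> inverse (det (1\<^sub>m (length as) - u \<cdot>\<^sub>m M as R))) (finite_subsets_at_top (necklaces (set as) R))"
proof -
  let ?S = "set as" and ?M = "M as R" and ?C = "cyclic_words (set as) R"
  have M: "?M \<in> carrier_mat (length as) (length as)" by (simp add: M_def)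
  have "\<forall>\<^sub>F u::complex in nhds 0. norm u < 1 / (card ?S + 1)"
  proof -
    have "((\<lambda>u::complex. norm u) \<longlongrightarrow> norm (0::complex)) (nhds 0)"
      by (intro tendsto_norm filterlim_ident)
    then show ?thesis by (rule order_tendstoD) simp
  qed
  from exp_trace_series[OF M] this show ?thesis
  proof eventually_elim
    case (elim u)
    obtain T' where T': "(\<lambda>m. u ^ m * mtrace (?M ^\<^sub>m m) / of_nat m) sums T'"
      "exp T' = inverse (det (1\<^sub>m (length as) - u \<cdot>\<^sub>m ?M))" using elim(1) by blast
    \<comment> \<open>The radius \<open>1 / (card ?S + 1)\<close> is chosen to give both bounds: the
      second makes the sum over all words absolutely convergent, the first keeps each
      \<open>z c\<close> inside the unit disc.\<close>
    have u: "norm u < 1" "norm u * card ?S < 1"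
    proof -
      have "norm u * (card ?S + 1) < 1" using elim(2) by (simp add: field_simps)
      moreover have "norm u * 1 \<le> norm u * (card ?S + 1)" by (intro mult_left_mono) auto
      moreover have "norm u * card ?S \<le> norm u * (card ?S + 1)" by (intro mult_left_mono) auto
      ultimately show "norm u < 1" "norm u * card ?S < 1" by linarith+
    qed
    define W where "W = (\<lambda>q. prod_list (map w q))"
    define h where "h = (\<lambda>q. u ^ length q * W q / of_nat (length q))"
    have W1: "norm (W q) \<le> 1" if "set q \<subseteq> ?S" for q
      using that
    proof (induction q)
      case (Cons a q)
      then show ?case using mult_mono[of "norm (w a)" 1 "norm (W q)" 1] w
        by (simp add: W_def norm_mult)
    qed (simp add: W_def)
    have "(\<lambda>q. norm (h q)) summable_on ?C"
    proof (rule Infinite_Sum.abs_summable_on_comparison_test')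
      show "(\<lambda>q. norm u ^ length q) summable_on ?C"
        by (rule summable_on_subset_banach[OF geometric_lists_summable[of ?S]])
          (use u in \<open>auto simp: cyclic_words_def\<close>)
    next
      fix q assume q: "q \<in> ?C"
      then have "1 \<le> real (length q)" by (cases "length q") (auto simp: cyclic_words_def)
      moreover have "norm u ^ length q * norm (W q) \<le> norm u ^ length q * 1"
        using q by (intro mult_left_mono W1) (auto simp: cyclic_words_def)
      moreover have "norm u ^ length q * 1 \<le> norm u ^ length q * real (length q)"
        using calculation(1) by (intro mult_left_mono) auto
      moreover have "0 < real (length q)" using calculation(1) by linarith
      ultimately show "norm (h q) \<le> norm u ^ length q"
        by (simp add: h_def norm_mult norm_divide norm_power pos_divide_le_eq)
    qed
    then have "h summable_on ?C" by (rule Infinite_Sum.abs_summable_summable)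
    then obtain T where T: "(h has_sum T) ?C" unfolding summable_on_def by blast
    have "((\<lambda>m. u ^ m * mtrace (?M ^\<^sub>m m) / of_nat m) has_sum T) UNIV"
    proof (rule has_sum_fibers[OF T, where g = snd and B = "\<lambda>m. {q \<in> ?C. length q = m}"])
      show "bij_betw snd (SIGMA m:UNIV. {q \<in> ?C. length q = m}) ?C"
        by (rule bij_betw_byWitness[where f' = "\<lambda>q. (length q, q)"]) auto
      fix m :: nat
      let ?L = "{q. set q \<subseteq> ?S \<and> length q = m}"
      have "{q \<in> ?C. length q = m} \<subseteq> ?L" by (auto simp: cyclic_words_def)
      moreover have fin: "finite ?L" by (rule finite_lists_length_eq) simp
      moreover have "u ^ m * mtrace (?M ^\<^sub>m m) / of_nat m = sum h {q \<in> ?C. length q = m}"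
      proof (cases "m = 0")
        case True
        then have "{q \<in> ?C. length q = m} = {}" by (auto simp: cyclic_words_def)
        then show ?thesis using True by (simp only: sum.empty) simp
      next
        case False
        then have "mtrace (?M ^\<^sub>m m) = (\<Sum>q\<in>?L. if q \<in> ?C then W q else 0)"
          unfolding M_def W_def
          by (subst mtrace_mat_on_pow[OF dist]) (auto intro!: sum.cong cyc_weight_cyclic_words)
        also have "\<dots> = (\<Sum>q\<in>{q \<in> ?C. length q = m}. W q)"
          using fin by (subst sum.inter_filter[symmetric])
            (auto intro!: sum.cong simp: cyclic_words_def)
        finally show ?thesis by (simp add: h_def sum_distrib_left sum_divide_distrib)
      qed
      ultimately show "((\<lambda>q. h (snd (m, q))) has_sum u ^ m * mtrace (?M ^\<^sub>m m) / of_nat m)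
          {q \<in> ?C. length q = m}"
        by (intro has_sum_finiteI) (auto dest: finite_subset)
    qed
    then have "T = T'" using T'(1) has_sum_imp_sums sums_unique2 by blast
    let ?P = "{c \<in> ?C. primitive c}"
    define z where "z = (\<lambda>c. W c * u ^ length c)"
    have z1: "norm (z c) < 1" if "c \<in> ?C" for c
    proof -
      have "length c > 0" "set c \<subseteq> ?S" using that by (auto simp: cyclic_words_def)
      then have "norm u ^ length c < 1" using u by (simp add: power_less_one_iff)
      moreover have "norm (W c) * norm u ^ length c \<le> 1 * norm u ^ length c"
        by (intro mult_right_mono W1) (use \<open>set c \<subseteq> ?S\<close> in auto)
      ultimately show ?thesis by (simp add: z_def norm_mult norm_power)
    qed
    \<comment> \<open>The divisor of \<open>concat (replicate k c)\<close> is
      \<open>k * length c\<close>. The factor \<open>k\<close> builds the logarithm; the factor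
      \<open>length c\<close> stays and is cancelled later by the \<open>length c\<close> rotations
      of \<open>c\<close>.\<close>
    have "((\<lambda>c. - Ln (1 - z c) / of_nat (length c)) has_sum T) ?P"
    proof (rule has_sum_fibers[OF T cyclic_word_roots])
      fix c assume c: "c \<in> ?P"
      then have zc: "norm (z c) < 1" using z1 by simp
      have "((\<lambda>k. z c ^ k / of_nat k) has_sum - Ln (1 - z c)) UNIV"
      proof (rule norm_summable_imp_has_sum[OF _ minus_Ln_series[OF zc]])
        show "summable (\<lambda>k. norm (z c ^ k / of_nat k))"
        proof (rule summable_comparison_test[OF _ summable_geometric[of "norm (z c)"]])
          show "\<exists>N. \<forall>k\<ge>N. norm (norm (z c ^ k / of_nat k)) \<le> norm (z c) ^ k"
            by (intro exI[of _ 1] allI impI)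
              (simp add: norm_divide norm_power divide_le_eq mult_le_cancel_left1)
        qed (use zc in simp)
      qed
      \<comment> \<open>The term at \<open>k = 0\<close> is a division by zero, hence 0, and may be
        dropped.\<close>
      then have "((\<lambda>k. z c ^ k / of_nat k) has_sum - Ln (1 - z c)) {0<..}"
        by (subst has_sum_cong_neutral[where T = UNIV]) auto
      then have "((\<lambda>k. inverse (of_nat (length c)) * (z c ^ k / of_nat k))
          has_sum inverse (of_nat (length c)) * - Ln (1 - z c)) {0<..}"
        by (rule has_sum_cmult_right)
      moreover have "inverse (of_nat (length c)) * (z c ^ k / of_nat k)
          = h (case (c, k) of (c, k) \<Rightarrow> concat (replicate k c))" for k
      proof -
        have "W (concat (replicate k c)) = W c ^ k"
          by (induction k) (simp_all add: W_def)
        then show ?thesis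
          by (simp add: h_def z_def power_mult_distrib power_mult[symmetric] field_simps)
      qed
      ultimately show "((\<lambda>k. h (case (c, k) of (c, k) \<Rightarrow> concat (replicate k c)))
          has_sum - Ln (1 - z c) / of_nat (length c)) {0<..}"
        by (simp add: field_simps)
    qed
    then have "((\<lambda>P. - Ln (1 - Z P * u ^ \<nu> P)) has_sum T) (necklaces ?S R)"
    proof (rule has_sum_fibers[OF _ necklaces_partition])
      fix P assume "P \<in> necklaces ?S R"
      then obtain p where p: "p \<in> ?C" "primitive p" "P = rotations p" by (auto simp: necklaces_def)
      then have "p \<noteq> []" by (simp add: cyclic_words_def)
      have "z c = Z P * u ^ \<nu> P \<and> length c = length p" if "c \<in> P" for c
      proof -
        have "c \<in> ?C" "primitive c"
          using that p by (auto simp: rotations_def cyclic_words_rotate primitive_rotate)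
        moreover have "rotations c = P" using rotations_eq that p by simp
        moreover have "length c = length p" using that p by (auto simp: rotations_def)
        ultimately show ?thesis using Z[of c] \<nu>[of c] by (simp add: z_def W_def)
      qed
      then have "(\<Sum>c\<in>P. - Ln (1 - z c) / of_nat (length c))
          = (\<Sum>c\<in>P. - Ln (1 - Z P * u ^ \<nu> P) / of_nat (length p))"
        by (intro sum.cong) auto
      also have "\<dots> = - Ln (1 - Z P * u ^ \<nu> P)"
        using card_rotations[OF p(2) \<open>p \<noteq> []\<close>] \<open>p \<noteq> []\<close> p(3) by simp
      finally show "((\<lambda>c. - Ln (1 - z (snd (P, c))) / of_nat (length (snd (P, c))))
          has_sum - Ln (1 - Z P * u ^ \<nu> P)) P"
        using card_rotations[OF p(2) \<open>p \<noteq> []\<close>] p(3) by (intro has_sum_finiteI) auto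
    qed
    \<comment> \<open>Each finite sum of logarithms exponentiates exactly to the finite partial
      product, so no branch of the logarithm of a product is ever chosen.\<close>
    then have "((\<lambda>F. exp (\<Sum>P\<in>F. - Ln (1 - Z P * u ^ \<nu> P))) \<longlongrightarrow> exp T)
        (finite_subsets_at_top (necklaces ?S R))"
      unfolding has_sum_def by (rule tendsto_exp)
    moreover have "\<forall>\<^sub>F F in finite_subsets_at_top (necklaces ?S R).
        exp (\<Sum>P\<in>F. - Ln (1 - Z P * u ^ \<nu> P)) = (\<Prod>P\<in>F. inverse (1 - Z P * u ^ \<nu> P))"
    proof (rule eventually_finite_subsets_at_top_weakI)
      fix F assume F: "finite F" "F \<subseteq> necklaces ?S R"
      have "exp (- Ln (1 - Z P * u ^ \<nu> P)) = inverse (1 - Z P * u ^ \<nu> P)" if "P \<in> F" for P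
      proof -
        have "P \<in> necklaces ?S R" using that F by blast
        then obtain p where p: "p \<in> ?C" "primitive p" "P = rotations p"
          by (auto simp: necklaces_def)
        then have "Z P * u ^ \<nu> P = z p" using Z \<nu> by (simp add: z_def W_def)
        then have "1 - Z P * u ^ \<nu> P \<noteq> 0" using z1[OF p(1)] by auto
        then show ?thesis by (simp add: exp_minus)
      qed
      then show "exp (\<Sum>P\<in>F. - Ln (1 - Z P * u ^ \<nu> P)) = (\<Prod>P\<in>F. inverse (1 - Z P * u ^ \<nu> P))"
        using F by (simp add: exp_sum)
    qed
    ultimately have "((\<lambda>F. \<Prod>P\<in>F. inverse (1 - Z P * u ^ \<nu> P)) \<longlongrightarrow> exp T)
        (finite_subsets_at_top (necklaces ?S R))"
      by (rule Lim_transform_eventually)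
    then show ?case using T'(2) \<open>T = T'\<close> by simp
  qed
qed

section \<open>Characters of finite abelian groups\<close>

text \<open>A character of \<open>H\<close> whose values outside \<open>H\<close> are left free, so
  that it can be extended to larger subgroups without changing its type.\<close>

definition mult_on :: "('g, 'm) monoid_scheme \<Rightarrow> 'g set \<Rightarrow> ('g \<Rightarrow> complex) \<Rightarrow> bool" where
  "mult_on G H f \<longleftrightarrow> (\<forall>x\<in>H. \<forall>y\<in>H. f (x \<otimes>\<^bsub>G\<^esub> y) = f x * f y) \<and> (\<forall>x\<in>H. f x \<noteq> 0)"

lemma characters_iff:
  "\<psi> \<in> characters G \<longleftrightarrow> mult_on G (carrier G) \<psi> \<and> \<psi> \<in> extensional (carrier G)"
  by (auto simp: characters_def mult_on_def hom_def complex_units_def)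

lemma (in monoid) mult_on_one: "mult_on G H f \<Longrightarrow> \<one> \<in> H \<Longrightarrow> f \<one> = 1"
  unfolding mult_on_def by (metis l_one mult_cancel_right1 one_closed)

lemma (in monoid) mult_on_pow:
  assumes "mult_on G H f" "\<one> \<in> H" "x \<in> H" "\<And>x y. x \<in> H \<Longrightarrow> y \<in> H \<Longrightarrow> x \<otimes> y \<in> H"
  shows "f (x [^] (k::nat)) = f x ^ k \<and> x [^] k \<in> H"
  by (induction k) (use assms mult_on_one in \<open>auto simp: mult_on_def\<close>)

context comm_group
begin

lemma subgroup_cancel:
  assumes "subgroup H G" "h \<in> H" "a \<in> carrier G" "h \<otimes> a \<in> H"
  shows "a \<in> H"
proof -
  interpret subgroup H G by (rule assms(1))
  have "inv h \<otimes> (h \<otimes> a) \<in> H" using assms by simp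
  then show ?thesis using assms by (simp add: m_assoc[symmetric])
qed

lemma subgroup_pow: "subgroup H G \<Longrightarrow> h \<in> H \<Longrightarrow> h [^] (k::nat) \<in> H"
  by (induction k) (auto simp: subgroup.one_closed subgroup.m_closed)

text \<open>Adjoining one element: \<open>n\<close> is the order of \<open>x\<close> modulo
  \<open>H\<close>, and any \<open>n\<close>-th root \<open>c\<close> of \<open>f (x [^] n)\<close>
  defines an extension sending \<open>h \<otimes> x [^] k\<close> to \<open>f h * c ^ k\<close>. The
  content is that this is well defined.\<close>

lemma character_extend:
  assumes fin: "finite (carrier G)" and H: "subgroup H G" and f: "mult_on G H f"
    and x: "x \<in> carrier G" and n: "n > 0" "x [^] n \<in> H"
    and least: "\<And>k. 0 < k \<Longrightarrow> k < n \<Longrightarrow> x [^] k \<notin> H"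
    and c: "c ^ n = f (x [^] (n::nat))" "c \<noteq> 0"
  obtains K f' where "subgroup K G" "mult_on G K f'" "insert x H \<subseteq> K" "\<forall>h\<in>H. f' h = f h" "f' x = c"
proof -
  interpret H: subgroup H G by (rule H)
  have HG: "h \<in> carrier G" if "h \<in> H" for h using that by (rule H.mem_carrier)
  have xk: "x [^] (k::nat) \<in> carrier G" for k using x by simp
  have dvd: "n dvd k" if "x [^] k \<in> H" for k
  proof -
    have "x [^] k = x [^] (n * (k div n)) \<otimes> x [^] (k mod n)"
      using x by (simp add: nat_pow_mult)
    moreover have "x [^] (n * (k div n)) \<in> H"
      using x subgroup_pow[OF H n(2), of "k div n"] by (simp add: nat_pow_pow)
    ultimately have "x [^] (k mod n) \<in> H"
      using that subgroup_cancel[OF H _ xk] by simp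
    then have "k mod n = 0" using least[of "k mod n"] n(1) by (cases "k mod n = 0") auto
    then show ?thesis by auto
  qed
  \<comment> \<open>Two representations of one element differ by a power of \<open>x\<close> lying
    in \<open>H\<close>. Its exponent is a multiple of \<open>n\<close> by \<open>dvd\<close>, and
    on such powers \<open>f\<close> is given by powers of \<open>c\<close>.\<close>
  have wd_le: "f h * c ^ k = f h' * c ^ k'"
    if "h \<in> H" "h' \<in> H" "h \<otimes> x [^] k = h' \<otimes> x [^] k'" "k \<le> k'" for h h' k k'
  proof -
    have "x [^] k' = x [^] (k' - k) \<otimes> x [^] k" using x that(4) by (simp add: nat_pow_mult)
    then have "h \<otimes> x [^] k = (h' \<otimes> x [^] (k' - k)) \<otimes> x [^] k"
      using that x HG by (simp add: m_assoc)
    then have e: "h = h' \<otimes> x [^] (k' - k)" using that x HG by simp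
    then have xH: "x [^] (k' - k) \<in> H"
      using that(1) subgroup_cancel[OF H that(2) xk] by simp
    then obtain j where j: "k' - k = n * j" using dvd by blast
    have "f (x [^] (k' - k)) = c ^ (k' - k)"
      using mult_on_pow[OF f H.one_closed n(2) H.m_closed, of j]
      by (simp add: j nat_pow_pow[OF x, symmetric] power_mult c)
    moreover have "f h = f h' * f (x [^] (k' - k))"
      using e f that(2) xH unfolding mult_on_def by metis
    ultimately show ?thesis using that(4) by (simp add: power_add[symmetric])
  qed
  have wd: "f h * c ^ k = f h' * c ^ k'"
    if "h \<in> H" "h' \<in> H" "h \<otimes> x [^] k = h' \<otimes> x [^] k'" for h h' k k'
  proof (cases "k \<le> k'")
    case False
    then show ?thesis using wd_le[OF that(2,1) that(3)[symmetric]] by simp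
  qed (rule wd_le[OF that])
  define K where "K = {h \<otimes> x [^] (k::nat) | h k. h \<in> H}"
  define f' where "f' = (\<lambda>y. THE z. \<exists>h k. h \<in> H \<and> y = h \<otimes> x [^] (k::nat) \<and> z = f h * c ^ k)"
  have f': "f' (h \<otimes> x [^] k) = f h * c ^ k" if "h \<in> H" for h k
    unfolding f'_def
  proof (rule the_equality)
    show "\<exists>h' k'. h' \<in> H \<and> h \<otimes> x [^] k = h' \<otimes> x [^] (k'::nat) \<and> f h * c ^ k = f h' * c ^ k'"
      using that by blast
    fix z assume "\<exists>h' k'. h' \<in> H \<and> h \<otimes> x [^] k = h' \<otimes> x [^] (k'::nat) \<and> z = f h' * c ^ k'"
    then show "z = f h * c ^ k" using wd[OF that] by metis
  qed
  have mK: "(h \<otimes> x [^] k) \<otimes> (h' \<otimes> x [^] k') = (h \<otimes> h') \<otimes> x [^] (k + k')"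
    if "h \<in> H" "h' \<in> H" for h h' and k k' :: nat
    using that x HG by (simp add: nat_pow_mult[symmetric] m_ac)
  have HK: "h \<in> K" "f' h = f h" if "h \<in> H" for h
  proof -
    have "h = h \<otimes> x [^] (0::nat)" using that HG by simp
    then show "h \<in> K" unfolding K_def using that by blast
    show "f' h = f h" using f'[OF that, of 0] that HG by simp
  qed
  have xe: "x = \<one> \<otimes> x [^] (1::nat)" using x by simp
  have "x \<in> K" unfolding K_def using xe H.one_closed by blast
  moreover have "f' x = c" using f'[OF H.one_closed, of 1] x mult_on_one[OF f] by simp
  moreover have "subgroup K G"
  proof (rule subgroupI)
    show "K \<subseteq> carrier G" using x HG by (auto simp: K_def)
    show "K \<noteq> {}" using \<open>x \<in> K\<close> by blast
    fix a assume "a \<in> K"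
    then obtain h k where h: "h \<in> H" "a = h \<otimes> x [^] (k::nat)" by (auto simp: K_def)
    let ?o = "order G"
    \<comment> \<open>The set \<open>K\<close> contains natural exponents only, so
      \<open>x [^] (k * (?o - 1))\<close> stands in for the inverse of \<open>x [^] k\<close>: the
      exponents add up to \<open>?o * k\<close>.\<close>
    have "a \<otimes> (inv h \<otimes> x [^] (k * (?o - 1))) = \<one>"
    proof -
      have "a \<otimes> (inv h \<otimes> x [^] (k * (?o - 1))) = x [^] (k + k * (?o - 1))"
        unfolding h(2) using mK[OF h(1) H.m_inv_closed[OF h(1)], of k "k * (?o - 1)"] h HG x by simp
      also have "k + k * (?o - 1) = ?o * k"
        using fin order_gt_0_iff_finite by (cases ?o) auto
      also have "x [^] (?o * k) = \<one>" using x power_order_eq_one[OF fin x, folded order_def] by (simp add: nat_pow_pow[symmetric])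
      finally show ?thesis .
    qed
    then have "inv a = inv h \<otimes> x [^] (k * (?o - 1))"
      using h HG[OF h(1)] xk by (intro comm_inv_char) simp_all
    then show "inv a \<in> K" unfolding K_def using h by blast
    fix b assume "b \<in> K"
    then obtain h' k' where h': "h' \<in> H" "b = h' \<otimes> x [^] (k'::nat)" by (auto simp: K_def)
    have "a \<otimes> b = (h \<otimes> h') \<otimes> x [^] (k + k')" using h h' mK by simp
    moreover have "h \<otimes> h' \<in> H" using h(1) h'(1) by (rule H.m_closed)
    ultimately show "a \<otimes> b \<in> K" unfolding K_def by blast
  qed
  moreover have "mult_on G K f'"
    unfolding mult_on_def
  proof (intro conjI ballI)
    fix a assume "a \<in> K"
    then obtain h k where h: "h \<in> H" "a = h \<otimes> x [^] (k::nat)" by (auto simp: K_def)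
    then show "f' a \<noteq> 0" using f' f c by (simp add: mult_on_def)
    fix b assume "b \<in> K"
    then obtain h' k' where h': "h' \<in> H" "b = h' \<otimes> x [^] (k'::nat)" by (auto simp: K_def)
    show "f' (a \<otimes> b) = f' a * f' b"
      using f h h' by (simp add: mK f' mult_on_def power_add)
  qed
  ultimately show ?thesis using that HK by blast
qed

lemma least_power_in_subgroup:
  assumes fin: "finite (carrier G)" and H: "subgroup H G" and x: "x \<in> carrier G"
  obtains n :: nat where "n > 0" "x [^] n \<in> H" "\<And>k. 0 < k \<Longrightarrow> k < n \<Longrightarrow> x [^] k \<notin> H"
proof -
  let ?P = "\<lambda>n. 0 < n \<and> x [^] (n::nat) \<in> H"
  have "?P (order G)"
    using power_order_eq_one[OF fin x, folded order_def] order_gt_0_iff_finite fin subgroup.one_closed[OF H] by simp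
  then have "?P (LEAST n. ?P n)" by (rule LeastI)
  then show ?thesis using not_less_Least[of _ ?P] by (intro that[of "LEAST n. ?P n"]) blast+
qed

text \<open>A maximal subgroup among those carrying a character nontrivial at \<open>g\<close> is
  the whole group, since otherwise one more element could be adjoined. The family is nonempty:
  starting from the trivial subgroup, \<open>g\<close> may be sent to a nontrivial root of
  unity.\<close>

lemma exists_character_nontrivial:
  assumes fin: "finite (carrier G)" and g: "g \<in> carrier G" "g \<noteq> \<one>"
  obtains \<psi> where "\<psi> \<in> characters G" "\<psi> g \<noteq> 1"
proof -
  let ?A = "{K. subgroup K G \<and> (\<exists>f. mult_on G K f \<and> g \<in> K \<and> f g \<noteq> 1)}"
  have "?A \<noteq> {}"
  proof -
    have T: "subgroup {\<one>} G" by (rule triv_subgroup)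
    obtain n :: nat where n: "n > 0" "g [^] n \<in> {\<one>}" "\<And>k. 0 < k \<Longrightarrow> k < n \<Longrightarrow> g [^] k \<notin> {\<one>}"
      using least_power_in_subgroup[OF fin T g(1)] by blast
    \<comment> \<open>Here \<open>n\<close> is the order of \<open>g\<close>; being at least 2, it
      leaves room for an \<open>n\<close>-th root of unity other than 1.\<close>
    have "n \<noteq> 1" using n g by auto
    then have "card {z::complex. z ^ n = 1} > 1" using card_roots_unity_eq[of n] n(1) by simp
    moreover have "card {z::complex. z ^ n = 1} \<le> 1" if "{z::complex. z ^ n = 1} \<subseteq> {1}"
      using card_mono[OF _ that] by simp
    ultimately obtain c :: complex where c: "c ^ n = 1" "c \<noteq> 1" by force
    have "c \<noteq> 0" using c(1) n(1) by (intro notI) (simp add: power_0_left)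
    have "mult_on G {\<one>} (\<lambda>_. 1)" by (simp add: mult_on_def)
    then obtain K f where "subgroup K G" "mult_on G K f" "insert g {\<one>} \<subseteq> K" "f g = c"
      using character_extend[OF fin T _ g(1) n, of "\<lambda>_. 1" c] c \<open>c \<noteq> 0\<close> by metis
    then show ?thesis using c by blast
  qed
  moreover have "finite ?A"
    by (rule finite_subset[of _ "Pow (carrier G)"]) (use fin in \<open>auto dest: subgroup.subset\<close>)
  ultimately obtain H where HA: "H \<in> ?A" and max: "\<And>K. K \<in> ?A \<Longrightarrow> H \<subseteq> K \<Longrightarrow> H = K"
    using finite_has_maximal[of ?A] by blast
  obtain f where H: "subgroup H G" "mult_on G H f" "g \<in> H" "f g \<noteq> 1" using HA by blast
  have "x \<in> H" if x: "x \<in> carrier G" for x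
  proof (rule ccontr)
    assume xH: "x \<notin> H"
    obtain n :: nat where n: "n > 0" "x [^] n \<in> H" "\<And>k. 0 < k \<Longrightarrow> k < n \<Longrightarrow> x [^] k \<notin> H"
      using least_power_in_subgroup[OF fin H(1) x] by blast
    let ?a = "f (x [^] n)"
    have a: "?a \<noteq> 0" using H(2) n by (simp add: mult_on_def)
    have "exp (Ln ?a / of_nat n) ^ n = exp (of_nat n * (Ln ?a / of_nat n))"
      by (rule exp_of_nat_mult[symmetric])
    also have "\<dots> = ?a" using a n by simp
    finally obtain K f' where K: "subgroup K G" "mult_on G K f'" "insert x H \<subseteq> K" "\<forall>h\<in>H. f' h = f h"
      using character_extend[OF fin H(1,2) x n, of "exp (Ln ?a / of_nat n)"] by (metis exp_not_eq_zero)
    then have "K \<in> ?A" using H by auto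
    then have "H = K" using max K(3) by blast
    then show False using K(3) xH by blast
  qed
  then have "H = carrier G" using H(1) subgroup.subset by blast
  then have "restrict f (carrier G) \<in> characters G" "restrict f (carrier G) g \<noteq> 1"
    using H g by (auto simp: characters_iff mult_on_def)
  then show ?thesis by (rule that)
qed

lemma character_mult:
  "\<psi> \<in> characters G \<Longrightarrow> x \<in> carrier G \<Longrightarrow> y \<in> carrier G \<Longrightarrow> \<psi> (x \<otimes> y) = \<psi> x * \<psi> y"
  by (simp add: characters_iff mult_on_def)

lemma character_one: "\<psi> \<in> characters G \<Longrightarrow> \<psi> \<one> = 1"
  by (rule mult_on_one[of "carrier G"]) (simp_all add: characters_iff)

lemma character_inv: "\<psi> \<in> characters G \<Longrightarrow> x \<in> carrier G \<Longrightarrow> \<psi> x * \<psi> (inv x) = 1"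
  by (metis character_mult character_one inv_closed r_inv)

lemma character_power_order:
  assumes "finite (carrier G)" "\<psi> \<in> characters G" "x \<in> carrier G"
  shows "\<psi> x ^ order G = 1"
proof -
  have "\<psi> (x [^] order G) = \<psi> x ^ order G"
    using mult_on_pow[of "carrier G" \<psi> x "order G"] assms(2,3) by (simp add: characters_iff)
  then show ?thesis using power_order_eq_one[OF assms(1,3), folded order_def] character_one[OF assms(2)] by simp
qed

lemma norm_character:
  assumes "finite (carrier G)" "\<psi> \<in> characters G" "x \<in> carrier G"
  shows "norm (\<psi> x) = 1"
proof -
  have "norm (\<psi> x) ^ order G = 1" by (metis norm_power norm_one character_power_order[OF assms])
  moreover have "order G > 0" using assms(1) by (simp add: order_gt_0_iff_finite)
  ultimately show ?thesis
    using power_eq_iff_eq_base[of "order G" "norm (\<psi> x)" 1] by simp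
qed

lemma cnj_character:
  assumes "finite (carrier G)" "\<psi> \<in> characters G" "x \<in> carrier G"
  shows "cnj (\<psi> x) = \<psi> (inv x)"
proof -
  have "\<psi> x * cnj (\<psi> x) = 1"
    using norm_character[OF assms] by (simp add: complex_norm_square[symmetric])
  then have "\<psi> x * cnj (\<psi> x) = \<psi> x * \<psi> (inv x)" using character_inv assms by simp
  moreover have "\<psi> x \<noteq> 0" using norm_character[OF assms] by auto
  ultimately show ?thesis by simp
qed

lemma finite_characters:
  assumes "finite (carrier G)"
  shows "finite (characters G)"
proof (rule finite_subset)
  show "characters G \<subseteq> carrier G \<rightarrow>\<^sub>E {z. z ^ order G = 1}"
    using character_power_order[OF assms] by (auto simp: characters_iff PiE_def)
  have "order G > 0" using assms by (simp add: order_gt_0_iff_finite)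
  then show "finite (carrier G \<rightarrow>\<^sub>E {z::complex. z ^ order G = 1})"
    by (intro finite_PiE assms finite_roots_unity) simp
qed

lemma character_times:
  assumes "\<psi> \<in> characters G" "\<phi> \<in> characters G"
  shows "(\<lambda>x\<in>carrier G. \<psi> x * \<phi> x) \<in> characters G"
  using assms by (auto simp: characters_iff mult_on_def)

lemma trivial_char_character: "trivial_char G \<in> characters G"
  by (auto simp: characters_iff mult_on_def trivial_char_def)

lemma sum_character:
  assumes "\<psi> \<in> characters G"
  shows "(\<Sum>x\<in>carrier G. \<psi> x) = (if \<psi> = trivial_char G then of_nat (order G) else 0)"
proof (cases "\<psi> = trivial_char G")
  case False
  then obtain y where y: "y \<in> carrier G" "\<psi> y \<noteq> 1"
    using assms by (force simp: trivial_char_def characters_iff extensional_def restrict_def)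
  have "(\<Sum>x\<in>carrier G. \<psi> x) = (\<Sum>x\<in>carrier G. \<psi> (y \<otimes> x))"
    using y by (intro sum.reindex_bij_witness[of _ "\<lambda>x. y \<otimes> x" "\<lambda>x. inv y \<otimes> x"])
      (auto simp: m_assoc[symmetric])
  also have "\<dots> = \<psi> y * (\<Sum>x\<in>carrier G. \<psi> x)"
    using assms y by (simp add: character_mult sum_distrib_left)
  finally show ?thesis using False y by simp
qed (simp add: trivial_char_def order_def)

text \<open>Away from the identity, multiplication by a character nontrivial at the given element
  permutes the characters and scales the sum. At the identity the sum counts the characters; this
  count is found by evaluating the double sum over elements and characters in both orders.\<close>

lemma sum_characters:
  assumes fin: "finite (carrier G)" and g: "g \<in> carrier G"
  shows "(\<Sum>\<psi>\<in>characters G. \<psi> g) = (if g = \<one> then of_nat (order G) else 0)"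
proof -
  have z: "(\<Sum>\<psi>\<in>characters G. \<psi> h) = 0" if h: "h \<in> carrier G" "h \<noteq> \<one>" for h
  proof -
    obtain \<phi> where \<phi>: "\<phi> \<in> characters G" "\<phi> h \<noteq> 1" using exists_character_nontrivial[OF fin h] by blast
    let ?m = "\<lambda>\<phi> \<psi>. \<lambda>x\<in>carrier G. \<phi> x * \<psi> x :: complex"
    let ?c = "\<lambda>x\<in>carrier G. \<phi> (inv x)"
    have c: "?c \<in> characters G"
      using \<phi>(1) by (auto simp: characters_iff mult_on_def inv_mult)
    have ne: "\<phi> x \<noteq> 0" if "x \<in> carrier G" for x using \<phi>(1) that by (simp add: characters_iff mult_on_def)
    have inv: "?m ?c (?m \<phi> \<psi>) = \<psi>" "?m \<phi> (?m ?c \<psi>) = \<psi>" if "\<psi> \<in> characters G" for \<psi>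
    proof -
      have i: "\<phi> (inv x) * (\<phi> x * \<psi> x) = \<psi> x" "\<phi> x * (\<phi> (inv x) * \<psi> x) = \<psi> x"
        if "x \<in> carrier G" for x
        using character_inv[OF \<phi>(1) that] by (simp_all add: mult.assoc[symmetric] mult.commute)
      show "?m ?c (?m \<phi> \<psi>) = \<psi>" "?m \<phi> (?m ?c \<psi>) = \<psi>"
        using that i by (auto simp: fun_eq_iff characters_iff extensional_def)
    qed
    have "(\<Sum>\<psi>\<in>characters G. \<psi> h) = (\<Sum>\<psi>\<in>characters G. ?m \<phi> \<psi> h)"
      by (rule sum.reindex_bij_witness[of _ "?m \<phi>" "?m ?c"])
        (use inv character_times[OF \<phi>(1)] character_times[OF c] in auto)
    also have "\<dots> = \<phi> h * (\<Sum>\<psi>\<in>characters G. \<psi> h)" using h by (simp add: sum_distrib_left)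
    finally show ?thesis using \<phi>(2) by simp
  qed
  have "(\<Sum>x\<in>carrier G. \<Sum>\<psi>\<in>characters G. \<psi> x) = (\<Sum>\<psi>\<in>characters G. \<Sum>x\<in>carrier G. \<psi> x)"
    by (rule sum.swap)
  also have "\<dots> = of_nat (order G)"
    using finite_characters[OF fin] trivial_char_character by (simp add: sum_character)
  finally have o: "(\<Sum>x\<in>carrier G. \<Sum>\<psi>\<in>characters G. \<psi> x) = of_nat (order G)" .
  have "(\<Sum>x\<in>carrier G. \<Sum>\<psi>\<in>characters G. \<psi> x)
      = (\<Sum>x\<in>carrier G. if x = \<one> then (\<Sum>\<psi>\<in>characters G. \<psi> \<one>) else 0)"
    by (intro sum.cong refl) (auto simp: z)
  also have "\<dots> = (\<Sum>\<psi>\<in>characters G. \<psi> \<one>)" using fin by simp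
  finally have "(\<Sum>\<psi>\<in>characters G. \<psi> \<one>) = of_nat (order G)" unfolding o by (rule sym)
  then show ?thesis using z[OF g] by auto
qed

end

section \<open>Unramified covers and unique lifting of arcs\<close>

lemma topspace_realization: "topspace (realization G r) = points G r"
proof
  have "openin (top_of_set {0..1}) {t \<in> {0..1}. arc_point G r a t \<in> points G r}" if "a \<in> arcs G" for a
  proof -
    have "{t \<in> {0..1}. arc_point G r a t \<in> points G r} = {0..1}"
      using that by (auto simp: points_def)
    then show ?thesis by simp
  qed
  then have "openin (realization G r) (points G r)" by (simp add: openin_realization)
  then show "points G r \<subseteq> topspace (realization G r)" by (rule openin_subset)
  show "topspace (realization G r) \<subseteq> points G r"
    using openin_topspace[of "realization G r"] unfolding openin_realization by blast
qed

lemma Inl_in_points: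
  assumes "wf_digraph G"
  shows "Inl v \<in> points G r \<longleftrightarrow> v \<in> verts G"
  using wf_digraph.tail_in_verts[OF assms] wf_digraph.head_in_verts[OF assms]
  by (auto simp: points_def arc_point_def split: if_splits)

lemma realize_simps:
  "realize f (Inl v) = Inl (fst f v)"
  "0 < t \<Longrightarrow> t < 1 \<Longrightarrow> realize f (arc_point G r a t) = Inr {(snd f a, t), (snd f (r a), 1 - t)}"
  by (simp_all add: realize_def arc_point_def)

section \<open>Lifting in the cover and freeness of the deck action\<close>

locale abelian_covering =
  fixes X :: "('v, 'a) pre_digraph" and r :: "'a \<Rightarrow> 'a"
    and Y :: "('w, 'b) pre_digraph" and s :: "'b \<Rightarrow> 'b"
    and \<pi> :: "('w \<Rightarrow> 'v) \<times> ('b \<Rightarrow> 'a)"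
  assumes finite_X: "finite_multigraph X r" and finite_Y: "finite_multigraph Y s"
    and connected_Y: "Digraph_Component.connected Y"
    and abelian: "abelian_cover Y s X r \<pi>"
begin

sublocale X: fin_digraph X using finite_X by (simp add: finite_multigraph_def)
sublocale X: bidirected_digraph X r using finite_X by (simp add: finite_multigraph_def)
sublocale Y: fin_digraph Y using finite_Y by (simp add: finite_multigraph_def)
sublocale Y: bidirected_digraph Y s using finite_Y by (simp add: finite_multigraph_def)

abbreviation "G \<equiv> deck_group Y s \<pi>"

sublocale G: comm_group G using abelian by (simp add: abelian_cover_def)

lemma cover: "multigraph_cover Y s X r \<pi>" and galois: "galois_cover Y s X r \<pi>"
  using abelian by (auto simp: abelian_cover_def galois_cover_def)

lemma proj:
  "w \<in> verts Y \<Longrightarrow> fst \<pi> w \<in> verts X" "b \<in> arcs Y \<Longrightarrow> snd \<pi> b \<in> arcs X"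
  "b \<in> arcs Y \<Longrightarrow> tail X (snd \<pi> b) = fst \<pi> (tail Y b)"
  "b \<in> arcs Y \<Longrightarrow> head X (snd \<pi> b) = fst \<pi> (head Y b)"
  "b \<in> arcs Y \<Longrightarrow> snd \<pi> (s b) = r (snd \<pi> b)"
  using cover by (auto simp: multigraph_cover_def multigraph_morphism_def)

lemma deck:
  assumes "g \<in> carrier G"
  shows "w \<in> verts Y \<Longrightarrow> fst g w \<in> verts Y" "b \<in> arcs Y \<Longrightarrow> snd g b \<in> arcs Y"
    "b \<in> arcs Y \<Longrightarrow> tail Y (snd g b) = fst g (tail Y b)"
    "b \<in> arcs Y \<Longrightarrow> head Y (snd g b) = fst g (head Y b)"
    "b \<in> arcs Y \<Longrightarrow> snd g (s b) = s (snd g b)"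
    "w \<in> verts Y \<Longrightarrow> fst \<pi> (fst g w) = fst \<pi> w" "b \<in> arcs Y \<Longrightarrow> snd \<pi> (snd g b) = snd \<pi> b"
  using assms by (auto simp: deck_group_def multigraph_morphism_def Bij_def bij_betw_def)

lemma deck_Bij: "g \<in> carrier G \<Longrightarrow> fst g \<in> Bij (verts Y) \<and> snd g \<in> Bij (arcs Y)"
  by (auto simp: deck_group_def)

lemma deck_mult:
  assumes "g \<in> carrier G" "h \<in> carrier G"
  shows "w \<in> verts Y \<Longrightarrow> fst (g \<otimes>\<^bsub>G\<^esub> h) w = fst g (fst h w)"
    "b \<in> arcs Y \<Longrightarrow> snd (g \<otimes>\<^bsub>G\<^esub> h) b = snd g (snd h b)"
  using deck_Bij[OF assms(1)] deck_Bij[OF assms(2)]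
  by (auto simp: deck_group_def DirProd_def BijGroup_def compose_def split: prod.splits)

lemma deck_one: "\<one>\<^bsub>G\<^esub> = (\<lambda>w\<in>verts Y. w, \<lambda>b\<in>arcs Y. b)"
  by (simp add: deck_group_def DirProd_def BijGroup_def)

lemma deck_inv:
  assumes "g \<in> carrier G" "w \<in> verts Y"
  shows "fst (inv\<^bsub>G\<^esub> g) (fst g w) = w" "fst g (fst (inv\<^bsub>G\<^esub> g) w) = w"
  using deck_mult(1)[of "inv\<^bsub>G\<^esub> g" g w] deck_mult(1)[of g "inv\<^bsub>G\<^esub> g" w] assms
  by (simp_all add: deck_one)

lemma surj_points: "realize \<pi> ` points Y s = points X r"
  using cover by (simp add: multigraph_cover_def covering_map_def topspace_realization)

lemma surj_verts:
  assumes "v \<in> verts X"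
  obtains w where "w \<in> verts Y" "fst \<pi> w = v"
proof -
  have "Inl v \<in> realize \<pi> ` points Y s"
    unfolding surj_points Inl_in_points[OF X.wf_digraph] by (rule assms)
  then obtain y where y: "y \<in> points Y s" "realize \<pi> y = Inl v" by force
  then obtain w where "y = Inl w" by (cases y) (auto simp: realize_def)
  then show ?thesis using that y Inl_in_points[OF Y.wf_digraph] by (auto simp: realize_simps)
qed

lemma transitive_verts:
  assumes "w \<in> verts Y" "w' \<in> verts Y" "fst \<pi> w = fst \<pi> w'"
  obtains g where "g \<in> carrier G" "fst g w = w'"
proof -
  have "Inl w \<in> points Y s" "Inl w' \<in> points Y s"
    using assms Inl_in_points[OF Y.wf_digraph] by auto
  then have "\<exists>g\<in>carrier G. realize g (Inl w) = Inl w'"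
    using galois assms unfolding galois_cover_def by (metis realize_simps(1))
  then show ?thesis using that by (auto simp: realize_simps)
qed

text \<open>Surjectivity of the covering map at an interior point of \<open>a\<close> provides an
  arc over \<open>a\<close> or over \<open>r a\<close>, hence one over \<open>a\<close> after
  reversal. A deck transformation then moves its tail to \<open>w\<close>.\<close>

lemma lift_exists:
  assumes "w \<in> verts Y" "a \<in> arcs X" "tail X a = fst \<pi> w"
  obtains b where "b \<in> arcs Y" "tail Y b = w" "snd \<pi> b = a"
proof -
  have "arc_point X r a (1/3) \<in> points X r"
    unfolding points_def by (intro UnI2 UN_I[OF assms(2)] imageI) simp
  then have "arc_point X r a (1/3) \<in> realize \<pi> ` points Y s" by (simp only: surj_points)
  then obtain y where y: "arc_point X r a (1/3) = realize \<pi> y" "y \<in> points Y s" by (rule imageE)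
  have "y \<notin> range Inl" using y(1) by (auto simp: realize_simps arc_point_def)
  then obtain b t where b: "b \<in> arcs Y" "y = arc_point Y s b t" "0 < t" "t < 1"
    using y(2) by (auto simp: points_def arc_point_def split: if_splits)
  then have "{(snd \<pi> b, t), (snd \<pi> (s b), 1 - t)} = {(a, 1/3), (r a, 1 - 1/3)}"
    using y(1) by (simp add: realize_simps) (simp add: arc_point_def)
  then have "snd \<pi> b = a \<or> snd \<pi> (s b) = a" by (auto simp: doubleton_eq_iff)
  then obtain b' where b': "b' \<in> arcs Y" "snd \<pi> b' = a" using b(1) Y.arev_in_arcs by blast
  have "fst \<pi> (tail Y b') = fst \<pi> w" using proj(3)[OF b'(1)] b' assms by simp
  then obtain g where g: "g \<in> carrier G" "fst g (tail Y b') = w"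
    using transitive_verts[of "tail Y b'" w] b' assms Y.tail_in_verts by blast
  show ?thesis
    by (rule that[of "snd g b'"]) (use deck[OF g(1)] g(2) b' in auto)
qed

text \<open>A sheet around \<open>w\<close> is open, hence contains initial segments of all arcs leaving \<open>w\<close>, and the
  projection is injective on it.\<close>

lemma lift_unique:
  assumes b: "b \<in> arcs Y" "b' \<in> arcs Y" "tail Y b = tail Y b'" "snd \<pi> b = snd \<pi> b'"
  shows "b = b'"
proof -
  let ?w = "tail Y b"
  have w: "?w \<in> verts Y" using b by simp
  have "Inl (fst \<pi> ?w) \<in> topspace (realization X r)"
    using proj(1)[OF w] by (simp add: topspace_realization Inl_in_points[OF X.wf_digraph])
  then obtain T \<V> where T: "openin (realization X r) T" "Inl (fst \<pi> ?w) \<in> T"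
    and V: "\<Union>\<V> = {x \<in> topspace (realization Y s). realize \<pi> x \<in> T}"
      "\<forall>U\<in>\<V>. openin (realization Y s) U"
      "\<forall>U\<in>\<V>. homeomorphic_map (subtopology (realization Y s) U) (subtopology (realization X r) T) (realize \<pi>)"
    using cover unfolding multigraph_cover_def covering_map_def by meson
  have "Inl ?w \<in> \<Union>\<V>"
    using V(1) T(2) w by (simp add: topspace_realization Inl_in_points[OF Y.wf_digraph] realize_simps)
  then obtain U where U: "U \<in> \<V>" "Inl ?w \<in> U" by blast
  then have oU: "openin (realization Y s) U" using V(2) by blast
  have "U \<subseteq> topspace (realization Y s)" using oU by (rule openin_subset)
  moreover have "inj_on (realize \<pi>) (topspace (subtopology (realization Y s) U))"
    using V(3) U(1) by (intro homeomorphic_imp_injective_map[where Y = "subtopology (realization X r) T"]) blast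
  ultimately have inj: "inj_on (realize \<pi>) U" by (simp add: topspace_subtopology Int_absorb1)
  have near: "\<exists>\<epsilon>>0. \<forall>t. 0 \<le> t \<and> t \<le> 1 \<and> t < \<epsilon> \<longrightarrow> arc_point Y s c t \<in> U"
    if c: "c \<in> arcs Y" "tail Y c = ?w" for c
  proof -
    let ?I = "{t \<in> {0..1}. arc_point Y s c t \<in> U}"
    have "openin (top_of_set {0..1}) ?I" using oU c by (simp add: openin_realization)
    moreover have "0 \<in> ?I" using U(2) c by (simp add: arc_point_def)
    ultimately obtain \<epsilon> where "\<epsilon> > 0" "ball 0 \<epsilon> \<inter> {0..1} \<subseteq> ?I"
      unfolding openin_contains_ball by blast
    then show ?thesis by (intro exI[of _ \<epsilon>]) (auto simp: subset_iff)
  qed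
  obtain \<epsilon>1 where e1: "\<epsilon>1 > 0" "\<forall>t. 0 \<le> t \<and> t \<le> 1 \<and> t < \<epsilon>1 \<longrightarrow> arc_point Y s b t \<in> U"
    using near[of b] b by auto
  obtain \<epsilon>2 where e2: "\<epsilon>2 > 0" "\<forall>t. 0 \<le> t \<and> t \<le> 1 \<and> t < \<epsilon>2 \<longrightarrow> arc_point Y s b' t \<in> U"
    using near[of b'] b by auto
  \<comment> \<open>Below 1/2 the parameters \<open>t\<close> and \<open>1 - t\<close> differ, so
    the unordered pair representing the point determines its arc; at the midpoint \<open>b\<close>
    and \<open>s b\<close> would be indistinguishable.\<close>
  define t where "t = min (1/3) (min (\<epsilon>1/2) (\<epsilon>2/2))"
  have t: "0 < t" "t < 1/2" "t < \<epsilon>1" "t < \<epsilon>2" using e1 e2 by (auto simp: t_def min_def)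
  have "arc_point Y s b t \<in> U" "arc_point Y s b' t \<in> U" using t e1(2) e2(2) by auto
  moreover have "realize \<pi> (arc_point Y s b t) = realize \<pi> (arc_point Y s b' t)"
    using t b by (simp add: realize_simps proj(5))
  ultimately have "arc_point Y s b t = arc_point Y s b' t" using inj by (auto dest: inj_onD)
  then have "{(b, t), (s b, 1 - t)} = {(b', t), (s b', 1 - t)}"
    using t by (simp add: arc_point_def)
  then show ?thesis using t(2) by (auto simp: doubleton_eq_iff)
qed

text \<open>Connectedness concerns the symmetric closure of the adjacency relation; since arcs come
  with their reversals under \<open>s\<close>, closure along forward arcs is enough.\<close>

lemma connected_closed:
  assumes "U \<subseteq> verts Y" "u \<in> U" and step: "\<And>b. b \<in> arcs Y \<Longrightarrow> tail Y b \<in> U \<Longrightarrow> head Y b \<in> U"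
  shows "U = verts Y"
proof -
  have "w \<in> U" if "w \<in> verts Y" for w
  proof -
    have "(u, w) \<in> rtrancl_on (verts Y) ((arcs_ends Y)\<^sup>s)"
      using connected_Y assms that by (auto simp: connected_conv)
    then show ?thesis
    proof (induction rule: rtrancl_on_induct)
      case (step y z)
      then obtain b where b: "b \<in> arcs Y" "(y, z) = (tail Y b, head Y b) \<or> (y, z) = (head Y b, tail Y b)"
        by (auto simp: symcl_def arcs_ends_def arc_to_ends_def)
      then show ?case using assms(3)[of b] assms(3)[of "s b"] step by auto
    qed (rule assms(2))
  qed
  then show ?thesis using assms by blast
qed

text \<open>An arc leaving a fixed vertex and its image have the same tail and the same projection,
  hence coincide by unique lifting. So the fixed vertices are closed along arcs and exhaust
  \<open>Y\<close>.\<close>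

lemma deck_free:
  assumes g: "g \<in> carrier G" and w: "w \<in> verts Y" "fst g w = w"
  shows "g = \<one>\<^bsub>G\<^esub>"
proof -
  have arc: "snd g b = b" if "b \<in> arcs Y" "fst g (tail Y b) = tail Y b" for b
    using lift_unique[of "snd g b" b] deck[OF g] that by simp
  have "{w \<in> verts Y. fst g w = w} = verts Y"
    by (rule connected_closed[of _ w]) (use w arc deck(4)[OF g] in auto, metis)
  then have v: "fst g w = w" if "w \<in> verts Y" for w using that by blast
  then have "snd g b = b" if "b \<in> arcs Y" for b using arc that by simp
  then show ?thesis
    using v deck_Bij[OF g]
    by (auto simp: deck_one prod_eq_iff Bij_def extensional_def fun_eq_iff)
qed

lemma deck_eqI:
  assumes "g \<in> carrier G" "h \<in> carrier G" "w \<in> verts Y" "fst g w = fst h w"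
  shows "g = h"
proof -
  have "inv\<^bsub>G\<^esub> h \<otimes>\<^bsub>G\<^esub> g = \<one>\<^bsub>G\<^esub>"
    using assms by (intro deck_free[of _ w]) (simp_all add: deck_mult deck_inv)
  then show ?thesis using assms(1,2) G.inv_comm G.inv_equality[of "inv\<^bsub>G\<^esub> h" g]
    by (metis G.inv_closed G.inv_inv)
qed

lemma finite_deck: "finite (carrier G)"
proof -
  obtain w where w: "w \<in> verts Y" using connected_Y by (auto simp: connected_conv)
  have "inj_on (\<lambda>g. fst g w) (carrier G)" by (rule inj_onI) (rule deck_eqI[OF _ _ w])
  moreover have "(\<lambda>g. fst g w) ` carrier G \<subseteq> verts Y" using w deck(1) by auto
  ultimately show ?thesis by (meson Y.finite_verts finite_imageD finite_subset)
qed

section \<open>Voltages and the Frobenius automorphism\<close>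

text \<open>One chosen point in each fibre. As the deck group acts simply transitively on fibres,
  every vertex of \<open>Y\<close> acquires unique coordinates: a group element and a vertex of
  \<open>X\<close>.\<close>

definition base :: "'v \<Rightarrow> 'w" where
  "base v = (SOME w. w \<in> verts Y \<and> fst \<pi> w = v)"

lemma base: "v \<in> verts X \<Longrightarrow> base v \<in> verts Y" "v \<in> verts X \<Longrightarrow> fst \<pi> (base v) = v"
  using surj_verts[of v] someI_ex[of "\<lambda>w. w \<in> verts Y \<and> fst \<pi> w = v"]
  unfolding base_def by blast+

lemma base_coords:
  assumes "w \<in> verts Y"
  obtains g where "g \<in> carrier G" "w = fst g (base (fst \<pi> w))"
  using transitive_verts[of "base (fst \<pi> w)" w] assms base proj(1) by metis

definition voltage :: "'a \<Rightarrow> ('w \<Rightarrow> 'w) \<times> ('b \<Rightarrow> 'b)" where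
  "voltage a = (SOME g. g \<in> carrier G \<and> (\<exists>b\<in>arcs Y. tail Y b = base (tail X a) \<and> snd \<pi> b = a
      \<and> head Y b = fst g (base (head X a))))"

lemma voltage_ex:
  assumes a: "a \<in> arcs X"
  shows "voltage a \<in> carrier G \<and> (\<exists>b\<in>arcs Y. tail Y b = base (tail X a) \<and> snd \<pi> b = a
      \<and> head Y b = fst (voltage a) (base (head X a)))"
  unfolding voltage_def
proof (rule someI_ex)
  obtain b where b: "b \<in> arcs Y" "tail Y b = base (tail X a)" "snd \<pi> b = a"
    using lift_exists[of "base (tail X a)" a] a base by auto
  have "fst \<pi> (head Y b) = head X a" using proj(4)[OF b(1)] b(3) by simp
  then obtain g where "g \<in> carrier G" "head Y b = fst g (base (head X a))"
    using base_coords[of "head Y b"] b(1) by auto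
  then show "\<exists>g. g \<in> carrier G \<and> (\<exists>b\<in>arcs Y. tail Y b = base (tail X a) \<and> snd \<pi> b = a
      \<and> head Y b = fst g (base (head X a)))" using b by blast
qed

lemma voltage_closed [simp]: "a \<in> arcs X \<Longrightarrow> voltage a \<in> carrier G"
  using voltage_ex by blast

text \<open>The lift of an arc at \<open>fst g (base x)\<close> is the \<open>g\<close>-translate of
  its lift at the base point, so traversing it multiplies the group coordinate by the
  voltage.\<close>

lemma head_lift:
  assumes b: "b \<in> arcs Y" and g: "g \<in> carrier G" and t: "tail Y b = fst g (base (tail X (snd \<pi> b)))"
  shows "head Y b = fst (g \<otimes>\<^bsub>G\<^esub> voltage (snd \<pi> b)) (base (head X (snd \<pi> b)))"
proof -
  let ?a = "snd \<pi> b"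
  have a: "?a \<in> arcs X" using proj b by blast
  obtain c where c: "c \<in> arcs Y" "tail Y c = base (tail X ?a)" "snd \<pi> c = ?a"
    "head Y c = fst (voltage ?a) (base (head X ?a))" using voltage_ex[OF a] by blast
  have "tail Y (snd g c) = tail Y b" using deck(3)[OF g c(1)] c(2) t by (simp only:)
  moreover have "snd \<pi> (snd g c) = snd \<pi> b" using deck(7)[OF g c(1)] c(3) by (simp only:)
  ultimately have "snd g c = b" using lift_unique[OF deck(2)[OF g c(1)] b] by blast
  then have "head Y b = fst g (head Y c)" using deck(4)[OF g c(1)] by simp
  also have "\<dots> = fst (g \<otimes>\<^bsub>G\<^esub> voltage ?a) (base (head X ?a))"
    unfolding c(4) using deck_mult(1)[OF g voltage_closed[OF a] base(1)] a by simp
  finally show ?thesis .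
qed

text \<open>Traversing a lift and then its reversal returns to the base point, so the product of the
  two voltages fixes a vertex and is trivial by freeness.\<close>

lemma voltage_rev:
  assumes a: "a \<in> arcs X"
  shows "voltage (r a) = inv\<^bsub>G\<^esub> (voltage a)"
proof -
  obtain c where c: "c \<in> arcs Y" "tail Y c = base (tail X a)" "snd \<pi> c = a"
    "head Y c = fst (voltage a) (base (head X a))" using voltage_ex[OF a] by blast
  have "head Y (s c) = fst (voltage a \<otimes>\<^bsub>G\<^esub> voltage (r a)) (base (tail X a))"
    using head_lift[of "s c" "voltage a"] c a by (simp add: proj)
  then have "voltage a \<otimes>\<^bsub>G\<^esub> voltage (r a) = \<one>\<^bsub>G\<^esub>"
    using c a base by (intro deck_free[of _ "base (tail X a)"]) auto
  then show ?thesis using a by (intro G.comm_inv_char[symmetric]) auto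
qed

definition path_voltage :: "'a list \<Rightarrow> ('w \<Rightarrow> 'w) \<times> ('b \<Rightarrow> 'b)" where
  "path_voltage p = foldr (\<lambda>a g. voltage a \<otimes>\<^bsub>G\<^esub> g) p \<one>\<^bsub>G\<^esub>"

lemma path_voltage_simps [simp]:
  "path_voltage [] = \<one>\<^bsub>G\<^esub>" "path_voltage (a # p) = voltage a \<otimes>\<^bsub>G\<^esub> path_voltage p"
  by (simp_all add: path_voltage_def)

lemma path_voltage_closed [simp]: "set p \<subseteq> arcs X \<Longrightarrow> path_voltage p \<in> carrier G"
  by (induction p) auto

lemma path_voltage_append:
  "set p \<subseteq> arcs X \<Longrightarrow> set q \<subseteq> arcs X \<Longrightarrow>
    path_voltage (p @ q) = path_voltage p \<otimes>\<^bsub>G\<^esub> path_voltage q"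
  by (induction p) (auto simp: G.m_assoc)

text \<open>Commutativity of the deck group makes the voltage a function of the cyclic word, hence
  of the prime.\<close>

lemma path_voltage_rotate:
  assumes "set p \<subseteq> arcs X"
  shows "path_voltage (rotate n p) = path_voltage p"
proof -
  have s: "set (drop k p) \<subseteq> arcs X" "set (take k p) \<subseteq> arcs X" for k
    using assms by (auto dest: in_set_dropD in_set_takeD)
  have "path_voltage (rotate n p) = path_voltage (take (n mod length p) p @ drop (n mod length p) p)"
    unfolding rotate_drop_take by (simp only: path_voltage_append s G.m_comm path_voltage_closed)
  then show ?thesis by simp
qed

lemma head_lift_path:
  assumes "Y.awalk w q w'" "g \<in> carrier G" "w = fst g (base (fst \<pi> w))"
  shows "w' = fst (g \<otimes>\<^bsub>G\<^esub> path_voltage (map (snd \<pi>) q)) (base (fst \<pi> w'))"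
  using assms
proof (induction q arbitrary: w g)
  case Nil
  then show ?case by (simp add: Y.awalk_Nil_iff)
next
  case (Cons b q)
  have b: "b \<in> arcs Y" "tail Y b = w" "Y.awalk (head Y b) q w'"
    using Cons.prems(1) by (auto simp: Y.awalk_Cons_iff)
  let ?g = "g \<otimes>\<^bsub>G\<^esub> voltage (snd \<pi> b)"
  have "head Y b = fst ?g (base (fst \<pi> (head Y b)))"
    using head_lift[OF b(1) Cons.prems(2)] Cons.prems(3) b by (simp add: proj)
  then have "w' = fst (?g \<otimes>\<^bsub>G\<^esub> path_voltage (map (snd \<pi>) q)) (base (fst \<pi> w'))"
    using Cons.IH[OF b(3)] Cons.prems b proj by simp
  moreover have "set (map (snd \<pi>) q) \<subseteq> arcs X"
    using Cons.prems(1) proj by (auto simp: Y.awalk_def)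
  ultimately show ?case using Cons.prems b proj by (simp add: G.m_assoc)
qed

lemma path_lift_exists:
  assumes "X.awalk v p v'" "w \<in> verts Y" "fst \<pi> w = v"
  obtains q w' where "Y.awalk w q w'" "map (snd \<pi>) q = p"
proof -
  have "\<exists>q w'. Y.awalk w q w' \<and> map (snd \<pi>) q = p"
    using assms
  proof (induction p arbitrary: v w)
    case Nil
    then show ?case by (intro exI[of _ "[]"] exI[of _ w]) (simp add: Y.awalk_Nil_iff)
  next
    case (Cons a p)
    have a: "a \<in> arcs X" "tail X a = v" "X.awalk (head X a) p v'"
      using Cons.prems(1) by (auto simp: X.awalk_Cons_iff)
    obtain b where b: "b \<in> arcs Y" "tail Y b = w" "snd \<pi> b = a"
      using lift_exists[OF Cons.prems(2) a(1)] a Cons.prems by auto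
    then have "\<exists>q w'. Y.awalk (head Y b) q w' \<and> map (snd \<pi>) q = p"
      using Cons.IH[OF a(3), of "head Y b"] proj(4)[OF b(1)] by auto
    then obtain q w' where "Y.awalk (head Y b) q w'" "map (snd \<pi>) q = p" by blast
    then show ?case
      using b by (intro exI[of _ "b # q"] exI[of _ w']) (simp add: Y.awalk_Cons_iff)
  qed
  then show ?thesis using that by blast
qed

end

section \<open>Degrees and oriented arcs\<close>

text \<open>Picks one arc from each orbit of the reversal, giving the ordering of arcs on which
  Bass's block matrices rest. The induction removes one orbit at a time.\<close>

lemma involution_orientation:
  assumes "finite A" "\<And>a. a \<in> A \<Longrightarrow> r a \<in> A \<and> r a \<noteq> a \<and> r (r a) = a"
  obtains es where "distinct (es @ map r es)" "set (es @ map r es) = A"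
proof -
  have "\<exists>es. distinct (es @ map r es) \<and> set (es @ map r es) = A"
    using assms
  proof (induction "card A" arbitrary: A rule: less_induct)
    case less
    show ?case
    proof (cases "A = {}")
      case False
      then obtain a where a: "a \<in> A" by blast
      let ?B = "A - {a, r a}"
      have inv: "r b \<in> ?B \<and> r b \<noteq> b \<and> r (r b) = b" if "b \<in> ?B" for b
        using that less.prems(2)[of b] less.prems(2)[OF a] by auto
      have "card ?B < card A" using a less.prems(1) by (intro psubset_card_mono) auto
      then obtain es where es: "distinct (es @ map r es)" "set (es @ map r es) = ?B"
        using less.hyps[of ?B] less.prems(1) inv by blast
      have "distinct ((a # es) @ map r (a # es))" "set ((a # es) @ map r (a # es)) = A"
        using es a less.prems(2)[OF a] by auto
      then show ?thesis by blast
    qed simp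
  qed
  then show ?thesis using that by blast
qed

locale fin_bidirected_digraph = fin_digraph G + bidirected_digraph G arev for G arev
begin

definition outdeg :: "'a \<Rightarrow> nat" where "outdeg v = card {a \<in> arcs G. tail G a = v}"

lemma edge_cases:
  assumes "E \<in> edges G arev"
  obtains a where "a \<in> arcs G" "E = {a, arev a}" "arev a \<noteq> a" "ends G E = {tail G a, head G a}"
proof -
  obtain a where a: "a \<in> arcs G" "E = {a, arev a}" using assms by (auto simp: edges_def)
  have "arev a \<noteq> a" "ends G E = {tail G a, head G a}"
    using a by (simp_all add: arev_neq ends_def)
  with a show ?thesis by (intro that[of a])
qed

lemma arev_inject: "arev a = arev b \<longleftrightarrow> a = b"
  by (metis arev_arev)

lemma card_arcs_by_edges:
  "card {a \<in> arcs G. P a} = (\<Sum>E\<in>edges G arev. card {a \<in> E. P a})"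
proof -
  have "{a \<in> arcs G. P a} = (\<Union>E\<in>edges G arev. {a \<in> E. P a})"
    unfolding edges_def by auto
  also have "card \<dots> = (\<Sum>E\<in>edges G arev. card {a \<in> E. P a})"
  proof (rule card_UN_disjoint)
    show "finite (edges G arev)" by (simp add: edges_def)
    show "\<forall>E\<in>edges G arev. finite {a \<in> E. P a}" by (auto simp: edges_def)
    show "\<forall>E\<in>edges G arev. \<forall>E'\<in>edges G arev. E \<noteq> E' \<longrightarrow> {a \<in> E. P a} \<inter> {a \<in> E'. P a} = {}"
      unfolding edges_def by (auto simp: doubleton_eq_iff arev_inject)
  qed
  finally show ?thesis .
qed

text \<open>Both orientations of a loop leave the same vertex, which is exactly the double counting
  of loops in the degree.\<close>

lemma vdegree_eq: "vdegree G arev v = outdeg v"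
proof -
  have "outdeg v = (\<Sum>E\<in>edges G arev. if v \<in> ends G E then if ends G E = {v} then 2 else 1 else 0)"
    unfolding outdeg_def card_arcs_by_edges
  proof (rule sum.cong)
    fix E assume "E \<in> edges G arev"
    then obtain a where a: "a \<in> arcs G" "E = {a, arev a}" "arev a \<noteq> a"
      "ends G E = {tail G a, head G a}" by (rule edge_cases)
    have "{x \<in> E. tail G x = v} = (if tail G a = v then {a} else {}) \<union> (if head G a = v then {arev a} else {})"
      using a by auto
    then show "card {x \<in> E. tail G x = v}
        = (if v \<in> ends G E then if ends G E = {v} then 2 else 1 else 0)"
      using a by auto
  qed simp
  then show ?thesis
    by (simp add: vdegree_def edges_def sum.inter_filter)
qed

lemma loops_at_eq: "2 * loops_at G arev v = card {a \<in> arcs G. tail G a = v \<and> head G a = v}"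
proof -
  have "card {a \<in> arcs G. tail G a = v \<and> head G a = v}
      = (\<Sum>E\<in>edges G arev. if ends G E = {v} then 2 else 0)"
    unfolding card_arcs_by_edges
  proof (rule sum.cong)
    fix E assume "E \<in> edges G arev"
    then obtain a where a: "a \<in> arcs G" "E = {a, arev a}" "arev a \<noteq> a"
      "ends G E = {tail G a, head G a}" by (rule edge_cases)
    have "{x \<in> E. tail G x = v \<and> head G x = v} = (if tail G a = v \<and> head G a = v then {a, arev a} else {})"
      using a by auto
    then show "card {x \<in> E. tail G x = v \<and> head G x = v} = (if ends G E = {v} then 2 else 0)"
      using a by auto
  qed simp
  then show ?thesis
    by (simp add: loops_at_def edges_def sum.inter_filter[symmetric])
qed

lemma edges_between_eq:
  assumes "v \<noteq> w"
  shows "edges_between G arev v w = card {a \<in> arcs G. tail G a = v \<and> head G a = w}"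
proof -
  have "card {a \<in> arcs G. tail G a = v \<and> head G a = w}
      = (\<Sum>E\<in>edges G arev. if ends G E = {v, w} then 1 else 0)"
    unfolding card_arcs_by_edges
  proof (rule sum.cong)
    fix E assume "E \<in> edges G arev"
    then obtain a where a: "a \<in> arcs G" "E = {a, arev a}" "arev a \<noteq> a"
      "ends G E = {tail G a, head G a}" by (rule edge_cases)
    have "card {x \<in> E. tail G x = v \<and> head G x = w}
        = card {x \<in> {a}. tail G x = v \<and> head G x = w} + card {x \<in> {arev a}. tail G x = v \<and> head G x = w}"
      unfolding a(2) using a(3) by (subst card_Un_disjoint[symmetric]) (auto intro: arg_cong[of _ _ card])
    also have "card {x \<in> {a}. tail G x = v \<and> head G x = w} = (if tail G a = v \<and> head G a = w then 1 else 0)"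
      by (simp cong: conj_cong)
    also have "card {x \<in> {arev a}. tail G x = v \<and> head G x = w} = (if tail G a = w \<and> head G a = v then 1 else 0)"
      using a(1) by (cases "tail G a = w"; cases "head G a = v"; simp cong: conj_cong)
    finally show "card {x \<in> E. tail G x = v \<and> head G x = w} = (if ends G E = {v, w} then 1 else 0)"
      unfolding a(4) doubleton_eq_iff using assms by simp
  qed simp
  then show ?thesis
    by (simp add: edges_between_def edges_def sum.inter_filter[symmetric])
qed

text \<open>Twice the number of loops is the number of arcs from \<open>v\<close> to itself, so the
  diagonal convention of \<open>rho\<close> is the usual degree matrix minus arc adjacency matrix,
  uniformly in \<open>w\<close> and \<open>v\<close>.\<close>

lemma rho_eq:
  "rho G arev w v = (if w = v then int (outdeg v) else 0)
    - int (card {a \<in> arcs G. tail G a = w \<and> head G a = v})"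
  using loops_at_eq[of v] by (auto simp: rho_def vdegree_eq edges_between_eq simp flip: of_nat_mult)

lemma sum_outdeg: "(\<Sum>v\<in>verts G. outdeg v) = card (arcs G)"
proof -
  have "card (arcs G) = card (\<Union>v\<in>verts G. {a \<in> arcs G. tail G a = v})"
    by (rule arg_cong[of _ _ card]) auto
  also have "\<dots> = (\<Sum>v\<in>verts G. outdeg v)"
    unfolding outdeg_def by (rule card_UN_disjoint) auto
  finally show ?thesis by simp
qed

end

section \<open>The L-function as a determinant\<close>

context abelian_covering
begin

sublocale X: fin_bidirected_digraph X r ..
sublocale Y: fin_bidirected_digraph Y s ..

definition follows :: "'a \<Rightarrow> 'a \<Rightarrow> bool" where
  "follows a b \<longleftrightarrow> head X a = tail X b \<and> b \<noteq> r a"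

lemma cas_nth:
  "X.cas u (a # p) v \<longleftrightarrow> tail X a = u \<and> (\<forall>i<length p. head X ((a # p) ! i) = tail X (p ! i))
    \<and> head X (last (a # p)) = v"
proof (induction p arbitrary: a u)
  case (Cons b p)
  show ?case by (subst X.cas.simps, subst Cons.IH) (auto simp: All_less_Suc2)
qed auto

lemma cyclic_nth_iff:
  assumes "p \<noteq> []"
  shows "(\<forall>i<length p. R (p ! i) (p ! (Suc i mod length p)))
    \<longleftrightarrow> (\<forall>i. Suc i < length p \<longrightarrow> R (p ! i) (p ! Suc i)) \<and> R (last p) (hd p)"
proof -
  obtain n where n: "length p = Suc n" using assms by (cases p) auto
  have "(\<forall>i<Suc n. R (p ! i) (p ! (Suc i mod Suc n)))
      \<longleftrightarrow> (\<forall>i<n. R (p ! i) (p ! (Suc i mod Suc n))) \<and> R (p ! n) (p ! (Suc n mod Suc n))"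
    by (auto simp: less_Suc_eq)
  then show ?thesis using assms by (simp add: n last_conv_nth hd_conv_nth)
qed

lemma closed_path_iff:
  "closed_path X p \<longleftrightarrow> p \<in> cyclic_words (arcs X) (\<lambda>a b. head X a = tail X b)"
proof (cases p)
  case (Cons a q)
  have "closed_path X p \<longleftrightarrow> set p \<subseteq> arcs X \<and> X.cas (tail X a) p (tail X a)"
    unfolding closed_path_def X.awalk_def using Cons by (auto simp: X.cas_simp)
  also have "X.cas (tail X a) p (tail X a) \<longleftrightarrow> (\<forall>i. Suc i < length p \<longrightarrow> head X (p ! i) = tail X (p ! Suc i))
      \<and> head X (last p) = tail X (hd p)"
    unfolding Cons cas_nth by simp
  finally show ?thesis
    using cyclic_nth_iff[of p "\<lambda>a b. head X a = tail X b"] Cons by (auto simp: cyclic_words_def)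
qed (simp add: closed_path_def cyclic_words_def)

text \<open>The tail condition is the backtrack condition at the seam of the cyclic word. A root of
  a closed path is itself closed, so the two notions of proper power agree.\<close>

lemma prime_path_iff:
  "prime_path X r p \<longleftrightarrow> p \<in> cyclic_words (arcs X) follows \<and> primitive p"
proof (cases "p = []")
  case False
  have "closed_path X p \<and> (\<forall>i. Suc i < length p \<longrightarrow> p ! Suc i \<noteq> r (p ! i)) \<and> hd p \<noteq> r (last p)
      \<longleftrightarrow> p \<in> cyclic_words (arcs X) follows"
    using False cyclic_nth_iff[OF False, of "\<lambda>a b. head X a = tail X b"] cyclic_nth_iff[OF False, of follows]
    by (auto simp: closed_path_iff cyclic_words_def follows_def)
  moreover have "(\<exists>c k. closed_path X c \<and> k \<ge> 2 \<and> p = concat (replicate k c)) \<longleftrightarrow> \<not> primitive p"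
    if "closed_path X p"
  proof -
    have "closed_path X c" if "k \<ge> 2" "p = concat (replicate k c)" for c k
      using \<open>closed_path X p\<close> that by (simp add: closed_path_iff cyclic_words_power)
    then show ?thesis unfolding primitive_def by blast
  qed
  ultimately show ?thesis unfolding prime_path_def by blast
qed (simp add: prime_path_def closed_path_def cyclic_words_def)

lemma primes_eq: "primes X r = necklaces (arcs X) follows"
  unfolding primes_def necklaces_def prime_path_iff rotations_def[symmetric] by blast

lemma prime_length_rotations: "prime_length (rotations p) = length p"
  unfolding prime_length_def
proof (rule the_equality)
  show "\<forall>q\<in>rotations p. length q = length p" by (auto simp: rotations_def)
qed (use self_in_rotations[of p] in \<open>metis\<close>)

lemma awalk_project: "Y.awalk w q w' \<Longrightarrow> X.awalk (fst \<pi> w) (map (snd \<pi>) q) (fst \<pi> w')"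
proof (induction q arbitrary: w)
  case (Cons b q)
  then have "b \<in> arcs Y" "tail Y b = w" "Y.awalk (head Y b) q w'" by (auto simp: Y.awalk_Cons_iff)
  then show ?case using Cons.IH[of "head Y b"] by (simp add: X.awalk_Cons_iff proj)
qed (simp add: X.awalk_Nil_iff Y.awalk_Nil_iff proj)

lemma closed_lift_end:
  assumes p: "closed_path X p" and q: "Y.awalk w q w'" "map (snd \<pi>) q = p"
  shows "fst \<pi> w' = fst \<pi> w" "tail X (hd p) = fst \<pi> w"
proof -
  obtain v a p' where v: "X.awalk v p v" "p = a # p'"
    using p unfolding closed_path_def by (cases p) auto
  have "X.awalk (fst \<pi> w) p (fst \<pi> w')" using awalk_project[OF q(1)] q(2) by simp
  then have "X.cas v (a # p') v" "X.cas (fst \<pi> w) (a # p') (fst \<pi> w')"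
    using v by (simp_all only: X.awalk_def)
  then show "fst \<pi> w' = fst \<pi> w" "tail X (hd p) = fst \<pi> w"
    unfolding cas_nth v(2) by simp_all
qed

text \<open>A lift starting at \<open>w = fst h (base v)\<close> ends at the base point moved by
  \<open>h\<close> times the path voltage. Commuting the two factors shows that the voltage carries
  \<open>w\<close> to the end, for every choice of rotation and of \<open>w\<close>; freeness makes
  it the only candidate.\<close>

lemma frobenius_rotations:
  assumes p: "prime_path X r p"
  shows "frobenius Y s X \<pi> (rotations p) = path_voltage p"
  unfolding frobenius_def
proof (rule the_equality)
  have cl: "closed_path X p" and pA: "set p \<subseteq> arcs X"
    using p by (auto simp: prime_path_def closed_path_iff cyclic_words_def)
  have key: "fst (path_voltage p') w = w'"
    if p': "p' \<in> rotations p" and q: "Y.awalk w q w'" "map (snd \<pi>) q = p'" for p' w q w'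
  proof -
    obtain n where n: "p' = rotate n p" using p' by (auto simp: rotations_def)
    have cl': "closed_path X p'"
      using cl by (simp add: n closed_path_iff cyclic_words_rotate)
    then have pA': "set p' \<subseteq> arcs X" by (simp add: closed_path_iff cyclic_words_def)
    have w: "w \<in> verts Y" using q(1) by (simp add: Y.awalk_def)
    obtain h where h: "h \<in> carrier G" "w = fst h (base (fst \<pi> w))" using base_coords[OF w] .
    have b: "base (fst \<pi> w) \<in> verts Y" using w proj base by blast
    have "w' = fst (h \<otimes>\<^bsub>G\<^esub> path_voltage p') (base (fst \<pi> w))"
      using head_lift_path[OF q(1) h] closed_lift_end[OF cl' q] q(2) by simp
    also have "h \<otimes>\<^bsub>G\<^esub> path_voltage p' = path_voltage p' \<otimes>\<^bsub>G\<^esub> h"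
      using h pA' by (simp add: G.m_comm)
    finally show ?thesis using h pA' b by (simp add: deck_mult)
  qed
  obtain v where v: "X.awalk v p v" using cl unfolding closed_path_def by blast
  then have "v \<in> verts X" by (simp add: X.awalk_def)
  then obtain q w' where q: "Y.awalk (base v) q w'" "map (snd \<pi>) q = p"
    using path_lift_exists[OF v, of "base v"] base by blast
  have "base v \<in> verts Y" using \<open>v \<in> verts X\<close> by (rule base)
  then show "path_voltage p \<in> carrier G \<and> (\<exists>p'\<in>rotations p. \<exists>w q w'. w \<in> verts Y \<and>
      fst \<pi> w = tail X (hd p') \<and> Y.awalk w q w' \<and> map (snd \<pi>) q = p' \<and> fst (path_voltage p) w = w')"
    using key[OF self_in_rotations q] closed_lift_end[OF cl q] q
    by (intro conjI bexI[of _ p] exI[of _ "base v"] exI[of _ q] exI[of _ w'] self_in_rotations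
        path_voltage_closed pA) auto
  fix g assume g: "g \<in> carrier G \<and> (\<exists>p'\<in>rotations p. \<exists>w q w'. w \<in> verts Y \<and>
      fst \<pi> w = tail X (hd p') \<and> Y.awalk w q w' \<and> map (snd \<pi>) q = p' \<and> fst g w = w')"
  then obtain p' w q w' where w: "p' \<in> rotations p" "w \<in> verts Y" "Y.awalk w q w'"
    "map (snd \<pi>) q = p'" "fst g w = w'" by blast
  obtain n where n: "p' = rotate n p" using w(1) by (auto simp: rotations_def)
  have "path_voltage p' = path_voltage p" unfolding n by (rule path_voltage_rotate[OF pA])
  moreover have "g = path_voltage p'"
    by (rule deck_eqI[of _ _ w]) (use g w key[OF w(1,3,4)] pA calculation in auto)
  ultimately show "g = path_voltage p" by simp
qed

lemma character_path_voltage: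
  assumes "\<psi> \<in> characters G" "set p \<subseteq> arcs X"
  shows "\<psi> (path_voltage p) = prod_list (map (\<lambda>a. \<psi> (voltage a)) p)"
  using assms(2)
  by (induction p) (simp_all add: G.character_one[OF assms(1)] G.character_mult[OF assms(1)])

lemma L_function_near_0:
  assumes \<psi>: "\<psi> \<in> characters G" and as: "distinct as" "set as = arcs X"
  shows "\<forall>\<^sub>F u in nhds 0. L_function Y s X r \<pi> \<psi> u
    = inverse (det (mat_on as as (\<lambda>a b. of_bool (a = b) - u * (\<psi> (voltage a) * of_bool (follows a b)))))"
proof -
  have M: "1\<^sub>m (length as) - u \<cdot>\<^sub>m mat_on as as (\<lambda>a b. \<psi> (voltage a) * of_bool (follows a b))
      = mat_on as as (\<lambda>a b. of_bool (a = b) - u * (\<psi> (voltage a) * of_bool (follows a b)))" for u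
    by (simp add: mat_on_one[OF as(1)] mat_on_smult mat_on_minus)
  have "\<forall>\<^sub>F u in nhds 0. ((\<lambda>F. \<Prod>P\<in>F. inverse (1 - \<psi> (frobenius Y s X \<pi> P) * u ^ prime_length P))
    \<longlongrightarrow> inverse (det (1\<^sub>m (length as) - u \<cdot>\<^sub>m mat_on as as (\<lambda>a b. \<psi> (voltage a) * of_bool (follows a b)))))
      (finite_subsets_at_top (necklaces (set as) follows))"
  proof (rule euler_product[OF as(1)])
    fix a assume "a \<in> set as"
    then show "norm (\<psi> (voltage a)) \<le> 1" using G.norm_character[OF finite_deck \<psi>] as by simp
  next
    fix p assume p: "p \<in> cyclic_words (set as) follows" "primitive p"
    then have "prime_path X r p" by (simp add: prime_path_iff as)
    then show "\<psi> (frobenius Y s X \<pi> (rotations p)) = prod_list (map (\<lambda>a. \<psi> (voltage a)) p)"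
      using p as by (simp add: frobenius_rotations character_path_voltage[OF \<psi>] cyclic_words_def)
    show "prime_length (rotations p) = length p" by (rule prime_length_rotations)
  qed
  then show ?thesis
    unfolding L_function_def M primes_eq as(2)
    by eventually_elim (intro tendsto_Lim finite_subsets_at_top_neq_bot)
qed

end

section \<open>Leading coefficients at \<open>1\<close>\<close>

text \<open>An open set in the plane is infinite. This supplies the uniqueness behind the definite
  description in \<open>L_reciprocal\<close>.\<close>

lemma poly_eq_of_eventually:
  fixes p q :: "complex poly"
  assumes "\<forall>\<^sub>F u in nhds 0. poly p u = poly q u"
  shows "p = q"
proof (rule ccontr)
  assume "p \<noteq> q"
  then have fin: "finite {u. poly (p - q) u = 0}" by (intro poly_roots_finite) simp
  obtain S where S: "open S" "0 \<in> S" "\<forall>u\<in>S. poly p u = poly q u"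
    using assms unfolding eventually_nhds by blast
  then have "S \<subseteq> {u. poly (p - q) u = 0}" by auto
  then have "finite S" using fin by (rule finite_subset)
  then show False using S finite_imp_not_open by blast
qed

lemma poly_det_mat_on:
  fixes f :: "'a \<Rightarrow> 'a \<Rightarrow> 'c::comm_ring_1 poly"
  shows "poly (det (mat_on xs xs f)) u = det (mat_on xs xs (\<lambda>x y. poly (f x y) u))"
proof -
  have "comm_ring_hom (\<lambda>p :: 'c poly. poly p u)" by unfold_locales auto
  then show ?thesis using comm_ring_hom.hom_det[of "\<lambda>p. poly p u" "mat_on xs xs f"] by (simp add: mat_on_map)
qed

text \<open>With \<open>u = 1 + x\<close> the factor \<open>1 - u\<^sup>2\<close> becomes
  \<open>x * (-2 - x)\<close>, the origin of the constant \<open>(-2) ^ k\<close>; as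
  \<open>D\<close> does not vanish at 1, the order of vanishing is exactly \<open>k\<close>.\<close>

lemma leading_coeff_at_1:
  fixes D :: "complex poly"
  assumes "poly D 1 \<noteq> 0"
  shows "(let q = pcompose ([:1, 0, -1:] ^ k * D) [:1, 1:] in coeff q (LEAST j. coeff q j \<noteq> 0))
    = (-2) ^ k * poly D 1"
proof -
  define R where "R = [:-2, -1:] ^ k * pcompose D [:1, 1:]"
  have pw: "pcompose (p ^ k) q = pcompose p q ^ k" for p q :: "complex poly"
    by (induction k) (simp_all add: pcompose_mult pcompose_1)
  have "pcompose [:1, 0, -1:] [:1, 1:] = ([:0, 1:] * [:-2, -1:] :: complex poly)"
    by (simp add: pcompose_pCons)
  then have q: "pcompose ([:1, 0, -1:] ^ k * D) [:1, 1:] = monom 1 k * R"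
    by (simp only: pcompose_mult pw power_mult_distrib R_def monom_altdef) (simp add: mult_ac)
  have R0: "coeff R 0 = (-2) ^ k * poly D 1"
    by (simp add: R_def poly_0_coeff_0[symmetric] poly_pcompose)
  have "(LEAST j. coeff (monom 1 k * R) j \<noteq> 0) = k"
  proof (rule Least_equality)
    show "coeff (monom 1 k * R) k \<noteq> 0" using assms by (simp add: coeff_monom_mult R0)
    fix j assume "coeff (monom 1 k * R) j \<noteq> 0"
    then show "k \<le> j" by (simp add: coeff_monom_mult split: if_splits)
  qed
  then show ?thesis by (simp add: q coeff_monom_mult R0)
qed

section \<open>The twisted Laplacian and its determinant\<close>

context abelian_covering
begin

text \<open>The coefficient ring is left generic: complex characters and formal variables are both
  substituted for the voltages, which makes the former specialisations of the latter.\<close>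

definition twisted_laplacian :: "(('w \<Rightarrow> 'w) \<times> ('b \<Rightarrow> 'b) \<Rightarrow> 'c::comm_ring_1) \<Rightarrow> 'v \<Rightarrow> 'v \<Rightarrow> 'c" where
  "twisted_laplacian \<psi> x y = of_bool (x = y) * of_nat (X.outdeg x)
    - (\<Sum>a\<in>{a \<in> arcs X. tail X a = x \<and> head X a = y}. \<psi> (voltage a))"

lemma out_arcs_bij:
  assumes "w \<in> verts Y"
  shows "bij_betw (snd \<pi>) {b \<in> arcs Y. tail Y b = w} {a \<in> arcs X. tail X a = fst \<pi> w}"
proof (rule bij_betwI')
  fix a assume "a \<in> {a \<in> arcs X. tail X a = fst \<pi> w}"
  then show "\<exists>b\<in>{b \<in> arcs Y. tail Y b = w}. a = snd \<pi> b"
    using lift_exists[OF assms, of a] by blast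
qed (use lift_unique proj in auto)

lemma outdeg_cover: "w \<in> verts Y \<Longrightarrow> Y.outdeg w = X.outdeg (fst \<pi> w)"
  unfolding X.outdeg_def Y.outdeg_def by (rule bij_betw_same_card[OF out_arcs_bij])

text \<open>Maximum principle: at a vertex where the maximum is attained all differences to
  neighbours are nonnegative and sum to zero, so the set of maximum points is closed along
  arcs.\<close>

lemma harmonic_constant:
  fixes H :: "'w \<Rightarrow> real"
  assumes harm: "\<And>w. w \<in> verts Y \<Longrightarrow> (\<Sum>b\<in>{b \<in> arcs Y. tail Y b = w}. H w - H (head Y b)) = 0"
    and w: "w \<in> verts Y" "w' \<in> verts Y"
  shows "H w = H w'"
proof -
  define m where "m = Max (H ` verts Y)"
  have le: "H w \<le> m" if "w \<in> verts Y" for w using that by (simp add: m_def)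
  have "m \<in> H ` verts Y" unfolding m_def using w by (intro Max_in) auto
  then obtain u where u: "u \<in> verts Y" "H u = m" by auto
  have "{w \<in> verts Y. H w = m} = verts Y"
  proof (rule connected_closed[of _ u])
    fix b assume b: "b \<in> arcs Y" "tail Y b \<in> {w \<in> verts Y. H w = m}"
    let ?A = "{b' \<in> arcs Y. tail Y b' = tail Y b}"
    have "(\<Sum>b'\<in>?A. H (tail Y b) - H (head Y b')) = 0" using harm[of "tail Y b"] b by simp
    then have "\<forall>b'\<in>?A. H (tail Y b) - H (head Y b') = 0"
      using b le sum_nonneg_eq_0_iff[of ?A "\<lambda>b'. H (tail Y b) - H (head Y b')"] by auto
    then show "head Y b \<in> {w \<in> verts Y. H w = m}" using b by auto
  qed (use u in auto)
  then have "H w = m" "H w' = m" using w by blast+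
  then show ?thesis by simp
qed

text \<open>A kernel vector \<open>f\<close> on \<open>X\<close> spreads to the function
  \<open>F\<close> on \<open>Y\<close> with value \<open>\<psi> g * f v\<close> at
  \<open>fst g (base v)\<close>; the twist turns the kernel equation into harmonicity. Hence
  \<open>F\<close> is constant, and comparing its values on a fibre where \<open>f\<close> is
  nonzero gives \<open>\<psi> g = 1\<close>.\<close>

lemma det_twisted_laplacian_nonzero:
  assumes \<psi>: "\<psi> \<in> characters G" "\<psi> \<noteq> trivial_char G" and vs: "distinct vs" "set vs = verts X"
  shows "det (mat_on vs vs (twisted_laplacian \<psi>)) \<noteq> 0"
proof
  let ?n = "length vs" and ?M = "mat_on vs vs (twisted_laplacian \<psi>)"
  assume "det ?M = 0"
  then obtain x where x: "x \<in> carrier_vec ?n" "x \<noteq> 0\<^sub>v ?n" "?M *\<^sub>v x = 0\<^sub>v ?n"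
    using det_0_iff_vec_prod_zero_field[of ?M ?n] by auto
  define f where "f = (\<lambda>v. vec_index x (THE i. i < ?n \<and> vs ! i = v))"
  have f_nth: "f (vs ! i) = vec_index x i" if "i < ?n" for i
  proof -
    have "(THE j. j < ?n \<and> vs ! j = vs ! i) = i"
      using that vs(1) by (intro the_equality) (auto simp: nth_eq_iff_index_eq)
    then show ?thesis by (simp add: f_def)
  qed
  have "\<exists>i<?n. vec_index x i \<noteq> 0"
  proof (rule ccontr)
    assume "\<not> ?thesis"
    then have "x = 0\<^sub>v ?n" using x(1) by (intro eq_vecI) auto
    then show False using x(2) by simp
  qed
  then obtain v0 where v0: "v0 \<in> verts X" "f v0 \<noteq> 0"
    using f_nth vs(2) nth_mem by metis
  have eq: "of_nat (X.outdeg v) * f v = (\<Sum>a\<in>{a \<in> arcs X. tail X a = v}. \<psi> (voltage a) * f (head X a))"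
    if v: "v \<in> verts X" for v
  proof -
    obtain i where i: "i < ?n" "v = vs ! i" using v vs(2) by (metis in_set_conv_nth)
    have "0 = vec_index (?M *\<^sub>v x) i" using x(3) i by simp
    also have "\<dots> = (\<Sum>j<?n. twisted_laplacian \<psi> v (vs ! j) * f (vs ! j))"
      using i x(1) by (auto simp: scalar_prod_def atLeast0LessThan f_nth intro!: sum.cong)
    also have "\<dots> = (\<Sum>y\<in>verts X. twisted_laplacian \<psi> v y * f y)"
      using sum_nth_distinct[OF vs(1), of "\<lambda>y. twisted_laplacian \<psi> v y * f y"] vs(2) by simp
    also have "\<dots> = (\<Sum>y\<in>verts X. of_bool (v = y) * (of_nat (X.outdeg v) * f y))
        - (\<Sum>y\<in>verts X. \<Sum>a\<in>{a \<in> arcs X. tail X a = v \<and> head X a = y}. \<psi> (voltage a) * f y)"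
      by (simp add: twisted_laplacian_def left_diff_distrib sum_subtractf sum_distrib_right mult.assoc)
    also have "(\<Sum>y\<in>verts X. of_bool (v = y) * (of_nat (X.outdeg v) * f y)) = of_nat (X.outdeg v) * f v"
      using v by (subst sum_of_bool_eq) simp_all
    also have "(\<Sum>y\<in>verts X. \<Sum>a\<in>{a \<in> arcs X. tail X a = v \<and> head X a = y}. \<psi> (voltage a) * f y)
        = (\<Sum>y\<in>verts X. \<Sum>a\<in>{a \<in> {a \<in> arcs X. tail X a = v}. head X a = y}. \<psi> (voltage a) * f (head X a))"
      by (intro sum.cong) auto
    also have "\<dots> = (\<Sum>a\<in>{a \<in> arcs X. tail X a = v}. \<psi> (voltage a) * f (head X a))"
      by (rule sum.group) auto
    finally show ?thesis by simp
  qed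
  define gc where "gc = (\<lambda>w. SOME g. g \<in> carrier G \<and> w = fst g (base (fst \<pi> w)))"
  have gc: "gc w \<in> carrier G" "w = fst (gc w) (base (fst \<pi> w))" if "w \<in> verts Y" for w
    using base_coords[OF that] someI_ex[of "\<lambda>g. g \<in> carrier G \<and> w = fst g (base (fst \<pi> w))"]
    unfolding gc_def by metis+
  define F where "F = (\<lambda>w. \<psi> (gc w) * f (fst \<pi> w))"
  have F: "F (fst g (base v)) = \<psi> g * f v" if "g \<in> carrier G" "v \<in> verts X" for g v
  proof -
    have w: "fst g (base v) \<in> verts Y" "fst \<pi> (fst g (base v)) = v"
      using deck[OF that(1)] base that(2) by auto
    have "gc (fst g (base v)) = g"
      by (rule deck_eqI[OF gc(1)[OF w(1)] that(1) base(1)[OF that(2)]])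
        (use gc(2)[OF w(1)] w(2) in simp)
    then show ?thesis using w by (simp add: F_def)
  qed
  have harm: "(\<Sum>b\<in>{b \<in> arcs Y. tail Y b = w}. F w - F (head Y b)) = 0" if w: "w \<in> verts Y" for w
  proof -
    let ?B = "{b \<in> arcs Y. tail Y b = w}" and ?A = "{a \<in> arcs X. tail X a = fst \<pi> w}"
    have "F (head Y b) = \<psi> (gc w) * (\<psi> (voltage (snd \<pi> b)) * f (head X (snd \<pi> b)))" if "b \<in> ?B" for b
    proof -
      have b: "b \<in> arcs Y" "tail X (snd \<pi> b) = fst \<pi> w" "snd \<pi> b \<in> arcs X" using that proj by auto
      have "head Y b = fst (gc w \<otimes>\<^bsub>G\<^esub> voltage (snd \<pi> b)) (base (head X (snd \<pi> b)))"
        using that gc[OF w] b(2) by (intro head_lift) auto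
      then have "F (head Y b) = \<psi> (gc w \<otimes>\<^bsub>G\<^esub> voltage (snd \<pi> b)) * f (head X (snd \<pi> b))"
        using F gc(1)[OF w] b(3) by simp
      then show ?thesis
        using G.character_mult[OF \<psi>(1) gc(1)[OF w] voltage_closed[OF b(3)]] by simp
    qed
    then have "(\<Sum>b\<in>?B. F (head Y b))
        = (\<Sum>b\<in>?B. \<psi> (gc w) * (\<psi> (voltage (snd \<pi> b)) * f (head X (snd \<pi> b))))"
      by (rule sum.cong[OF refl])
    also have "\<dots> = (\<Sum>a\<in>?A. \<psi> (gc w) * (\<psi> (voltage a) * f (head X a)))"
      by (rule sum.reindex_bij_betw[OF out_arcs_bij[OF w],
            of "\<lambda>a. \<psi> (gc w) * (\<psi> (voltage a) * f (head X a))"])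
    also have "\<dots> = of_nat (X.outdeg (fst \<pi> w)) * F w"
      using eq[OF proj(1)[OF w]] by (simp add: sum_distrib_left[symmetric] F_def mult_ac)
    also have "X.outdeg (fst \<pi> w) = card ?B" using outdeg_cover[OF w] by (simp add: Y.outdeg_def)
    finally show ?thesis by (simp add: sum_subtractf)
  qed
  \<comment> \<open>The maximum principle needs real values; the real and imaginary parts of a
    harmonic function are harmonic.\<close>
  have "F w = F w'" if "w \<in> verts Y" "w' \<in> verts Y" for w w'
  proof (rule complex_eqI)
    show "Re (F w) = Re (F w')"
      using arg_cong[OF harm, of _ Re] that
      by (intro harmonic_constant[of "\<lambda>w. Re (F w)"]) (simp_all add: Re_sum)
    show "Im (F w) = Im (F w')"
      using arg_cong[OF harm, of _ Im] that
      by (intro harmonic_constant[of "\<lambda>w. Im (F w)"]) (simp_all add: Im_sum)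
  qed
  then have "F (fst g (base v0)) = F (fst \<one>\<^bsub>G\<^esub> (base v0))" if "g \<in> carrier G" for g
    using deck(1)[OF that base(1)[OF v0(1)]] deck(1)[OF G.one_closed base(1)[OF v0(1)]] by blast
  then have "\<psi> g * f v0 = \<psi> \<one>\<^bsub>G\<^esub> * f v0" if "g \<in> carrier G" for g
    unfolding F[OF that v0(1), symmetric] F[OF G.one_closed v0(1), symmetric] by (simp only: that)
  then have "\<psi> g = 1" if "g \<in> carrier G" for g
    using that v0 G.character_one[OF \<psi>(1)] by simp
  then have "\<psi> = trivial_char G"
    using \<psi>(1) by (auto simp: trivial_char_def characters_iff extensional_def fun_eq_iff)
  then show False using \<psi>(2) by simp
qed

text \<open>By Bass's formula \<open>L(u, \<psi>)\<inverse> = (1 - u\<^sup>2)\<^sup>k D(u)\<close> with \<open>D(1)\<close> the determinant of the twisted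
  Laplacian and \<open>k\<close> the number of edges minus the number of vertices.\<close>

lemma L_star_1_eq:
  assumes \<psi>: "\<psi> \<in> characters G" "\<psi> \<noteq> trivial_char G" and vs: "distinct vs" "set vs = verts X"
    and deg: "\<And>v. v \<in> verts X \<Longrightarrow> X.outdeg v \<ge> 2"
  shows "L_star_1 Y s X r \<pi> \<psi>
    = (-2) ^ (card (arcs X) div 2 - card (verts X)) * det (mat_on vs vs (twisted_laplacian \<psi>))"
proof -
  obtain es where es: "distinct (es @ map r es)" "set (es @ map r es) = arcs X"
    by (rule involution_orientation[of "arcs X" r]) (auto simp: X.arev_neq)
  define as where "as = es @ map r es"
  have as: "distinct as" "set as = arcs X" using es by (simp_all add: as_def)
  have "card (arcs X) = length as" using as distinct_card by metis
  then have m: "length es = card (arcs X) div 2" by (simp add: as_def)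
  have n: "length vs = card (verts X)" using vs distinct_card by metis
  \<comment> \<open>Degrees at least 2 give at least as many edges as vertices, so the natural
    subtraction defining \<open>k\<close> does not truncate.\<close>
  have "2 * card (verts X) = (\<Sum>v\<in>verts X. 2)" by simp
  also have "\<dots> \<le> card (arcs X)" unfolding X.sum_outdeg[symmetric] by (rule sum_mono) (rule deg)
  finally have le: "length vs \<le> length es" unfolding m n by simp
  define k where "k = length es - length vs"
  define A where "A = (\<lambda>x y. \<Sum>a\<in>{a \<in> arcs X. tail X a = x \<and> head X a = y}. \<psi> (voltage a))"
  define D where "D = det (mat_on vs vs (\<lambda>x y. [:of_bool (x = y), - A x y,
      of_bool (x = y) * (of_nat (X.outdeg x) - 1):]))"
  have pD: "poly D u = det (mat_on vs vs (\<lambda>x y. of_bool (x = y) *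
      (1 - u\<^sup>2 + u\<^sup>2 * of_nat (X.outdeg x)) - u * A x y))" for u
    unfolding D_def poly_det_mat_on
    by (intro arg_cong[of _ _ det] mat_on_cong) (simp add: algebra_simps power2_eq_square)
  have D1: "poly D 1 = det (mat_on vs vs (twisted_laplacian \<psi>))"
    unfolding pD by (intro arg_cong[of _ _ det] mat_on_cong) (simp add: A_def twisted_laplacian_def)
  let ?W = "\<lambda>u. mat_on as as (\<lambda>a b. of_bool (a = b) - u * (\<psi> (voltage a) * of_bool (follows a b)))"
  \<comment> \<open>Off \<open>u\<^sup>2 = 1\<close> the common power of
    \<open>1 - u\<^sup>2\<close> in Bass's formula can be cancelled. A neighbourhood of
    \<open>0\<close> avoids these points, and the values there already determine the
    polynomial.\<close>
  have W: "det (?W u) = poly ([:1, 0, -1:] ^ k * D) u" if u: "u\<^sup>2 \<noteq> 1" for u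
  proof -
    have "(1 - u\<^sup>2) ^ length vs * det (mat_on (es @ map r es) (es @ map r es)
        (\<lambda>a b. of_bool (a = b) - u * (\<psi> (voltage a) * of_bool (head X a = tail X b \<and> b \<noteq> r a))))
      = (1 - u\<^sup>2) ^ length es * det (mat_on vs vs (\<lambda>x y. of_bool (x = y) *
          (1 - u\<^sup>2 + u\<^sup>2 * of_nat (card {a \<in> set (es @ map r es). tail X a = x}))
          - u * (\<Sum>a\<in>{a \<in> set (es @ map r es). tail X a = x \<and> head X a = y}. \<psi> (voltage a))))"
    proof (rule bass_formula[OF es(1) vs(1)])
      fix a assume "a \<in> set (es @ map r es)"
      then have a: "a \<in> arcs X" unfolding es(2) .
      then show "r (r a) = a" "head X (r a) = tail X a" "tail X (r a) = head X a" "tail X a \<in> set vs"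
        using vs(2) by simp_all
      show "\<psi> (voltage a) * \<psi> (voltage (r a)) = 1"
        using a G.character_inv[OF \<psi>(1) voltage_closed[OF a]] by (simp add: voltage_rev)
    qed (rule u)
    then have "(1 - u\<^sup>2) ^ length vs * det (?W u) = (1 - u\<^sup>2) ^ length es * poly D u"
      unfolding pD es(2) X.outdeg_def[symmetric] A_def as_def follows_def .
    also have "(1 - u\<^sup>2) ^ length es = (1 - u\<^sup>2) ^ length vs * (1 - u\<^sup>2) ^ k"
      using le by (simp add: k_def power_add[symmetric])
    finally have "det (?W u) = (1 - u\<^sup>2) ^ k * poly D u" using u by simp
    then show ?thesis by (simp add: power2_eq_square)
  qed
  have "\<forall>\<^sub>F u::complex in nhds 0. u\<^sup>2 \<noteq> 1"
  proof -
    have "((\<lambda>u::complex. u\<^sup>2) \<longlongrightarrow> 0\<^sup>2) (nhds 0)" by (intro tendsto_power filterlim_ident)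
    then show ?thesis by (rule tendsto_imp_eventually_ne) simp
  qed
  with L_function_near_0[OF \<psi>(1) as]
  have near: "\<forall>\<^sub>F u in nhds 0. inverse (L_function Y s X r \<pi> \<psi> u) = poly ([:1, 0, -1:] ^ k * D) u"
  proof eventually_elim
    case (elim u)
    show ?case unfolding elim(1) inverse_inverse_eq by (rule W[OF elim(2)])
  qed
  have "L_reciprocal Y s X r \<pi> \<psi> = [:1, 0, -1:] ^ k * D"
    unfolding L_reciprocal_def
  proof (rule the_equality)
    show "\<forall>\<^sub>F u in nhds 0. inverse (L_function Y s X r \<pi> \<psi> u) = poly ([:1, 0, -1:] ^ k * D) u"
      by (rule near)
    fix p assume "\<forall>\<^sub>F u in nhds 0. inverse (L_function Y s X r \<pi> \<psi> u) = poly p u"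
    with near have "\<forall>\<^sub>F u in nhds 0. poly p u = poly ([:1, 0, -1:] ^ k * D) u"
      by eventually_elim simp
    then show "p = [:1, 0, -1:] ^ k * D" by (rule poly_eq_of_eventually)
  qed
  then have "L_star_1 Y s X r \<pi> \<psi> = (-2) ^ k * poly D 1"
    unfolding L_star_1_def
    using leading_coeff_at_1[of D k] det_twisted_laplacian_nonzero[OF \<psi> vs] by (simp add: D1)
  then show ?thesis by (simp add: D1 k_def m n)
qed

end

section \<open>A commutative ring mapping onto the group ring\<close>

text \<open>Determinants need a commutative ring as a type. In place of the integral group ring we use the
  polynomial ring with one variable for each value of the type of group elements; its monomials are
  multisets.\<close>

definition monomial_value :: "('g, 'm) monoid_scheme \<Rightarrow> 'g multiset \<Rightarrow> 'g" where
  "monomial_value G m = finprod G (\<lambda>x. x [^]\<^bsub>G\<^esub> count m x) (carrier G)"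

text \<open>For a character, variables outside the carrier take the value 1, since
  \<open>monomial_value\<close> ignores their exponents.\<close>

definition eval_at :: "('g \<Rightarrow> complex) \<Rightarrow> ('g, 'm) monoid_scheme \<Rightarrow> ('g multiset \<Rightarrow>\<^sub>0 int) \<Rightarrow> complex" where
  "eval_at \<psi> G f = (\<Sum>m\<in>Poly_Mapping.keys f. of_int (Poly_Mapping.lookup f m) * \<psi> (monomial_value G m))"

definition to_group_ring :: "('g, 'm) monoid_scheme \<Rightarrow> ('g multiset \<Rightarrow>\<^sub>0 int) \<Rightarrow> ('g \<Rightarrow>\<^sub>0 int)" where
  "to_group_ring G = frag_extend (\<lambda>m. frag_of (monomial_value G m))"

lemma frag_of_mult: "frag_of m * frag_of n = (frag_of (m + n) :: 'a::comm_monoid_add \<Rightarrow>\<^sub>0 int)"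
  by (simp add: mult_single)

lemma frag_of_zero: "(frag_of 0 :: 'a::comm_monoid_add \<Rightarrow>\<^sub>0 int) = 1"
  by (simp add: single_one)

context comm_group
begin

lemma monomial_value_closed [simp]: "monomial_value G m \<in> carrier G"
  by (simp add: monomial_value_def)

lemma monomial_value_add: "monomial_value G (m + n) = monomial_value G m \<otimes> monomial_value G n"
proof -
  have "monomial_value G (m + n) = (\<Otimes>x\<in>carrier G. x [^] count m x \<otimes> x [^] count n x)"
    unfolding monomial_value_def by (rule finprod_cong') (auto simp: nat_pow_mult)
  also have "\<dots> = monomial_value G m \<otimes> monomial_value G n"
    unfolding monomial_value_def by (rule finprod_multf) auto
  finally show ?thesis .
qed

lemma monomial_value_zero: "monomial_value G {#} = \<one>"
  by (simp add: monomial_value_def)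

lemma monomial_value_single:
  assumes "finite (carrier G)" "x \<in> carrier G"
  shows "monomial_value G {#x#} = x"
proof -
  have "monomial_value G {#x#} = (\<Otimes>y\<in>carrier G. if y = x then y else \<one>)"
    unfolding monomial_value_def by (rule finprod_cong') auto
  also have "\<dots> = x" by (rule finprod_singleton_swap) (use assms in auto)
  finally show ?thesis .
qed

lemma eval_at_superset:
  assumes "finite S" "Poly_Mapping.keys f \<subseteq> S"
  shows "eval_at \<psi> G f = (\<Sum>m\<in>S. of_int (Poly_Mapping.lookup f m) * \<psi> (monomial_value G m))"
  unfolding eval_at_def by (rule sum.mono_neutral_left) (use assms in \<open>auto simp: in_keys_iff\<close>)

text \<open>On monomials this is multiplicativity of \<open>\<psi>\<close> and of
  \<open>monomial_value\<close>; additivity extends it to one factor and then to the other.\<close>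

lemma eval_at_hom:
  assumes \<psi>: "\<psi> \<in> characters G"
  shows "Ring_Hom.comm_ring_hom (eval_at \<psi> G)"
proof -
  let ?e = "eval_at \<psi> G"
  have frag: "?e (frag_of m) = \<psi> (monomial_value G m)" for m by (simp add: eval_at_def)
  have add: "?e (f + g) = ?e f + ?e g" for f g
  proof -
    let ?S = "Poly_Mapping.keys f \<union> Poly_Mapping.keys g"
    have "Poly_Mapping.keys (f + g) \<subseteq> ?S" by (rule Poly_Mapping.keys_add)
    then show ?thesis
      by (simp add: eval_at_superset[of ?S] lookup_add sum.distrib distrib_right)
  qed
  have zero: "?e 0 = 0" by (simp add: eval_at_def)
  have diff: "?e (f - g) = ?e f - ?e g" for f g
    using add[of "f - g" g] by simp
  have one: "?e 1 = 1"
    using frag[of 0] character_one[OF \<psi>] by (simp only: frag_of_zero monomial_value_zero)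
  have mult1: "?e (frag_of m * g) = \<psi> (monomial_value G m) * ?e g" for m g
    using subset_UNIV[of "Poly_Mapping.keys g"]
  proof (induction g rule: frag_induction)
    case (one n)
    have "?e (frag_of m * frag_of n) = \<psi> (monomial_value G (m + n))"
      by (simp only: frag_of_mult frag)
    then show ?case
      using character_mult[OF \<psi>, of "monomial_value G m" "monomial_value G n"]
      by (simp add: monomial_value_add frag)
  qed (simp_all add: zero diff right_diff_distrib)
  have "?e (f * g) = ?e f * ?e g" for f g
    using subset_UNIV[of "Poly_Mapping.keys f"]
    by (induction f rule: frag_induction) (simp_all add: zero diff left_diff_distrib mult1 frag)
  then show ?thesis using add one zero by unfold_locales auto
qed

lemma keys_to_group_ring: "Poly_Mapping.keys (to_group_ring G f) \<subseteq> carrier G"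
  unfolding to_group_ring_def using keys_frag_extend[of "\<lambda>m. frag_of (monomial_value G m)" f] by force

text \<open>Evaluation at a character factors through the integral group ring, so the character
  values of a polynomial determinant come from the integer coefficients of its image there.\<close>

lemma eval_at_to_group_ring:
  assumes fin: "finite (carrier G)" and \<psi>: "\<psi> \<in> characters G"
  shows "(\<Sum>g\<in>carrier G. of_int (Poly_Mapping.lookup (to_group_ring G f) g) * \<psi> g) = eval_at \<psi> G f"
proof -
  interpret e: Ring_Hom.comm_ring_hom "eval_at \<psi> G" by (rule eval_at_hom[OF \<psi>])
  have diff: "eval_at \<psi> G (a - b) = eval_at \<psi> G a - eval_at \<psi> G b" for a b
    using e.hom_add[of "a - b" b] by simp
  show ?thesis
    using subset_UNIV[of "Poly_Mapping.keys f"]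
  proof (induction f rule: frag_induction)
    case (one m)
    have "(\<Sum>g\<in>carrier G. of_int (Poly_Mapping.lookup (to_group_ring G (frag_of m)) g) * \<psi> g)
        = (\<Sum>g\<in>carrier G. if g = monomial_value G m then \<psi> g else 0)"
      by (intro sum.cong) (auto simp: to_group_ring_def lookup_single)
    then show ?case using fin by (simp add: eval_at_def)
  qed (simp_all add: to_group_ring_def frag_extend_diff lookup_minus left_diff_distrib sum_subtractf diff)
qed

section \<open>Fourier analysis on the group ring\<close>

text \<open>Exchanging the sums leaves a sum of characters over \<open>inv h \<otimes> g\<close>,
  which vanishes unless \<open>h = g\<close>. The factor \<open>order G\<close> is what cancels the
  denominator of the idempotents.\<close>

lemma fourier_inversion:
  fixes \<alpha> :: "'a \<Rightarrow> complex"
  assumes fin: "finite (carrier G)" and g: "g \<in> carrier G"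
  shows "(\<Sum>\<psi>\<in>characters G. (\<Sum>h\<in>carrier G. \<alpha> h * \<psi> (inv h)) * \<psi> g) = of_nat (order G) * \<alpha> g"
proof -
  have "(\<Sum>\<psi>\<in>characters G. (\<Sum>h\<in>carrier G. \<alpha> h * \<psi> (inv h)) * \<psi> g)
      = (\<Sum>h\<in>carrier G. \<alpha> h * (\<Sum>\<psi>\<in>characters G. \<psi> (inv h \<otimes> g)))"
    unfolding sum_distrib_right sum_distrib_left
    using g by (subst sum.swap) (auto simp: character_mult mult.assoc intro!: sum.cong)
  also have "\<dots> = (\<Sum>h\<in>carrier G. if h = g then \<alpha> g * of_nat (order G) else 0)"
  proof (rule sum.cong)
    fix h assume h: "h \<in> carrier G"
    have "inv h \<otimes> g = \<one> \<longleftrightarrow> h = g"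
      using h g by (metis inv_closed inv_equality inv_inv l_inv)
    then show "\<alpha> h * (\<Sum>\<psi>\<in>characters G. \<psi> (inv h \<otimes> g)) = (if h = g then \<alpha> g * of_nat (order G) else 0)"
      using sum_characters[OF fin, of "inv h \<otimes> g"] h g by simp
  qed simp
  finally show ?thesis using fin g by (simp add: mult.commute)
qed

text \<open>Two inversions cancel: the idempotent places the value at \<open>\<sigma>\<close> on
  \<open>inv \<sigma>\<close>, and conjugating a character value is inverting its argument.\<close>

lemma idem_conj_char:
  assumes fin: "finite (carrier G)" and \<psi>: "\<psi> \<in> characters G" and g: "g \<in> carrier G"
  shows "idem G (conj_char G \<psi>) g = \<psi> g / of_nat (order G)"
proof -
  have "(\<Sum>\<sigma>\<in>carrier G. conj_char G \<psi> \<sigma> * gr_of (inv \<sigma>) g)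
      = (\<Sum>\<sigma>\<in>carrier G. if \<sigma> = inv g then \<psi> g else 0)"
  proof (rule sum.cong)
    fix \<sigma> assume \<sigma>: "\<sigma> \<in> carrier G"
    have "g = inv \<sigma> \<longleftrightarrow> \<sigma> = inv g" using \<sigma> g by (metis inv_inv)
    then show "conj_char G \<psi> \<sigma> * gr_of (inv \<sigma>) g = (if \<sigma> = inv g then \<psi> g else 0)"
      using \<sigma> g by (simp add: conj_char_def gr_of_def cnj_character[OF fin \<psi>])
  qed simp
  then show ?thesis using fin g by (simp add: idem_def)
qed

text \<open>Multiplication by the trivial idempotent replaces every coefficient by the mean, to
  which only the trivial character contributes. Subtracting it removes that component whatever
  \<open>L\<close> is there, so the leading coefficient at the trivial character never has to be
  computed.\<close>

lemma gr_mult_augmentation: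
  fixes L :: "('a \<Rightarrow> complex) \<Rightarrow> complex"
  assumes fin: "finite (carrier G)"
    and \<theta>: "\<And>g. \<theta> g = (\<Sum>\<psi>\<in>characters G. L \<psi> * idem G (conj_char G \<psi>) g)"
  shows "gr_mult G \<theta> (gr_minus (gr_of \<one>) (idem G (trivial_char G))) g
    = (if g \<in> carrier G then (\<Sum>\<psi>\<in>characters G - {trivial_char G}. L \<psi> * \<psi> g) / of_nat (order G) else 0)"
proof (cases "g \<in> carrier G")
  case False
  then have "{(\<sigma>, \<tau>) \<in> carrier G \<times> carrier G. \<sigma> \<otimes> \<tau> = g} = {}" by auto
  then show ?thesis using False by (simp only: gr_mult_def) simp
next
  case g: True
  let ?N = "of_nat (order G) :: complex"
  have N: "?N \<noteq> 0" using fin by (simp add: order_def) auto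
  have \<theta>': "\<theta> h = (\<Sum>\<psi>\<in>characters G. L \<psi> * \<psi> h) / ?N" if "h \<in> carrier G" for h
    using that by (simp add: \<theta> idem_conj_char[OF fin] sum_divide_distrib)
  have "conj_char G (trivial_char G) = trivial_char G"
    by (auto simp: conj_char_def trivial_char_def)
  then have triv: "idem G (trivial_char G) h = 1 / ?N" if "h \<in> carrier G" for h
    using idem_conj_char[OF fin trivial_char_character that] that by (simp add: trivial_char_def)
  have S: "{(\<sigma>, \<tau>) \<in> carrier G \<times> carrier G. \<sigma> \<otimes> \<tau> = g} = (\<lambda>\<sigma>. (\<sigma>, inv \<sigma> \<otimes> g)) ` carrier G"
    using g by (auto simp: image_iff m_assoc[symmetric])
  have "gr_mult G \<theta> (gr_minus (gr_of \<one>) (idem G (trivial_char G))) g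
      = (\<Sum>\<sigma>\<in>carrier G. \<theta> \<sigma> * gr_minus (gr_of \<one>) (idem G (trivial_char G)) (inv \<sigma> \<otimes> g))"
    unfolding gr_mult_def S by (subst sum.reindex) (auto intro!: inj_onI)
  also have "\<dots> = (\<Sum>\<sigma>\<in>carrier G. (if \<sigma> = g then \<theta> g else 0) - \<theta> \<sigma> / ?N)"
  proof (rule sum.cong)
    fix \<sigma> assume \<sigma>: "\<sigma> \<in> carrier G"
    have "inv \<sigma> \<otimes> g = \<one> \<longleftrightarrow> \<sigma> = g"
      using \<sigma> g by (metis inv_closed inv_equality inv_inv l_inv)
    then show "\<theta> \<sigma> * gr_minus (gr_of \<one>) (idem G (trivial_char G)) (inv \<sigma> \<otimes> g)
        = (if \<sigma> = g then \<theta> g else 0) - \<theta> \<sigma> / ?N"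
      using \<sigma> g by (simp add: gr_minus_def gr_of_def triv right_diff_distrib)
  qed simp
  also have "\<dots> = \<theta> g - (\<Sum>\<sigma>\<in>carrier G. \<theta> \<sigma>) / ?N"
    using fin g by (simp add: sum_subtractf sum_divide_distrib)
  also have "(\<Sum>\<sigma>\<in>carrier G. \<theta> \<sigma>) = (\<Sum>\<psi>\<in>characters G. L \<psi> * (\<Sum>\<sigma>\<in>carrier G. \<psi> \<sigma>)) / ?N"
    by (simp add: \<theta>' sum_divide_distrib[symmetric] sum_distrib_left sum.swap[of _ "carrier G"])
  also have "\<dots> = (\<Sum>\<psi>\<in>characters G. if \<psi> = trivial_char G then L (trivial_char G) * ?N else 0) / ?N"
    by (intro arg_cong2[where f = "(/)"] sum.cong) (auto simp: sum_character)
  also have "\<dots> = L (trivial_char G)"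
    using finite_characters[OF fin] trivial_char_character N by simp
  also have "\<theta> g = (\<Sum>\<psi>\<in>characters G - {trivial_char G}. L \<psi> * \<psi> g) / ?N + L (trivial_char G) / ?N"
    unfolding \<theta>'[OF g]
    by (subst sum.remove[OF finite_characters[OF fin] trivial_char_character])
      (use g in \<open>simp add: trivial_char_def add_divide_distrib\<close>)
  finally show ?thesis using g by simp
qed

end

section \<open>The determinant annihilates the Jacobian\<close>

lemma frag_extend_frag_extend:
  "frag_extend h (frag_extend l D) = frag_extend (\<lambda>w. frag_extend h (l w)) D"
  using subset_UNIV[of "Poly_Mapping.keys D"]
  by (induction D rule: frag_induction) (simp_all add: frag_extend_diff)

lemma frag_extend_diff_fun: "frag_extend (\<lambda>w. h w - l w) D = frag_extend h D - frag_extend l D"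
  using subset_UNIV[of "Poly_Mapping.keys D"]
  by (induction D rule: frag_induction) (simp_all add: frag_extend_diff)

lemma sum_frag_of_card:
  fixes t :: "'a \<Rightarrow> 'b"
  assumes "finite A" "finite B" "t ` A \<subseteq> B"
  shows "(\<Sum>a\<in>A. frag_of (t a)) = (\<Sum>u\<in>B. frag_cmul (int (card {a \<in> A. t a = u})) (frag_of u))"
proof -
  have "(\<Sum>a\<in>A. frag_of (t a)) = (\<Sum>u\<in>B. \<Sum>a\<in>{a \<in> A. t a = u}. frag_of (t a))"
    using assms by (intro sum.group[symmetric]) auto
  also have "\<dots> = (\<Sum>u\<in>B. frag_cmul (int (card {a \<in> A. t a = u})) (frag_of u))"
  proof (rule sum.cong)
    fix u :: 'b
    have "(\<Sum>a\<in>S. frag_of u) = frag_cmul (int (card S)) (frag_of u)" if "finite S" for S :: "'a set"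
      using that by induction (simp_all add: frag_cmul_distrib)
    then show "(\<Sum>a\<in>{a \<in> A. t a = u}. frag_of (t a))
        = frag_cmul (int (card {a \<in> A. t a = u})) (frag_of u)" using assms by simp
  qed simp
  finally show ?thesis .
qed

context abelian_covering
begin

definition translate :: "('w \<Rightarrow> 'w) \<times> ('b \<Rightarrow> 'b) \<Rightarrow> ('w \<Rightarrow>\<^sub>0 int) \<Rightarrow> ('w \<Rightarrow>\<^sub>0 int)" where
  "translate g D = frag_extend (\<lambda>w. frag_of (fst g w)) D"

definition act :: "((('w \<Rightarrow> 'w) \<times> ('b \<Rightarrow> 'b)) multiset \<Rightarrow>\<^sub>0 int) \<Rightarrow> ('w \<Rightarrow>\<^sub>0 int) \<Rightarrow> ('w \<Rightarrow>\<^sub>0 int)" where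
  "act f D = frag_extend (\<lambda>m. translate (monomial_value G m) D) f"

abbreviation "divisors \<equiv> {D :: 'w \<Rightarrow>\<^sub>0 int. Poly_Mapping.keys D \<subseteq> verts Y}"

lemma translate_simps [simp]:
  "translate g 0 = 0" "translate g (frag_of w) = frag_of (fst g w)"
  "translate g (D - E) = translate g D - translate g E"
  by (simp_all add: translate_def frag_extend_diff)

lemma translate_sum: "finite I \<Longrightarrow> translate g (sum D I) = (\<Sum>i\<in>I. translate g (D i))"
  by (simp add: translate_def frag_extend_sum o_def)

lemma act_simps [simp]:
  "act 0 D = 0" "act (frag_of m) D = translate (monomial_value G m) D"
  "act (f - g) D = act f D - act g D" "act f 0 = 0"
  by (simp_all add: act_def frag_extend_diff) (simp add: frag_extend_eq_0)

lemma act_diff: "act f (D - E) = act f D - act f E"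
  unfolding act_def by (simp add: frag_extend_diff_fun)

lemma act_sum: "finite I \<Longrightarrow> act (sum f I) D = (\<Sum>i\<in>I. act (f i) D)"
  by (simp add: act_def frag_extend_sum o_def)

lemma act_add: "act f (D + E) = act f D + act f E"
  using act_diff[of f "D + E" E] by simp

lemma act_sum_right: "act f (sum D I) = (\<Sum>i\<in>I. act f (D i))"
  by (induction I rule: infinite_finite_induct) (simp_all add: act_add)

lemma act_of_nat: "act (of_nat n) D = frag_cmul (int n) D" if D: "D \<in> divisors"
proof -
  have "act 1 D = D"
  proof -
    have "act 1 D = translate \<one>\<^bsub>G\<^esub> D"
      by (simp only: frag_of_zero[symmetric] act_simps(2) G.monomial_value_zero)
    also have "\<dots> = frag_extend frag_of D"
      unfolding translate_def using D by (intro frag_extend_eq) (auto simp: deck_one)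
    finally show ?thesis by (simp add: frag_expansion[symmetric])
  qed
  moreover have "act (f + h) D = act f D + act h D" for f h
    by (simp add: act_def frag_extend_add)
  ultimately show ?thesis
    by (induction n) (simp_all add: frag_cmul_distrib add.commute)
qed

text \<open>The product in the deck group composes extensional maps, which agrees with plain
  composition on the vertices of \<open>Y\<close>; hence the restriction on the support of
  \<open>D\<close>.\<close>

lemma translate_mult:
  assumes "g \<in> carrier G" "h \<in> carrier G" "D \<in> divisors"
  shows "translate (g \<otimes>\<^bsub>G\<^esub> h) D = translate g (translate h D)"
  unfolding translate_def frag_extend_frag_extend
  using assms by (intro frag_extend_eq) (auto simp: deck_mult)

lemma translate_divisors: "g \<in> carrier G \<Longrightarrow> D \<in> divisors \<Longrightarrow> translate g D \<in> divisors"
  unfolding translate_def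
  using keys_frag_extend[of "\<lambda>w. frag_of (fst g w)" D] deck(1) by fastforce

lemma act_mult:
  assumes D: "D \<in> divisors"
  shows "act (f * h) D = act f (act h D)"
proof -
  have frag: "act (frag_of m * h) D = translate (monomial_value G m) (act h D)" for m h
    using subset_UNIV[of "Poly_Mapping.keys h"]
  proof (induction h rule: frag_induction)
    case (one n)
    show ?case
      using translate_mult[OF G.monomial_value_closed G.monomial_value_closed D]
      by (simp only: frag_of_mult act_simps G.monomial_value_add)
  qed (simp_all add: right_diff_distrib)
  show ?thesis
    using subset_UNIV[of "Poly_Mapping.keys f"]
    by (induction f rule: frag_induction) (simp_all add: frag left_diff_distrib)
qed

text \<open>Links the polynomial action, in which determinants are computed, to the group ring
  action that defines the annihilator.\<close>

lemma act_eq_div_action: "act f D = div_action G (Poly_Mapping.lookup (to_group_ring G f)) D"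
  using subset_UNIV[of "Poly_Mapping.keys f"]
proof (induction f rule: frag_induction)
  case (one m)
  have "div_action G (Poly_Mapping.lookup (to_group_ring G (frag_of m))) D
      = (\<Sum>g\<in>carrier G. if g = monomial_value G m then translate g D else 0)"
    unfolding div_action_def translate_def[symmetric]
    by (intro sum.cong) (auto simp: to_group_ring_def lookup_single)
  then show ?case using finite_deck by simp
next
  case (diff f h)
  then show ?case
    by (simp add: div_action_def to_group_ring_def frag_extend_diff lookup_minus frag_cmul_diff_distrib
        sum_subtractf)
qed (simp add: div_action_def to_group_ring_def)

section \<open>Equivariance of the Laplacian and stability of Pr(Y)\<close>

lemma laplacian_frag_of:
  assumes w: "w \<in> verts Y"
  shows "laplacian Y s (frag_of w) = frag_cmul (int (Y.outdeg w)) (frag_of w)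
    - (\<Sum>b\<in>{b \<in> arcs Y. tail Y b = w}. frag_of (head Y b))"
proof -
  have "laplacian Y s (frag_of w) = (\<Sum>u\<in>verts Y. frag_cmul (rho Y s u w) (frag_of u))"
    by (simp add: laplacian_def)
  also have "\<dots> = (\<Sum>u\<in>verts Y. if u = w then frag_cmul (int (Y.outdeg w)) (frag_of w) else 0)
      - (\<Sum>u\<in>verts Y. frag_cmul (int (card {b \<in> arcs Y. tail Y b = u \<and> head Y b = w})) (frag_of u))"
    unfolding sum_subtractf[symmetric]
    by (intro sum.cong) (auto simp: Y.rho_eq frag_cmul_diff_distrib)
  also have "(\<Sum>u\<in>verts Y. if u = w then frag_cmul (int (Y.outdeg w)) (frag_of w) else 0)
      = frag_cmul (int (Y.outdeg w)) (frag_of w)" using w by simp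
  also have "(\<Sum>u\<in>verts Y. frag_cmul (int (card {b \<in> arcs Y. tail Y b = u \<and> head Y b = w})) (frag_of u))
      = (\<Sum>u\<in>verts Y. frag_cmul (int (card {b \<in> {b \<in> arcs Y. tail Y b = w}. head Y b = u})) (frag_of u))"
  \<comment> \<open>Column \<open>w\<close> of \<open>rho\<close> counts arcs ending at
    \<open>w\<close>; reversal by \<open>s\<close> turns them into arcs leaving \<open>w\<close>,
    for which lifting gives bijections.\<close>
  proof (intro sum.cong arg_cong2[where f = frag_cmul] arg_cong[where f = int] refl)
    fix u
    show "card {b \<in> arcs Y. tail Y b = u \<and> head Y b = w} = card {b \<in> {b \<in> arcs Y. tail Y b = w}. head Y b = u}"
      by (rule bij_betw_same_card[of s]) (rule bij_betw_byWitness[where f' = s], auto)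
  qed
  also have "\<dots> = (\<Sum>b\<in>{b \<in> arcs Y. tail Y b = w}. frag_of (head Y b))"
    by (rule sum_frag_of_card[symmetric]) auto
  finally show ?thesis .
qed

lemma deck_out_arcs:
  assumes g: "g \<in> carrier G" and w: "w \<in> verts Y"
  shows "bij_betw (snd g) {b \<in> arcs Y. tail Y b = w} {b \<in> arcs Y. tail Y b = fst g w}"
proof (rule bij_betwI')
  fix b b' assume "b \<in> {b \<in> arcs Y. tail Y b = w}" "b' \<in> {b \<in> arcs Y. tail Y b = w}"
  moreover have "inj_on (snd g) (arcs Y)" using deck_Bij[OF g] by (simp add: Bij_def bij_betw_def)
  ultimately show "snd g b = snd g b' \<longleftrightarrow> b = b'" by (simp add: inj_on_eq_iff)
next
  fix c assume c: "c \<in> {b \<in> arcs Y. tail Y b = fst g w}"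
  then have "snd \<pi> c \<in> arcs X" "tail X (snd \<pi> c) = fst \<pi> w"
    by (simp_all add: proj deck(6)[OF g w])
  then obtain b where b: "b \<in> arcs Y" "tail Y b = w" "snd \<pi> b = snd \<pi> c"
    using lift_exists[OF w] by blast
  then have "snd g b = c"
    using c deck(2,3,7)[OF g b(1)] by (intro lift_unique) simp_all
  then show "\<exists>b\<in>{b \<in> arcs Y. tail Y b = w}. c = snd g b" using b by blast
qed (use deck[OF g] in auto)

lemma laplacian_translate:
  assumes g: "g \<in> carrier G" and D: "D \<in> divisors"
  shows "laplacian Y s (translate g D) = translate g (laplacian Y s D)"
proof -
  have lap: "laplacian Y s (D - E) = laplacian Y s D - laplacian Y s E" for D E
    by (simp add: laplacian_def frag_extend_diff)
  have one: "laplacian Y s (frag_of (fst g w)) = translate g (laplacian Y s (frag_of w))"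
    if w: "w \<in> verts Y" for w
  proof -
    have "translate g (laplacian Y s (frag_of w)) = frag_cmul (int (Y.outdeg w)) (frag_of (fst g w))
        - (\<Sum>b\<in>{b \<in> arcs Y. tail Y b = w}. frag_of (fst g (head Y b)))"
      unfolding laplacian_frag_of[OF w]
      by (simp add: translate_sum) (simp add: translate_def frag_extend_cmul)
    also have "(\<Sum>b\<in>{b \<in> arcs Y. tail Y b = w}. frag_of (fst g (head Y b)))
        = (\<Sum>b\<in>{b \<in> arcs Y. tail Y b = w}. frag_of (head Y (snd g b)))"
      by (intro sum.cong) (auto simp: deck[OF g])
    also have "\<dots> = (\<Sum>b\<in>{b \<in> arcs Y. tail Y b = fst g w}. frag_of (head Y b))"
      by (rule sum.reindex_bij_betw[OF deck_out_arcs[OF g w]])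
    finally show ?thesis
      using w deck[OF g] by (simp add: laplacian_frag_of outdeg_cover)
  qed
  have "Poly_Mapping.keys D \<subseteq> verts Y" using D by simp
  then show ?thesis
    by (induction D rule: frag_induction) (simp_all add: one lap, simp add: laplacian_def)
qed

lemma Pr_iff: "E \<in> Pr Y s \<longleftrightarrow> (\<exists>D\<in>divisors. E = laplacian Y s D)"
  by (simp add: Pr_def image_iff free_Abelian_group_def)

lemma laplacian_Pr: "D \<in> divisors \<Longrightarrow> laplacian Y s D \<in> Pr Y s"
  unfolding Pr_iff by blast

lemma Pr_diff: "D \<in> Pr Y s \<Longrightarrow> E \<in> Pr Y s \<Longrightarrow> D - E \<in> Pr Y s"
proof -
  assume "D \<in> Pr Y s" "E \<in> Pr Y s"
  then obtain D' E' where DE: "D' \<in> divisors" "E' \<in> divisors" "D = laplacian Y s D'" "E = laplacian Y s E'"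
    unfolding Pr_iff by blast
  have "D' - E' \<in> divisors" using DE(1,2) keys_diff[of D' E'] by blast
  moreover have "D - E = laplacian Y s (D' - E')" by (simp add: DE(3,4) laplacian_def frag_extend_diff)
  ultimately show ?thesis unfolding Pr_iff by blast
qed

lemma Pr_zero: "0 \<in> Pr Y s"
  unfolding Pr_iff laplacian_def by (rule bexI[of _ 0]) auto

lemma Pr_add: "D \<in> Pr Y s \<Longrightarrow> E \<in> Pr Y s \<Longrightarrow> D + E \<in> Pr Y s"
  using Pr_diff[of D "0 - E"] Pr_diff[OF Pr_zero, of E] by simp

lemma Pr_sum: "(\<And>i. i \<in> I \<Longrightarrow> D i \<in> Pr Y s) \<Longrightarrow> sum D I \<in> Pr Y s"
  by (induction I rule: infinite_finite_induct) (auto simp: Pr_zero Pr_add)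

lemma Pr_divisors: "Pr Y s \<subseteq> divisors"
proof -
  have "Poly_Mapping.keys (\<Sum>u\<in>verts Y. frag_cmul (rho Y s u w) (frag_of u)) \<subseteq> verts Y" for w
    using keys_sum[of "\<lambda>u. frag_cmul (rho Y s u w) (frag_of u)" "verts Y"] by (auto split: if_splits)
  then show ?thesis unfolding Pr_def laplacian_def
    using keys_frag_extend[of "\<lambda>w. \<Sum>u\<in>verts Y. frag_cmul (rho Y s u w) (frag_of u)"] by fastforce
qed

lemma Pr_translate: "g \<in> carrier G \<Longrightarrow> D \<in> Pr Y s \<Longrightarrow> translate g D \<in> Pr Y s"
proof -
  assume g: "g \<in> carrier G" and "D \<in> Pr Y s"
  then obtain E where E: "E \<in> divisors" "D = laplacian Y s E" unfolding Pr_iff by blast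
  then have "translate g D = laplacian Y s (translate g E)" by (simp only: laplacian_translate[OF g])
  then show ?thesis unfolding Pr_iff using translate_divisors[OF g E(1)] by blast
qed

text \<open>The Laplacian commutes with deck transformations, so its image is stable under all
  monomials and hence under the whole polynomial ring.\<close>

lemma Pr_act: "D \<in> Pr Y s \<Longrightarrow> act f D \<in> Pr Y s"
proof -
  assume D: "D \<in> Pr Y s"
  show ?thesis
    using subset_UNIV[of "Poly_Mapping.keys f"]
    by (induction f rule: frag_induction) (simp_all add: Pr_zero Pr_diff Pr_translate D)
qed

abbreviation "variable g \<equiv> frag_of {#g#} :: (('w \<Rightarrow> 'w) \<times> ('b \<Rightarrow> 'b)) multiset \<Rightarrow>\<^sub>0 int"

text \<open>The Laplacian expressed in the basis of base points over \<open>\<int>[G]\<close>.\<close>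

lemma laplacian_base:
  assumes x: "x \<in> verts X"
  shows "laplacian Y s (frag_of (base x)) = (\<Sum>y\<in>verts X. act (twisted_laplacian variable x y) (frag_of (base y)))"
proof -
  let ?A = "{a \<in> arcs X. tail X a = x}"
  let ?e = "\<lambda>a. frag_of (fst (voltage a) (base (head X a)))"
  have bx: "base x \<in> verts Y" "fst \<pi> (base x) = x" using x base by auto
  have "(\<Sum>b\<in>{b \<in> arcs Y. tail Y b = base x}. frag_of (head Y b))
      = (\<Sum>b\<in>{b \<in> arcs Y. tail Y b = base x}. ?e (snd \<pi> b))"
  proof (rule sum.cong)
    fix b assume b: "b \<in> {b \<in> arcs Y. tail Y b = base x}"
    then have bY: "b \<in> arcs Y" and tx: "tail X (snd \<pi> b) = x" using bx(2) by (auto simp: proj(3))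
    have "head Y b = fst (\<one>\<^bsub>G\<^esub> \<otimes>\<^bsub>G\<^esub> voltage (snd \<pi> b)) (base (head X (snd \<pi> b)))"
      using b bx(1) by (intro head_lift[OF bY G.one_closed]) (simp add: tx, simp add: deck_one)
    then show "frag_of (head Y b) = ?e (snd \<pi> b)"
      by (simp only: G.l_one[OF voltage_closed[OF proj(2)[OF bY]]])
  qed simp
  also have "\<dots> = (\<Sum>a\<in>?A. ?e a)"
    using sum.reindex_bij_betw[OF out_arcs_bij[OF bx(1)], of ?e] bx(2) by simp
  finally have L: "laplacian Y s (frag_of (base x))
      = frag_cmul (int (X.outdeg x)) (frag_of (base x)) - (\<Sum>a\<in>?A. ?e a)"
    using laplacian_frag_of[OF bx(1)] bx by (simp add: outdeg_cover)
  have entry: "act (twisted_laplacian variable x y) (frag_of (base y))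
      = (if y = x then frag_cmul (int (X.outdeg x)) (frag_of (base x)) else 0)
        - (\<Sum>a\<in>{a \<in> ?A. head X a = y}. ?e a)" if y: "y \<in> verts X" for y
  proof -
    have "act (of_bool (x = y) * of_nat (X.outdeg x)) (frag_of (base y))
        = (if y = x then frag_cmul (int (X.outdeg x)) (frag_of (base x)) else 0)"
      using base(1)[OF y] act_of_nat[of "frag_of (base y)"] by auto
    moreover have "act (\<Sum>a\<in>{a \<in> arcs X. tail X a = x \<and> head X a = y}. variable (voltage a)) (frag_of (base y))
        = (\<Sum>a\<in>{a \<in> ?A. head X a = y}. ?e a)"
      by (auto simp: act_sum G.monomial_value_single finite_deck intro!: sum.cong)
    ultimately show ?thesis by (simp only: twisted_laplacian_def act_simps)
  qed
  have "(\<Sum>y\<in>verts X. act (twisted_laplacian variable x y) (frag_of (base y)))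
      = (\<Sum>y\<in>verts X. if y = x then frag_cmul (int (X.outdeg x)) (frag_of (base x)) else 0)
        - (\<Sum>y\<in>verts X. \<Sum>a\<in>{a \<in> ?A. head X a = y}. ?e a)"
    by (simp add: entry sum_subtractf)
  also have "(\<Sum>y\<in>verts X. \<Sum>a\<in>{a \<in> ?A. head X a = y}. ?e a) = (\<Sum>a\<in>?A. ?e a)"
    by (rule sum.group) auto
  finally show ?thesis using L x by simp
qed

text \<open>Multiplying the Laplacian matrix by its adjugate shows that the determinant maps every base
  point into \<open>Pr(Y)\<close>.\<close>

lemma det_act_Pr:
  assumes vs: "distinct vs" "set vs = verts X" and D: "D \<in> divisors"
  shows "act (det (mat_on vs vs (twisted_laplacian variable))) D \<in> Pr Y s"
proof -
  let ?n = "length vs" and ?M = "mat_on vs vs (twisted_laplacian variable)"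
  let ?d = "det ?M" and ?B = "adj_mat ?M" and ?b = "\<lambda>j. frag_of (base (vs ! j))"
  have vX: "vs ! j \<in> verts X" if "j < ?n" for j using that vs nth_mem by blast
  have b: "?b j \<in> divisors" if "j < ?n" for j using base(1)[OF vX[OF that]] by simp
  have B: "?B \<in> carrier_mat ?n ?n" "?B * ?M = ?d \<cdot>\<^sub>m 1\<^sub>m ?n" using adj_mat[of ?M ?n] by auto
  have base_Pr: "act ?d (?b i) \<in> Pr Y s" if i: "i < ?n" for i
  proof -
    have "(\<Sum>j<?n. act (?B $$ (i, j)) (laplacian Y s (?b j)))
        = (\<Sum>j<?n. \<Sum>k<?n. act (?B $$ (i, j) * ?M $$ (j, k)) (?b k))"
    proof (rule sum.cong)
      fix j assume j: "j \<in> {..<?n}"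
      have "laplacian Y s (?b j) = (\<Sum>k<?n. act (?M $$ (j, k)) (?b k))"
        using laplacian_base[OF vX] j vs sum_nth_distinct[OF vs(1),
            of "\<lambda>y. act (twisted_laplacian variable (vs ! j) y) (frag_of (base y))"] by simp
      then show "act (?B $$ (i, j)) (laplacian Y s (?b j))
          = (\<Sum>k<?n. act (?B $$ (i, j) * ?M $$ (j, k)) (?b k))"
        using act_mult[OF b] by (simp add: act_sum_right)
    qed simp
    also have "\<dots> = (\<Sum>k<?n. act ((?B * ?M) $$ (i, k)) (?b k))"
      using i B(1) by (subst sum.swap) (auto simp: act_sum[symmetric] scalar_prod_def atLeast0LessThan intro!: sum.cong)
    also have "\<dots> = (\<Sum>k<?n. if k = i then act ?d (?b i) else 0)"
      unfolding B(2) using i by (intro sum.cong) auto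
    also have "\<dots> = act ?d (?b i)" using i by simp
    finally have "act ?d (?b i) = (\<Sum>j<?n. act (?B $$ (i, j)) (laplacian Y s (?b j)))" by simp
    also have "\<dots> \<in> Pr Y s"
      by (intro Pr_sum Pr_act laplacian_Pr b) simp
    finally show ?thesis .
  qed
  have "Poly_Mapping.keys D \<subseteq> verts Y" using D by simp
  then show ?thesis
  proof (induction D rule: frag_induction)
    case (one w)
    obtain g where g: "g \<in> carrier G" "w = fst g (base (fst \<pi> w))" using base_coords[OF one] .
    obtain i where i: "i < ?n" "vs ! i = fst \<pi> w"
      using proj(1)[OF one] vs(2) by (metis in_set_conv_nth)
    \<comment> \<open>Every vertex is a translate of a base point, and translation is the action of
      a variable, which commutes with the determinant in the polynomial ring.\<close>
    have "act ?d (frag_of w) = act ?d (act (variable g) (?b i))"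
      using g by (simp add: i G.monomial_value_single[OF finite_deck])
    also have "\<dots> = act (variable g) (act ?d (?b i))"
      using act_mult[OF b[OF i(1)]] by (metis mult.commute)
    also have "\<dots> \<in> Pr Y s" by (intro Pr_act base_Pr i)
    finally show ?case .
  qed (simp_all add: act_diff Pr_diff Pr_zero)
qed

text \<open>Every member of a class is sent into \<open>Pr Y s\<close>, so each coset in the union
  defining \<open>Jac_action\<close> is \<open>Pr Y s\<close> itself, and the union is over a
  nonempty class.\<close>

lemma in_Ann_Jac:
  assumes \<alpha>: "\<alpha> \<in> gr_carrier G" and Pr: "\<And>D. D \<in> divisors \<Longrightarrow> div_action G \<alpha> D \<in> Pr Y s"
  shows "\<alpha> \<in> Ann_Jac Y s G"
proof -
  have plus: "x \<otimes>\<^bsub>Div0 Y\<^esub> y = x + y" for x y by (simp add: Div0_def free_Abelian_group_def)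
  have coset: "Pr Y s #>\<^bsub>Div0 Y\<^esub> D = (\<lambda>E. E + D) ` Pr Y s" for D
    by (auto simp: r_coset_def plus)
  have absorb: "(\<lambda>E. E + D) ` Pr Y s = Pr Y s" if "D \<in> Pr Y s" for D
  proof (intro subset_antisym subsetI)
    fix E assume "E \<in> Pr Y s"
    then have "E = (E - D) + D" "E - D \<in> Pr Y s" using that Pr_diff by auto
    then show "E \<in> (\<lambda>E. E + D) ` Pr Y s" by blast
  qed (use that Pr_add in auto)
  have "Jac_action Y s G \<alpha> C = Pr Y s" if C: "C \<in> carrier (Jac Y s)" for C
  proof -
    obtain D where D: "D \<in> carrier (Div0 Y)" "C = (\<lambda>E. E + D) ` Pr Y s"
      using C unfolding Jac_def FactGroup_def RCOSETS_def by (auto simp: coset)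
    have "D \<in> divisors" using D(1) by (simp add: Div0_def)
    then have "E + D \<in> divisors" if "E \<in> Pr Y s" for E
      using that Pr_divisors Poly_Mapping.keys_add[of E D] by blast
    then have "Pr Y s #>\<^bsub>Div0 Y\<^esub> div_action G \<alpha> D' = Pr Y s" if "D' \<in> C" for D'
      unfolding coset using that D(2) by (intro absorb Pr) auto
    moreover have "C \<noteq> {}" using D(2) Pr_zero by blast
    ultimately show ?thesis by (simp add: Jac_action_def)
  qed
  moreover have "\<one>\<^bsub>Jac Y s\<^esub> = Pr Y s" by (simp add: Jac_def FactGroup_def)
  ultimately show ?thesis using \<alpha> by (simp add: Ann_Jac_def)
qed

end

section \<open>The annihilation theorem\<close>

context abelian_covering
begin

text \<open>Without twist each row sums to zero, so the all-ones vector lies in the kernel. This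
  permits completing a sum over nontrivial characters to one over all characters.\<close>

lemma det_twisted_laplacian_trivial:
  assumes vs: "distinct vs" "set vs = verts X"
  shows "det (mat_on vs vs (twisted_laplacian (trivial_char G))) = 0"
proof -
  let ?n = "length vs" and ?M = "mat_on vs vs (twisted_laplacian (trivial_char G))"
  let ?v = "Matrix.vec ?n (\<lambda>_. 1 :: complex)"
  have "verts X \<noteq> {}" using connected_Y proj(1) by (auto simp: connected_conv)
  then have "?n > 0" using vs(2) by (cases vs) auto
  then have "vec_index ?v 0 \<noteq> vec_index (0\<^sub>v ?n) 0" by simp
  then have "?v \<noteq> 0\<^sub>v ?n" by metis
  moreover have "?M *\<^sub>v ?v = 0\<^sub>v ?n"
  proof (rule eq_vecI)
    fix i assume "i < dim_vec (0\<^sub>v ?n :: complex Matrix.vec)"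
    then have i: "i < ?n" by simp
    let ?x = "vs ! i"
    have x: "?x \<in> verts X" using i vs nth_mem by blast
    have "vec_index (?M *\<^sub>v ?v) i = (\<Sum>j<?n. twisted_laplacian (trivial_char G) ?x (vs ! j))"
      using i by (simp add: scalar_prod_def atLeast0LessThan)
    also have "\<dots> = (\<Sum>y\<in>verts X. twisted_laplacian (trivial_char G) ?x y)"
      using sum_nth_distinct[OF vs(1), of "twisted_laplacian (trivial_char G) ?x"] vs(2) by simp
    also have "\<dots> = (\<Sum>y\<in>verts X. of_bool (?x = y) * of_nat (X.outdeg ?x))
        - (\<Sum>y\<in>verts X. \<Sum>a\<in>{a \<in> {a \<in> arcs X. tail X a = ?x}. head X a = y}. 1)"
      unfolding sum_subtractf[symmetric] twisted_laplacian_def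
      by (intro sum.cong arg_cong2[where f = "(-)"]) (auto simp: trivial_char_def)
    also have "(\<Sum>y\<in>verts X. \<Sum>a\<in>{a \<in> {a \<in> arcs X. tail X a = ?x}. head X a = y}. 1 :: complex)
        = (\<Sum>a\<in>{a \<in> arcs X. tail X a = ?x}. 1)"
      by (rule sum.group) auto
    also have "(\<Sum>y\<in>verts X. of_bool (?x = y) * of_nat (X.outdeg ?x)) = (of_nat (X.outdeg ?x) :: complex)"
      using x by (subst sum_of_bool_eq) simp_all
    finally show "vec_index (?M *\<^sub>v ?v) i = vec_index (0\<^sub>v ?n) i"
      using i by (simp add: X.outdeg_def)
  qed simp
  ultimately show ?thesis
    using det_0_iff_vec_prod_zero_field[of ?M ?n] by (metis mat_on_carrier vec_carrier)
qed

text \<open>Reversing arcs swaps their ends and inverts their voltages, so inverting the character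
  transposes the matrix.\<close>

lemma det_twisted_laplacian_inv:
  assumes \<psi>: "\<psi> \<in> characters G"
  shows "det (mat_on vs vs (twisted_laplacian (\<lambda>g\<in>carrier G. \<psi> (inv\<^bsub>G\<^esub> g))))
    = det (mat_on vs vs (twisted_laplacian \<psi>))"
proof -
  have "twisted_laplacian (\<lambda>g\<in>carrier G. \<psi> (inv\<^bsub>G\<^esub> g)) = (\<lambda>x y. twisted_laplacian \<psi> y x)"
  proof (intro ext)
    fix x y
    have "(\<Sum>a\<in>{a \<in> arcs X. tail X a = x \<and> head X a = y}. (\<lambda>g\<in>carrier G. \<psi> (inv\<^bsub>G\<^esub> g)) (voltage a))
        = (\<Sum>a\<in>{a \<in> arcs X. tail X a = y \<and> head X a = x}. \<psi> (voltage a))"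
      by (rule sum.reindex_bij_witness[of _ r r]) (auto simp: voltage_rev)
    moreover have "of_bool (x = y) * of_nat (X.outdeg x) = (of_bool (y = x) * of_nat (X.outdeg y) :: complex)"
      by auto
    ultimately show "twisted_laplacian (\<lambda>g\<in>carrier G. \<psi> (inv\<^bsub>G\<^esub> g)) x y = twisted_laplacian \<psi> y x"
      unfolding twisted_laplacian_def by (simp only:)
  qed
  then show ?thesis
    by (rule ssubst) (rule det_mat_on_transpose)
qed

text \<open>Ring homomorphisms commute with determinants, so one polynomial determinant accounts for
  all characters simultaneously.\<close>

lemma eval_at_det:
  assumes \<psi>: "\<psi> \<in> characters G"
  shows "eval_at \<psi> G (det (mat_on vs vs (twisted_laplacian variable))) = det (mat_on vs vs (twisted_laplacian \<psi>))"
proof -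
  interpret e: Ring_Hom.comm_ring_hom "eval_at \<psi> G" by (rule G.eval_at_hom[OF \<psi>])
  have var: "eval_at \<psi> G (variable g) = \<psi> g" if "g \<in> carrier G" for g
    using that by (simp add: eval_at_def G.monomial_value_single[OF finite_deck])
  have "eval_at \<psi> G (of_bool b) = of_bool b" for b by simp
  then have "eval_at \<psi> G (twisted_laplacian variable x y) = twisted_laplacian \<psi> x y" for x y
    by (simp add: twisted_laplacian_def e.hom_minus e.hom_mult e.hom_of_nat e.hom_sum var)
  then show ?thesis by (simp only: e.hom_det[symmetric] mat_on_map)
qed

lemma Pr_cmul: "D \<in> Pr Y s \<Longrightarrow> frag_cmul k D \<in> Pr Y s"
  using frag_closure_minus_cmul[of "\<lambda>D. D \<in> Pr Y s" D k] Pr_zero Pr_diff by blast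

lemma theta_annihilates:
  assumes deg: "\<And>w. w \<in> verts Y \<Longrightarrow> Y.outdeg w \<noteq> 1"
  shows "gr_mult G (theta_star_1 Y s X r \<pi>) (gr_minus (gr_of \<one>\<^bsub>G\<^esub>) (idem G (trivial_char G)))
    \<in> gr_of_int ` Ann_Jac Y s G"
proof -
  let ?N = "of_nat (order G) :: complex" and ?C = "characters G" and ?t = "trivial_char G"
  let ?\<theta>e = "gr_mult G (theta_star_1 Y s X r \<pi>) (gr_minus (gr_of \<one>\<^bsub>G\<^esub>) (idem G ?t))"
  have \<theta>e: "?\<theta>e g = (if g \<in> carrier G then (\<Sum>\<psi>\<in>?C - {?t}. L_star_1 Y s X r \<pi> \<psi> * \<psi> g) / ?N else 0)" for g
    by (rule G.gr_mult_augmentation[OF finite_deck]) (simp add: theta_star_1_def)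
  show ?thesis
  \<comment> \<open>An isolated vertex of the connected \<open>Y\<close> is all of \<open>Y\<close>,
    so the group is trivial and the element is 0. Otherwise all degrees are at least 2, as
    \<open>L_star_1_eq\<close> demands.\<close>
  proof (cases "\<exists>w\<in>verts Y. Y.outdeg w = 0")
    case True
    then obtain w where w: "w \<in> verts Y" "\<And>b. b \<in> arcs Y \<Longrightarrow> tail Y b \<noteq> w"
      by (auto simp: Y.outdeg_def)
    have "{w} = verts Y" by (rule connected_closed[of _ w]) (use w in auto)
    then have "g = \<one>\<^bsub>G\<^esub>" if "g \<in> carrier G" for g
      using deck_free[OF that w(1)] deck(1)[OF that w(1)] by blast
    then have "\<psi> = ?t" if "\<psi> \<in> ?C" for \<psi>
      using that G.character_one[OF that]
      by (force simp: trivial_char_def characters_iff extensional_def fun_eq_iff)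
    then have "?C - {?t} = {}" by blast
    then have "?\<theta>e = gr_of_int (\<lambda>_. 0)" by (intro ext) (simp only: \<theta>e, simp add: gr_of_int_def)
    moreover have "(\<lambda>_. 0) \<in> Ann_Jac Y s G"
      by (rule in_Ann_Jac) (simp_all add: gr_carrier_def div_action_def Pr_zero)
    ultimately show ?thesis by blast
  next
    case False
    have degX: "X.outdeg v \<ge> 2" if v: "v \<in> verts X" for v
    proof -
      obtain w where w: "w \<in> verts Y" "fst \<pi> w = v" using surj_verts[OF v] .
      then show ?thesis using False deg[OF w(1)] outdeg_cover[OF w(1)] by force
    qed
    obtain vs where vs: "set vs = verts X" "distinct vs"
      using finite_distinct_list[of "verts X"] by auto
    define k where "k = card (arcs X) div 2 - card (verts X)"
    define f where "f = det (mat_on vs vs (twisted_laplacian variable))"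
    define A where "A = Poly_Mapping.lookup (to_group_ring G f)"
    define \<alpha> where "\<alpha> = (\<lambda>g. (-2) ^ k * A g)"
    have A0: "A g = 0" if "g \<notin> carrier G" for g
      using that G.keys_to_group_ring[of f] by (auto simp: A_def in_keys_iff)
    \<comment> \<open>Evaluation yields \<open>\<psi> h\<close>, whereas
      \<open>fourier_inversion\<close> expects \<open>\<psi> (inv h)\<close>; the symmetry under
      inversion of characters bridges the two.\<close>
    have det: "det (mat_on vs vs (twisted_laplacian \<psi>)) = (\<Sum>h\<in>carrier G. of_int (A h) * \<psi> (inv\<^bsub>G\<^esub> h))"
      if \<psi>: "\<psi> \<in> ?C" for \<psi>
    proof -
      let ?\<psi> = "\<lambda>g\<in>carrier G. \<psi> (inv\<^bsub>G\<^esub> g)"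
      have c: "?\<psi> \<in> ?C"
        using \<psi> by (auto simp: characters_iff mult_on_def G.inv_mult)
      have "det (mat_on vs vs (twisted_laplacian \<psi>)) = eval_at ?\<psi> G f"
        unfolding f_def eval_at_det[OF c] by (rule det_twisted_laplacian_inv[OF \<psi>, symmetric])
      also have "\<dots> = (\<Sum>h\<in>carrier G. of_int (A h) * ?\<psi> h)"
        unfolding A_def by (rule G.eval_at_to_group_ring[OF finite_deck c, symmetric])
      finally show ?thesis by simp
    qed
    have "?\<theta>e g = gr_of_int \<alpha> g" for g
    proof (cases "g \<in> carrier G")
      case g: True
      have "(\<Sum>\<psi>\<in>?C - {?t}. L_star_1 Y s X r \<pi> \<psi> * \<psi> g)
          = (\<Sum>\<psi>\<in>?C - {?t}. (-2) ^ k * (det (mat_on vs vs (twisted_laplacian \<psi>)) * \<psi> g))"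
        using L_star_1_eq[OF _ _ vs(2,1) degX] by (intro sum.cong) (auto simp: k_def)
      \<comment> \<open>The trivial character returns with a zero determinant in place of its
        \<open>L_star_1\<close> value, which \<open>e\<close> has already removed.\<close>
      also have "\<dots> = (\<Sum>\<psi>\<in>?C. (-2) ^ k * (det (mat_on vs vs (twisted_laplacian \<psi>)) * \<psi> g))"
        using det_twisted_laplacian_trivial[OF vs(2,1)] G.finite_characters[OF finite_deck]
        by (intro sum.mono_neutral_left) auto
      also have "\<dots> = (-2) ^ k * (\<Sum>\<psi>\<in>?C. (\<Sum>h\<in>carrier G. of_int (A h) * \<psi> (inv\<^bsub>G\<^esub> h)) * \<psi> g)"
        by (simp add: sum_distrib_left[symmetric] det)
      also have "\<dots> = (-2) ^ k * (?N * of_int (A g))"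
        by (simp only: G.fourier_inversion[OF finite_deck g])
      finally have "?\<theta>e g = (-2) ^ k * (?N * of_int (A g)) / ?N" using g by (simp only: \<theta>e if_True)
      moreover have "?N \<noteq> 0" using finite_deck G.one_closed by (auto simp: order_def)
      ultimately show ?thesis by (simp add: gr_of_int_def \<alpha>_def)
    next
      case False
      then show ?thesis by (simp add: \<theta>e gr_of_int_def \<alpha>_def A0)
    qed
    then have "?\<theta>e = gr_of_int \<alpha>" by (rule ext)
    moreover have "\<alpha> \<in> Ann_Jac Y s G"
    proof (rule in_Ann_Jac)
      show "\<alpha> \<in> gr_carrier G" by (simp add: gr_carrier_def \<alpha>_def A0)
      fix D assume D: "D \<in> divisors"
      have "div_action G \<alpha> D = frag_cmul ((-2) ^ k) (act f D)"
        unfolding act_eq_div_action A_def[symmetric] by (simp add: div_action_def \<alpha>_def frag_cmul_sum)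
      then show "div_action G \<alpha> D \<in> Pr Y s"
        unfolding f_def using det_act_Pr[OF vs(2,1) D] Pr_cmul by simp
    qed
    ultimately show ?thesis by blast
  qed
qed

end

theorem theorem4p7:
  fixes X :: "('v, 'a) pre_digraph" and r :: "'a \<Rightarrow> 'a"
    and Y :: "('w, 'b) pre_digraph" and s :: "'b \<Rightarrow> 'b"
    and \<pi> :: "('w \<Rightarrow> 'v) \<times> ('b \<Rightarrow> 'a)"
    and G :: "(('w \<Rightarrow> 'w) \<times> ('b \<Rightarrow> 'b)) monoid"
    and e :: "('w \<Rightarrow> 'w) \<times> ('b \<Rightarrow> 'b) \<Rightarrow> complex"
  assumes "finite_multigraph X r" and "finite_multigraph Y s"
    and "Digraph_Component.connected X" and "Digraph_Component.connected Y"
    and "\<forall>v\<in>verts X. vdegree X r v \<noteq> 1" and "\<forall>w\<in>verts Y. vdegree Y s w \<noteq> 1"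
    and "abelian_cover Y s X r \<pi>"
  defines "G \<equiv> deck_group Y s \<pi>"
    and "e \<equiv> gr_minus (gr_of \<one>\<^bsub>G\<^esub>) (idem G (trivial_char G))"
  shows "gr_mult G (theta_star_1 Y s X r \<pi>) e \<in> gr_of_int ` Ann_Jac Y s G"
proof -
  interpret abelian_covering X r Y s \<pi> using assms by unfold_locales
  show ?thesis unfolding e_def G_def
    by (rule theta_annihilates) (use assms(6) in \<open>simp add: Y.vdegree_eq\<close>)
qed

end
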